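(* Let $d\in\mathbb{N}$ and $1\le p<q<\infty$. Then there is a constant $C>0$, independent of $n$ and $f$, such that $$\|f-I_nf\|_{L_q([0,1]^d)}\le C\,2^{-n/q}\,n^{(d-1)/q}\,\|f|S^{1/p}_{p,1}B([0,1]^d)\|$$ holds for all $n\in\mathbb{N}$ and all $f\in S^{1/p}_{p,1}B([0,1]^d)$, where $I_n$ is the truncated Faber-Schauder series operator.
   Context: Notation: $\mathbb{N}=\{1,2,\dots\}$, $\mathbb{N}_0=\mathbb{N}\cup\{0\}$, $\mathbb{N}_{-1}=\mathbb{N}_0\cup\{-1\}$, $a_+=\max\{a,0\}$, $|x|_1=\sum_i|x_i|$. Function spaces. Let $\mathcal{F}$ be the Fourier transform on $\mathbb{R}^d$, $\mathcal{F}f(\xi)=(2\pi)^{-d/2}\int_{\mathbb{R}^d}f(x)e^{-i\xi\cdot x}dx$. Fix a system $\varphi=\{\varphi_n\}_{n=0}^\infty\subset C_0^\infty(\mathbb{R})$ with (i) $\operatorname{supp}\varphi_0\subset\{|x|\le 2\}$; (ii) $\operatorname{supp}\varphi_n\subset\{2^{n-1}\le|x|\le 2^{n+1}\}$ for $n\ge1$; (iii) for every $\ell\in\mathbb{N}_0$, $\sup_{x,n}2^{n\ell}|D^\ell\varphi_n(x)|<\infty$; (iv) $\sum_{n=0}^\infty\varphi_n(x)=1$ for all $x\in\mathbb{R}$. For $f\in L_1(\mathbb{R}^d)$ and $\ell\in\mathbb{N}_0^d$ put $f_\ell=\mathcal{F}^{-1}[\varphi_{\ell_1}(\xi_1)\cdots\varphi_{\ell_d}(\xi_d)\mathcal{F}f(\xi)]$.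 For $0<p,q\le\infty$ and $r>(1/p-1)_+$, $S^r_{p,q}B(\mathbb{R}^d)$ is the set of all $f\in L_1(\mathbb{R}^d)$ with $\|f|S^r_{p,q}B(\mathbb{R}^d)\|=\big(\sum_{j\in\mathbb{N}_0^d}2^{|j|_1rq}\|f_j\|_p^q\big)^{1/q}<\infty$ (usual modification for $q=\infty$). The space $S^r_{p,q}B([0,1]^d)$ consists of all $f\in L_1([0,1]^d)$ that are restrictions to $[0,1]^d$ of some $g\in S^r_{p,q}B(\mathbb{R}^d)$, with $\|f|S^r_{p,q}B([0,1]^d)\|$ the infimum of $\|g|S^r_{p,q}B(\mathbb{R}^d)\|$ over all such $g$. Elements of $S^{1/p}_{p,1}B([0,1]^d)$ are identified with their continuous representatives. Faber-Schauder system on $[0,1]^d$. Let $v:\mathbb{R}\to\mathbb{R}$ be the hat function supported on $[0,1]$, $v(x)=2x$ on $[0,1/2]$, $v(x)=2(1-x)$ on $[1/2,1]$, and $0$ otherwise. For $j\in\mathbb{N}_0$ put $\mathbb{D}_j=\{0,1,\dots,2^j-1\}$ and $v_{j,k}(x)=v(2^jx-k)$; for $j=-1$ put $\mathbb{D}_{-1}=\{0,1\}$, $v_{-1,0}(x)=1-x$, $v_{-1,1}(x)=x$. For $j\in\mathbb{N}_{-1}^d$ put $\mathbb{D}_j=\mathbb{D}_{j_1}\times\cdots\times\mathbb{D}_{j_d}$ and $v_{j,k}(x)=\prod_{i=1}^dv_{j_i,k_i}(x_i)$. For $f\in C([0,1]^d)$, $j\in\mathbb{N}_{-1}^d$, $k\in\mathbb{D}_j$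 let $e(j)=\{i:j_i\ne-1\}$, $x_{j,k}=(2^{-(j_1)_+}k_1,\dots,2^{-(j_d)_+}k_d)$ and $$d^2_{j,k}(f)=(-2)^{-|e(j)|}\Big(\prod_{i\in e(j)}\Delta^{2,i}_{2^{-(j_i+1)}}\Big)f(x_{j,k}),$$ where $|e(j)|$ is the cardinality of $e(j)$ and $\Delta^{2,i}_hf(x)=f(x+2he_i)-2f(x+he_i)+f(x)$, with $e_i$ the $i$-th unit vector. The truncated Faber-Schauder series is $$I_nf=\sum_{j\in\mathbb{N}_{-1}^d,\ |j|_1\le n}\ \sum_{k\in\mathbb{D}_j}d^2_{j,k}(f)\,v_{j,k}.$$ *)

theory Defs
  imports "HOL-Analysis.Analysis"
begin

section \<open>Smooth dyadic resolutions of unity\<close>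

definition iter_deriv :: "nat \<Rightarrow> (real \<Rightarrow> complex) \<Rightarrow> real \<Rightarrow> complex" where
  "iter_deriv l f = ((\<lambda>g x. vector_derivative g (at x)) ^^ l) f"

definition smooth :: "(real \<Rightarrow> complex) \<Rightarrow> bool" where
  "smooth f \<longleftrightarrow> (\<forall>l x. iter_deriv l f differentiable (at x))"

definition supp :: "(real \<Rightarrow> complex) \<Rightarrow> real set" where
  "supp f = closure {x. f x \<noteq> 0}"

definition resolution_of_unity :: "(nat \<Rightarrow> real \<Rightarrow> complex) \<Rightarrow> bool" where
  "resolution_of_unity \<phi> \<longleftrightarrow>
     (\<forall>n. smooth (\<phi> n) \<and> compact (supp (\<phi> n))) \<and>
     supp (\<phi> 0) \<subseteq> {x. \<bar>x\<bar> \<le> 2} \<and>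
     (\<forall>n\<ge>1. supp (\<phi> n) \<subseteq> {x. 2 ^ (n - 1) \<le> \<bar>x\<bar> \<and> \<bar>x\<bar> \<le> 2 ^ (n + 1)}) \<and>
     (\<forall>l. \<exists>B. \<forall>n x. 2 ^ (n * l) * norm (iter_deriv l (\<phi> n) x) \<le> B) \<and>
     (\<forall>x. (\<lambda>n. \<phi> n x) sums 1)"

section \<open>Fourier transform and frequency blocks\<close>

definition fourier :: "(real ^ 'd \<Rightarrow> complex) \<Rightarrow> real ^ 'd \<Rightarrow> complex" where
  "fourier f \<xi> = of_real ((2 * pi) powr (- real CARD('d) / 2)) *
     (\<integral>x. f x * exp (- \<i> * of_real (\<xi> \<bullet> x)) \<partial>lebesgue)"

definition inv_fourier :: "(real ^ 'd \<Rightarrow> complex) \<Rightarrow> real ^ 'd \<Rightarrow> complex" where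
  "inv_fourier g x = of_real ((2 * pi) powr (- real CARD('d) / 2)) *
     (\<integral>\<xi>. g \<xi> * exp (\<i> * of_real (x \<bullet> \<xi>)) \<partial>lebesgue)"

definition freq_block ::
    "(nat \<Rightarrow> real \<Rightarrow> complex) \<Rightarrow> nat ^ 'd \<Rightarrow> (real ^ 'd \<Rightarrow> complex) \<Rightarrow> real ^ 'd \<Rightarrow> complex" where
  "freq_block \<phi> l f = inv_fourier (\<lambda>\<xi>. (\<Prod>i\<in>UNIV. \<phi> (l $ i) (\<xi> $ i)) * fourier f \<xi>)"

section \<open>Besov spaces of dominating mixed smoothness\<close>

text \<open>Norms take values in the extended nonnegative reals, so they are defined for every
  function, being infinite exactly where the underlying integral, series or infimum is.
  Only finite integrability indices \<open>p, q > 0\<close> are covered, so there is no supremum case.\<close>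

text \<open>Meant for a positive exponent only.\<close>

definition ennpowr :: "ennreal \<Rightarrow> real \<Rightarrow> ennreal" where
  "ennpowr t a = (if t = \<infinity> then \<infinity> else ennreal (enn2real t powr a))"

definition Lp_norm :: "'a measure \<Rightarrow> real \<Rightarrow> ('a \<Rightarrow> complex) \<Rightarrow> ennreal" where
  "Lp_norm M p f = ennpowr (\<integral>\<^sup>+ x. ennreal (norm (f x) powr p) \<partial>M) (1 / p)"

definition SB_norm ::
    "(nat \<Rightarrow> real \<Rightarrow> complex) \<Rightarrow> real \<Rightarrow> real \<Rightarrow> real \<Rightarrow> (real ^ 'd \<Rightarrow> complex) \<Rightarrow> ennreal" where
  "SB_norm \<phi> r p q f =
     ennpowr (\<Sum>\<^sub>\<infinity>j\<in>(UNIV :: (nat ^ 'd) set).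
       ennreal (2 powr (real (\<Sum>i\<in>UNIV. j $ i) * r * q)) *
       ennpowr (Lp_norm lebesgue p (freq_block \<phi> j f)) q) (1 / q)"

definition SB ::
    "(nat \<Rightarrow> real \<Rightarrow> complex) \<Rightarrow> real \<Rightarrow> real \<Rightarrow> real \<Rightarrow> (real ^ 'd \<Rightarrow> complex) set" where
  "SB \<phi> r p q = {f. integrable lebesgue f \<and> SB_norm \<phi> r p q f < \<infinity>}"

abbreviation unit_cube :: "(real ^ 'd) set" where
  "unit_cube \<equiv> cbox 0 1"

text \<open>Elements of \<open>L\<^sub>1\<close> are represented by functions, so being a restriction to the cube
  means equality almost everywhere on the cube.\<close>

definition SB_extensions ::
    "(nat \<Rightarrow> real \<Rightarrow> complex) \<Rightarrow> real \<Rightarrow> real \<Rightarrow> real \<Rightarrow> (real ^ 'd \<Rightarrow> complex) \<Rightarrow>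
     (real ^ 'd \<Rightarrow> complex) set" where
  "SB_extensions \<phi> r p q f =
     {g \<in> SB \<phi> r p q. AE x in lebesgue_on unit_cube. f x = g x}"

definition SB_cube ::
    "(nat \<Rightarrow> real \<Rightarrow> complex) \<Rightarrow> real \<Rightarrow> real \<Rightarrow> real \<Rightarrow> (real ^ 'd \<Rightarrow> complex) set" where
  "SB_cube \<phi> r p q =
     {f. integrable (lebesgue_on unit_cube) f \<and> SB_extensions \<phi> r p q f \<noteq> {}}"

definition SB_cube_norm ::
    "(nat \<Rightarrow> real \<Rightarrow> complex) \<Rightarrow> real \<Rightarrow> real \<Rightarrow> real \<Rightarrow> (real ^ 'd \<Rightarrow> complex) \<Rightarrow> ennreal" where
  "SB_cube_norm \<phi> r p q f = (INF g\<in>SB_extensions \<phi> r p q f. SB_norm \<phi> r p q g)"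

section \<open>The Faber--Schauder system\<close>

definition hat :: "real \<Rightarrow> real" where
  "hat x = (if 0 \<le> x \<and> x \<le> 1/2 then 2 * x
            else if 1/2 \<le> x \<and> x \<le> 1 then 2 * (1 - x) else 0)"

text \<open>Levels are integers \<open>\<ge> -1\<close>; in all definitions below other levels are irrelevant.\<close>

definition pos_set :: "int \<Rightarrow> int set" where
  "pos_set j = (if j = -1 then {0, 1} else {0 .. 2 ^ nat j - 1})"

definition faber1 :: "int \<Rightarrow> int \<Rightarrow> real \<Rightarrow> real" where
  "faber1 j k x =
     (if j = -1 then (if k = 0 then 1 - x else x)
      else hat (2 ^ nat j * x - of_int k))"

definition pos_set_d :: "int ^ 'd \<Rightarrow> (int ^ 'd) set" where
  "pos_set_d j = {k. \<forall>i. k $ i \<in> pos_set (j $ i)}"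

definition faber :: "int ^ 'd \<Rightarrow> int ^ 'd \<Rightarrow> real ^ 'd \<Rightarrow> real" where
  "faber j k x = (\<Prod>i\<in>UNIV. faber1 (j $ i) (k $ i) (x $ i))"

definition diff2 :: "'d \<Rightarrow> real \<Rightarrow> (real ^ 'd \<Rightarrow> complex) \<Rightarrow> real ^ 'd \<Rightarrow> complex" where
  "diff2 i h f x = f (x + (2 * h) *\<^sub>R axis i 1) - 2 * f (x + h *\<^sub>R axis i 1) + f x"

text \<open>The composition of the difference operators in the directions of a finite set. They
  commute, so the fold does not depend on an order of the directions.\<close>

lemma comp_fun_commute_diff2: "comp_fun_commute (\<lambda>i. diff2 i (h i))"
proof
  fix i j :: 'a
  show "diff2 j (h j) \<circ> diff2 i (h i) = diff2 i (h i) \<circ> diff2 j (h j)"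
    by (rule ext, rule ext) (simp add: diff2_def algebra_simps)
qed

definition diff2_set ::
    "'d set \<Rightarrow> ('d \<Rightarrow> real) \<Rightarrow> (real ^ 'd \<Rightarrow> complex) \<Rightarrow> real ^ 'd \<Rightarrow> complex" where
  "diff2_set A h f = Finite_Set.fold (\<lambda>i. diff2 i (h i)) f A"

lemma diff2_set_empty: "diff2_set {} h f = f"
  by (simp add: diff2_set_def)

lemma diff2_set_insert:
  fixes A :: "('d::finite) set"
  assumes "i \<notin> A"
  shows "diff2_set (insert i A) h f = diff2 i (h i) (diff2_set A h f)"
proof -
  interpret comp_fun_commute "\<lambda>i. diff2 i (h i)" by (rule comp_fun_commute_diff2)
  show ?thesis using assms by (simp add: diff2_set_def)
qed

definition active :: "int ^ 'd \<Rightarrow> 'd set" where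
  "active j = {i. j $ i \<noteq> -1}"

definition grid_point :: "int ^ 'd \<Rightarrow> int ^ 'd \<Rightarrow> real ^ 'd" where
  "grid_point j k = (\<chi> i. 2 powr (- real_of_int (max (j $ i) 0)) * of_int (k $ i))"

definition faber_coeff :: "int ^ 'd \<Rightarrow> int ^ 'd \<Rightarrow> (real ^ 'd \<Rightarrow> complex) \<Rightarrow> complex" where
  "faber_coeff j k f =
     (-2) powi (- int (card (active j))) *
     diff2_set (active j) (\<lambda>i. 2 powr (- real_of_int (j $ i + 1))) f (grid_point j k)"

definition levels :: "nat \<Rightarrow> (int ^ 'd) set" where
  "levels n = {j. (\<forall>i. j $ i \<ge> -1) \<and> (\<Sum>i\<in>UNIV. \<bar>j $ i\<bar>) \<le> int n}"

definition faber_trunc :: "nat \<Rightarrow> (real ^ 'd \<Rightarrow> complex) \<Rightarrow> real ^ 'd \<Rightarrow> complex" where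
  "faber_trunc n f x =
     (\<Sum>j\<in>levels n. \<Sum>k\<in>pos_set_d j. faber_coeff j k f * of_real (faber j k x))"

lemma finite_vec_range:
  fixes S :: "'d::finite \<Rightarrow> int set"
  assumes "\<And>i. finite (S i)"
  shows "finite {j :: int ^ 'd. \<forall>i. j $ i \<in> S i}"
proof (rule finite_imageD)
  show "finite (vec_nth ` {j :: int ^ 'd. \<forall>i. j $ i \<in> S i})"
    by (rule finite_subset[of _ "PiE UNIV S"]) (auto simp: finite_PiE assms)
  show "inj_on vec_nth {j :: int ^ 'd. \<forall>i. j $ i \<in> S i}"
    by (auto simp: inj_on_def vec_eq_iff)
qed

lemma finite_pos_set_d: "finite (pos_set_d j)"
  unfolding pos_set_d_def by (rule finite_vec_range) (simp add: pos_set_def)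

lemma finite_levels: "finite (levels n :: (int ^ 'd) set)"
proof (rule finite_subset)
  show "levels n \<subseteq> {j :: int ^ 'd. \<forall>i. j $ i \<in> {- int n .. int n}}"
  proof (clarsimp simp: levels_def)
    fix j :: "int ^ 'd" and i
    assume "(\<Sum>i\<in>UNIV. \<bar>j $ i\<bar>) \<le> int n"
    moreover have "\<bar>j $ i\<bar> \<le> (\<Sum>i\<in>UNIV. \<bar>j $ i\<bar>)" by (rule member_le_sum) auto
    ultimately show "- int n \<le> j $ i \<and> j $ i \<le> int n" by linarith
  qed
qed (rule finite_vec_range, simp)

end

theory Submission
  imports Defs "HOL-Probability.Sinc_Integral"
begin

text \<open>Write \<open>a\<^sub>m\<close> for the \<open>\<ell>\<^sub>p\<close> norm of the Faber--Schauder coefficients of level \<open>m\<close>. The proof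
  rests on two estimates. First, \<open>a\<^sub>m \<le> C \<parallel>f\<parallel>\<close> uniformly in \<open>m\<close>: a frequency block reproduces
  itself under convolution with a tensor product of de la Vallee Poussin kernels, so its
  coefficients are integrals of the block against tensor products of coefficients of these
  kernels; Schur's test applies because sums of second differences over the dyadic intervals of
  one level are bounded by the total variation of the kernel. Second, since \<open>p < q\<close>, a discrete
  Jawerth--Franke embedding bounds the \<open>q\<close>-th power of the \<open>L\<^sub>q\<close> norm of the sum of the levels
  \<open>\<bar>m\<bar> > n\<close> by a multiple of \<open>\<Sum> 2 powr (- \<bar>m\<bar>) a\<^sub>m powr q\<close>, and
  \<open>\<Sum>\<^bsub>\<bar>m\<bar> > n\<^esub> 2 powr (- \<bar>m\<bar>)\<close> is of order \<open>n ^ (d - 1) / 2 ^ n\<close>. The embedding is first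
  proved in one variable, where it follows from the Hoelder inequality with exponents on both
  sides of \<open>q\<close>, and then iterated over the coordinates with the Minkowski inequality.
  That a function is on the cube the sum of its frequency blocks is seen by testing against
  triangle bumps, whose Fourier transforms are Fejer kernels.\<close>

section \<open>Discrete Hoelder and Minkowski inequalities\<close>

text \<open>The exponents balance without slack. Reproducing a block of frequency index l costs a
  factor 2 ^ |l| in the p-th power of the coefficient norm, the size of the supremum and of the
  variation of the kernel; the smoothness 1/p compensates exactly this. Hence blocks are added by
  the triangle inequality, which is where the third index 1 enters, and the coefficient norms do not
  decay with the level. All decay comes from the measure 2 powr (-|m|) of the support of a Faber
  function. Adding the levels in L_q by the triangle inequality would give the factor n ^ (d - 1)
  without the root 1/q; the embedding sums q-th powers instead. Its Hoelder step uses p / (p - 1),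
  so p is first raised to (p + q) / 2, which also covers p = 1. The series of f is not summed
  directly: its partial sums over cubes of levels interpolate f on dyadic grids and converge
  pointwise for continuous f, and Fatou's lemma carries a bound uniform in the cube to the
  limit.\<close>

lemma holder_sum:
  fixes w a b :: "'a \<Rightarrow> real" and p r :: real
  assumes p: "p > 1" "1/p + 1/r = 1"
    and w: "\<And>x. x \<in> A \<Longrightarrow> w x \<ge> 0"
    and a: "\<And>x. x \<in> A \<Longrightarrow> a x \<ge> 0" and b: "\<And>x. x \<in> A \<Longrightarrow> b x \<ge> 0"
  shows "(\<Sum>x\<in>A. w x * (a x * b x)) \<le>
    (\<Sum>x\<in>A. w x * a x powr p) powr (1/p) * (\<Sum>x\<in>A. w x * b x powr r) powr (1/r)"
proof (cases "finite A")
  case False then show ?thesis by simp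
next
  case fin: True
  have r: "r > 1" using p by (smt (verit, best) divide_pos_pos le_divide_eq_1_pos divide_nonneg_neg divide_less_eq_1_pos zero_less_divide_iff div_by_0)
  define X where "X = (\<Sum>x\<in>A. w x * a x powr p)"
  define Y where "Y = (\<Sum>x\<in>A. w x * b x powr r)"
  have X0: "X \<ge> 0" and Y0: "Y \<ge> 0" unfolding X_def Y_def by (auto intro!: sum_nonneg mult_nonneg_nonneg w)
  show ?thesis
  proof (cases "X = 0 \<or> Y = 0")
    case True
    then have "\<forall>x\<in>A. w x * (a x * b x) = 0"
    proof
      assume "X = 0"
      then have "\<forall>x\<in>A. w x * a x powr p = 0" unfolding X_def
        using sum_nonneg_eq_0_iff[OF fin, of "\<lambda>x. w x * a x powr p"] w by auto
      then show ?thesis by auto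
    next
      assume "Y = 0"
      then have "\<forall>x\<in>A. w x * b x powr r = 0" unfolding Y_def
        using sum_nonneg_eq_0_iff[OF fin, of "\<lambda>x. w x * b x powr r"] w by auto
      then show ?thesis by auto
    qed
    then have "(\<Sum>x\<in>A. w x * (a x * b x)) = 0" by (intro sum.neutral)
    then show ?thesis by simp
  next
    case False
    then have X: "X > 0" and Y: "Y > 0" using X0 Y0 by auto
    define \<alpha> where "\<alpha> = X powr (1/p)"
    define \<beta> where "\<beta> = Y powr (1/r)"
    have ab: "\<alpha> > 0" "\<beta> > 0" using X Y by (auto simp: \<alpha>_def \<beta>_def)
    have e: "\<alpha> powr p = X" "\<beta> powr r = Y" using X Y p r by (auto simp: \<alpha>_def \<beta>_def powr_powr)
    have "(\<Sum>x\<in>A. w x * (a x * b x)) = \<alpha> * \<beta> * (\<Sum>x\<in>A. w x * (a x / \<alpha> * (b x / \<beta>)))"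
      using ab by (simp add: sum_distrib_left)
    also have "\<dots> \<le> \<alpha> * \<beta> * (\<Sum>x\<in>A. w x * ((a x / \<alpha>) powr p / p + (b x / \<beta>) powr r / r))"
      using ab p r w a b by (intro mult_left_mono sum_mono Youngs_inequality) auto
    also have "(\<Sum>x\<in>A. w x * ((a x / \<alpha>) powr p / p + (b x / \<beta>) powr r / r)) =
       (\<Sum>x\<in>A. w x * a x powr p / X / p + w x * b x powr r / Y / r)"
      by (intro sum.cong refl) (use ab a b e in \<open>simp add: powr_divide algebra_simps\<close>)
    also have "\<dots> = X / X / p + Y / Y / r"
      by (simp add: sum.distrib X_def Y_def flip: sum_divide_distrib)
    also have "\<dots> = 1" using X Y p by simp
    finally show ?thesis by (simp add: \<alpha>_def \<beta>_def X_def Y_def)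
  qed
qed

text \<open>One factor of the p-th power is split over \<open>J\<close> and paired by Hoelder with
  the remaining power p - 1; the conjugate exponent r satisfies (p - 1) r = p, so the second factor
  is again the whole sum, raised to 1/r, and cancels. The weight serves both for cell volumes and,
  equal to 1, for sums of coefficients.\<close>

lemma minkowski_sum:
  fixes w :: "'a \<Rightarrow> real" and c :: "'j \<Rightarrow> 'a \<Rightarrow> real" and p :: real
  assumes p: "p \<ge> 1"
    and w: "\<And>x. x \<in> A \<Longrightarrow> w x \<ge> 0"
    and c: "\<And>j x. j \<in> J \<Longrightarrow> x \<in> A \<Longrightarrow> c j x \<ge> 0"
  shows "(\<Sum>x\<in>A. w x * (\<Sum>j\<in>J. c j x) powr p) powr (1/p) \<le>
     (\<Sum>j\<in>J. (\<Sum>x\<in>A. w x * c j x powr p) powr (1/p))"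
proof (cases "p = 1")
  case True
  have "(\<Sum>x\<in>A. w x * (\<Sum>j\<in>J. c j x)) = (\<Sum>j\<in>J. \<Sum>x\<in>A. w x * c j x)"
    by (subst sum.swap) (simp add: sum_distrib_left)
  moreover have "(\<Sum>x\<in>A. w x * (\<Sum>j\<in>J. c j x)) \<ge> 0" "\<And>j. j \<in> J \<Longrightarrow> (\<Sum>x\<in>A. w x * c j x) \<ge> 0"
    using w c by (auto intro!: sum_nonneg mult_nonneg_nonneg)
  ultimately show ?thesis using True w c by (simp add: sum_nonneg)
next
  case False
  then have p: "p > 1" using p by simp
  define r where "r = p / (p - 1)"
  have r: "1/p + 1/r = 1" "r > 1" using p by (auto simp: r_def field_simps)
  define s where "s x = (\<Sum>j\<in>J. c j x)" for x
  have s0: "s x \<ge> 0" if "x \<in> A" for x using c that by (auto simp: s_def intro!: sum_nonneg)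
  define T where "T = (\<Sum>x\<in>A. w x * s x powr p)"
  have T0: "T \<ge> 0" unfolding T_def by (auto intro!: sum_nonneg mult_nonneg_nonneg w)
  define Q where "Q = (\<Sum>j\<in>J. (\<Sum>x\<in>A. w x * c j x powr p) powr (1/p))"
  have "T = (\<Sum>x\<in>A. w x * (s x * s x powr (p - 1)))"
    unfolding T_def using s0 p by (intro sum.cong refl) (simp add: powr_mult_base)
  also have "\<dots> = (\<Sum>j\<in>J. \<Sum>x\<in>A. w x * (c j x * s x powr (p - 1)))"
    by (subst sum.swap) (simp add: s_def sum_distrib_left sum_distrib_right)
  also have "\<dots> \<le> (\<Sum>j\<in>J. (\<Sum>x\<in>A. w x * c j x powr p) powr (1/p) * (\<Sum>x\<in>A. w x * (s x powr (p - 1)) powr r) powr (1/r))"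
    using p r w c s0 by (intro sum_mono holder_sum) auto
  also have "(\<Sum>x\<in>A. w x * (s x powr (p - 1)) powr r) = T"
    using p by (simp add: T_def powr_powr r_def)
  also have "(\<Sum>j\<in>J. (\<Sum>x\<in>A. w x * c j x powr p) powr (1/p) * T powr (1/r)) = Q * T powr (1/r)"
    by (simp add: Q_def sum_distrib_right)
  finally have *: "T \<le> Q * T powr (1/r)" .
  show ?thesis
  proof (cases "T = 0")
    case True
    then show ?thesis unfolding T_def s_def by (simp add: sum_nonneg)
  next
    case False
    then have T: "T > 0" using T0 by simp
    have "T powr (1/p) * T powr (1/r) = T" using r T by (simp flip: powr_add)
    with * T have "T powr (1/p) \<le> Q" by (metis mult_le_cancel_right_pos powr_gt_zero less_irrefl)
    then show ?thesis by (simp add: T_def s_def Q_def)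
  qed
qed

text \<open>Discrete version of d(S^q) = q S^(q-1) dS. The mean value theorem evaluates the
  derivative below the new partial sum, so the partial sum on the right includes the current term.
  This replaces the q-th power of a sum over levels by pairings of one level with the levels up to
  it.\<close>

lemma powr_sum_telescope:
  fixes F :: "nat \<Rightarrow> real" and q :: real
  assumes q: "q > 1" and F: "\<And>i. F i \<ge> 0"
  shows "(\<Sum>i\<le>N. F i) powr q \<le> q * (\<Sum>i\<le>N. F i * (\<Sum>l\<le>i. F l) powr (q - 1))"
proof (induction N)
  case 0
  have "F 0 powr q = F 0 * F 0 powr (q - 1)" using F[of 0] q by (simp add: powr_mult_base)
  moreover have "F 0 * F 0 powr (q - 1) \<le> q * (F 0 * F 0 powr (q - 1))"
    using q F[of 0] by (simp add: mult_le_cancel_right1 not_less)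
  ultimately show ?case by simp
next
  case (Suc N)
  define a where "a = (\<Sum>i\<le>N. F i)"
  define b where "b = F (Suc N)"
  have a: "a \<ge> 0" and b: "b \<ge> 0" using F by (auto simp: a_def b_def intro!: sum_nonneg)
  have "(a + b) powr q - a powr q \<le> q * (b * (a + b) powr (q - 1))"
  \<comment> \<open>The derivative rule for \<open>powr\<close> needs a positive base, so a
    vanishing old sum is treated by hand.\<close>
  proof (cases "b = 0 \<or> a = 0")
    case True
    then show ?thesis
    proof
      assume "a = 0"
      have "b powr q = b * b powr (q - 1)" using b q by (simp add: powr_mult_base)
      moreover have "b * b powr (q - 1) \<le> q * (b * b powr (q - 1))"
        using q b by (simp add: mult_le_cancel_right1 not_less)
      ultimately show ?thesis using \<open>a = 0\<close> by simp
    qed auto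
  next
    case False
    then have a: "a > 0" and b: "b > 0" using a b by auto
    have "\<exists>z. z > a \<and> z < a + b \<and> (a + b) powr q - a powr q = (a + b - a) * (q * z powr (q - 1))"
      using a b by (intro MVT2) (auto intro!: has_real_derivative_powr)
    then obtain z where z: "z > a" "z < a + b" "(a + b) powr q - a powr q = b * (q * z powr (q - 1))"
      by auto
    have "z powr (q - 1) \<le> (a + b) powr (q - 1)" using z a q by (intro powr_mono2) auto
    then show ?thesis using z b q by (simp add: mult_left_mono mult.left_commute)
  qed
  with Suc show ?case by (simp add: a_def b_def algebra_simps)
qed

text \<open>Young's inequality for convolution with a geometric sequence, whose l_1 norm is at most
  1 / (1 - \<theta>). Hoelder with the weights \<open>\<theta> ^ (i - l)\<close> contributes the
  power q - 1 of this norm, the exchange of the two sums one more.\<close>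

lemma geometric_convolution:
  fixes b :: "nat \<Rightarrow> real" and \<theta> q :: real
  assumes \<theta>: "0 < \<theta>" "\<theta> < 1" and q: "q > 1" and b: "\<And>i. b i \<ge> 0"
  shows "(\<Sum>i\<le>N. (\<Sum>l\<le>i. \<theta> ^ (i - l) * b l) powr q) \<le> (1 / (1 - \<theta>)) powr q * (\<Sum>l\<le>N. b l powr q)"
proof -
  define W where "W = 1 / (1 - \<theta>)"
  have W: "W \<ge> 1" using \<theta> by (simp add: W_def)
  have geo: "(\<Sum>t\<le>n. \<theta> ^ t) \<le> W" for n
    using \<theta> sum_le_suminf[of "\<lambda>t. \<theta> ^ t" "{..n}"] by (auto simp: W_def suminf_geometric summable_geometric)
  define r where "r = q / (q - 1)"
  have r: "1/r + 1/q = 1" "r > 1" using q by (auto simp: r_def field_simps)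
  have "(\<Sum>l\<le>i. \<theta> ^ (i - l) * b l) powr q \<le> W powr (q - 1) * (\<Sum>l\<le>i. \<theta> ^ (i - l) * b l powr q)" for i
  proof -
    have "(\<Sum>l\<le>i. \<theta> ^ (i - l) * (1 * b l)) \<le> (\<Sum>l\<le>i. \<theta> ^ (i - l) * 1 powr r) powr (1/r) * (\<Sum>l\<le>i. \<theta> ^ (i - l) * b l powr q) powr (1/q)"
      using r b \<theta> by (intro holder_sum) auto
    also have "(\<Sum>l\<le>i. \<theta> ^ (i - l) * 1 powr r) = (\<Sum>t\<le>i. \<theta> ^ t)"
      by (intro sum.reindex_bij_witness[of _ "\<lambda>t. i - t" "\<lambda>l. i - l"]) auto
    also have "(\<Sum>t\<le>i. \<theta> ^ t) powr (1/r) \<le> W powr (1/r)" using geo r \<theta> by (intro powr_mono2) (auto intro!: sum_nonneg)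
    finally have "(\<Sum>l\<le>i. \<theta> ^ (i - l) * b l) \<le> W powr (1/r) * (\<Sum>l\<le>i. \<theta> ^ (i - l) * b l powr q) powr (1/q)"
      by (simp add: mult_right_mono)
    then have "(\<Sum>l\<le>i. \<theta> ^ (i - l) * b l) powr q \<le> (W powr (1/r) * (\<Sum>l\<le>i. \<theta> ^ (i - l) * b l powr q) powr (1/q)) powr q"
      using q b \<theta> by (intro powr_mono2) (auto intro!: sum_nonneg)
    also have "\<dots> = W powr (q - 1) * (\<Sum>l\<le>i. \<theta> ^ (i - l) * b l powr q)"
      using q b \<theta> by (simp add: powr_mult powr_powr r_def sum_nonneg)
    finally show ?thesis .
  qed
  then have "(\<Sum>i\<le>N. (\<Sum>l\<le>i. \<theta> ^ (i - l) * b l) powr q) \<le> (\<Sum>i\<le>N. W powr (q - 1) * (\<Sum>l\<le>i. \<theta> ^ (i - l) * b l powr q))"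
    by (intro sum_mono)
  also have "\<dots> = W powr (q - 1) * (\<Sum>i\<le>N. \<Sum>l\<le>i. \<theta> ^ (i - l) * b l powr q)"
    by (simp add: sum_distrib_left)
  also have "(\<Sum>i\<le>N. \<Sum>l\<le>i. \<theta> ^ (i - l) * b l powr q) = (\<Sum>l\<le>N. \<Sum>i\<in>{l..N}. \<theta> ^ (i - l) * b l powr q)"
    by (simp add: sum.Sigma, intro sum.reindex_bij_witness[of _ "\<lambda>(a, b). (b, a)" "\<lambda>(a, b). (b, a)"]) auto
  also have "\<dots> \<le> (\<Sum>l\<le>N. W * b l powr q)"
  proof (intro sum_mono)
    fix l assume "l \<in> {..N}"
    have "(\<Sum>i\<in>{l..N}. \<theta> ^ (i - l) * b l powr q) = (\<Sum>i\<in>{l..N}. \<theta> ^ (i - l)) * b l powr q"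
      by (simp add: sum_distrib_right)
    also have "(\<Sum>i\<in>{l..N}. \<theta> ^ (i - l)) = (\<Sum>t\<le>N - l. \<theta> ^ t)"
      using \<open>l \<in> {..N}\<close> by (intro sum.reindex_bij_witness[of _ "\<lambda>t. t + l" "\<lambda>i. i - l"]) auto
    finally show "(\<Sum>i\<in>{l..N}. \<theta> ^ (i - l) * b l powr q) \<le> W * b l powr q"
      using geo by (simp add: mult_right_mono)
  qed
  finally have "(\<Sum>i\<le>N. (\<Sum>l\<le>i. \<theta> ^ (i - l) * b l) powr q) \<le> W powr (q - 1) * (\<Sum>l\<le>N. W * b l powr q)"
    using W by (simp add: mult_left_mono)
  also have "\<dots> = W powr q * (\<Sum>l\<le>N. b l powr q)"
    using W q by (simp add: powr_diff sum_distrib_left[symmetric])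
  finally show ?thesis by (simp add: W_def)
qed

text \<open>The factor q stems from \<open>powr_sum_telescope\<close> and the inner power from
  \<open>geometric_convolution\<close> with ratio 2 powr (- (1/q - 1/r)). The ratio is less than 1
  because r - q = (q - p) / (p - 1) is positive.\<close>

definition emb_const :: "real \<Rightarrow> real \<Rightarrow> real" where
  "emb_const p q = (let r = (q - 1) * p / (p - 1) in
     q * (1 + (1 / (1 - 2 powr (- (1/q - 1/r)))) powr q))"

lemma emb_const_pos:
  assumes "1 < p" "p < q" shows "emb_const p q > 0"
proof -
  have "q * (1 + x powr q) > 0" for x :: real using assms
    by (intro mult_pos_pos) (auto intro: add_pos_nonneg)
  then show ?thesis by (simp add: emb_const_def Let_def)
qed

text \<open>After telescoping, F i is paired with the power q - 1 of a partial sum. The exponent r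
  is chosen such that Hoelder with p and p / (p - 1) turns that power into an L_r norm, to which
  Minkowski applies. Measured against the normalisation 2 powr (- l / q), level l enters this norm
  with a factor decaying geometrically in i - l, because r > q; so the levels add up in l_q.\<close>

lemma level_sum_powr:
  fixes F :: "nat \<Rightarrow> 'z \<Rightarrow> real" and w :: "'z \<Rightarrow> real" and a :: "nat \<Rightarrow> real" and p q :: real
  assumes p: "1 < p" and pq: "p < q" and r_def: "r = (q - 1) * p / (p - 1)"
    and w: "\<And>z. z \<in> Z \<Longrightarrow> w z \<ge> 0" and F: "\<And>i z. F i z \<ge> 0" and a: "\<And>i. a i \<ge> 0"
    and Fp: "\<And>i. i \<le> N \<Longrightarrow> (\<Sum>z\<in>Z. w z * F i z powr p) \<le> (1/2) ^ i * a i powr p"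
    and Fr: "\<And>i. i \<le> N \<Longrightarrow> (\<Sum>z\<in>Z. w z * F i z powr r) \<le> (1/2) ^ i * a i powr r"
  shows "(\<Sum>z\<in>Z. w z * (\<Sum>i\<le>N. F i z) powr q) \<le> emb_const p q * (\<Sum>i\<le>N. (1/2) ^ i * a i powr q)"
proof -
  define p' where "p' = p / (p - 1)"
  have p': "1/p + 1/p' = 1" "p' > 1" using p by (auto simp: p'_def field_simps)
  have r: "r = (q - 1) * p'" by (simp add: r_def p'_def)
  have rq: "r > q" using p pq by (simp add: r_def field_simps)
  define \<epsilon> where "\<epsilon> = 1/q - 1/r"
  have \<epsilon>: "\<epsilon> > 0" using rq p pq by (simp add: \<epsilon>_def field_simps)
  define \<theta> :: real where "\<theta> = 2 powr (- \<epsilon>)"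
  have \<theta>: "0 < \<theta>" "\<theta> < 1" using \<epsilon> by (auto simp: \<theta>_def powr_less_one)
  have half: "(1/2) ^ i = 2 powr (- real i)" for i :: nat
    by (subst powr_minus_divide, subst powr_realpow) (simp_all add: power_divide)
  define b where "b i = 2 powr (- real i / q) * a i" for i
  have b: "b i \<ge> 0" for i using a by (simp add: b_def)
  have bq: "b i powr q = (1/2) ^ i * a i powr q" for i
    using a p pq by (simp add: b_def powr_mult powr_powr half)
  define S where "S i z = (\<Sum>l\<le>i. F l z)" for i z
  have S: "S i z \<ge> 0" for i z by (auto simp: S_def intro!: sum_nonneg F)
  define B where "B i = (\<Sum>l\<le>i. \<theta> ^ (i - l) * b l)" for i
  have B: "B i \<ge> 0" for i using \<theta> b by (auto simp: B_def intro!: sum_nonneg)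
  have key: "(\<Sum>z\<in>Z. w z * (F i z * S i z powr (q - 1))) \<le> b i powr q + B i powr q" if i: "i \<le> N" for i
  proof -
    have rt: "(\<Sum>z\<in>Z. w z * F l z powr s) powr (1/s) \<le> 2 powr (- real l / s) * a l"
      if "l \<le> N" "s = p \<or> s = r" for l s
    proof -
      have s: "s > 0" using that rq p pq by auto
      have "(\<Sum>z\<in>Z. w z * F l z powr s) powr (1/s) \<le> ((1/2) ^ l * a l powr s) powr (1/s)"
        using that Fp Fr s w by (intro powr_mono2) (auto intro!: sum_nonneg)
      also have "\<dots> = 2 powr (- real l / s) * a l" using s a by (simp add: half powr_mult powr_powr)
      finally show ?thesis .
    qed
    have "(\<Sum>z\<in>Z. w z * S i z powr r) powr (1/r) \<le> (\<Sum>l\<le>i. (\<Sum>z\<in>Z. w z * F l z powr r) powr (1/r))"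
      unfolding S_def using w F rq p pq by (intro minkowski_sum) auto
    also have "\<dots> \<le> (\<Sum>l\<le>i. 2 powr (- real l / r) * a l)" using rt i by (intro sum_mono) auto
    finally have Sr: "(\<Sum>z\<in>Z. w z * S i z powr r) powr (1/r) \<le> (\<Sum>l\<le>i. 2 powr (- real l / r) * a l)" .
    \<comment> \<open>Factoring out 2 powr (i \<epsilon>) leaves weights relative to the current
      level i, the shape that \<open>geometric_convolution\<close> expects.\<close>
    have "(\<Sum>l\<le>i. 2 powr (- real l / r) * a l) = 2 powr (real i * \<epsilon>) * B i"
      unfolding B_def sum_distrib_left
    proof (intro sum.cong refl)
      fix l assume l: "l \<in> {..i}"
      have "\<theta> ^ (i - l) = 2 powr (- (real i - real l) * \<epsilon>)" using l
        by (simp add: \<theta>_def powr_power of_nat_diff algebra_simps)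
      moreover have "real i * \<epsilon> + (- (real i - real l) * \<epsilon> + (- real l / q)) = - real l / r"
        by (simp add: \<epsilon>_def algebra_simps)
      ultimately show "2 powr (- real l / r) * a l = 2 powr (real i * \<epsilon>) * (\<theta> ^ (i - l) * b l)"
        unfolding b_def by (metis (no_types, lifting) mult.assoc powr_add)
    qed
    with Sr have Sr: "(\<Sum>z\<in>Z. w z * S i z powr r) powr (1/r) \<le> 2 powr (real i * \<epsilon>) * B i" by simp
    have "(\<Sum>z\<in>Z. w z * (F i z * S i z powr (q - 1))) \<le>
      (\<Sum>z\<in>Z. w z * F i z powr p) powr (1/p) * (\<Sum>z\<in>Z. w z * (S i z powr (q - 1)) powr p') powr (1/p')"
      using p p' w F by (intro holder_sum) auto
    also have "(\<Sum>z\<in>Z. w z * (S i z powr (q - 1)) powr p') = (\<Sum>z\<in>Z. w z * S i z powr r)"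
      by (simp add: powr_powr r)
    also have "(\<Sum>z\<in>Z. w z * S i z powr r) powr (1/p') = ((\<Sum>z\<in>Z. w z * S i z powr r) powr (1/r)) powr (q - 1)"
      using p p' pq by (simp add: powr_powr r)
    also have "(\<Sum>z\<in>Z. w z * F i z powr p) powr (1/p) * \<dots> \<le>
        (2 powr (- real i / p) * a i) * (2 powr (real i * \<epsilon>) * B i) powr (q - 1)"
      using rt[of i p] Sr i p pq a by (intro mult_mono powr_mono2) auto
    also have "\<dots> = b i * B i powr (q - 1)"
    proof -
      \<comment> \<open>The growth inherited from L_r is exactly what turns 2 powr (- i / p) into 2
        powr (- i / q), since (q - 1) / r = 1 - 1 / p.\<close>
      have "- real i / p + real i * \<epsilon> * (q - 1) = - real i / q"
      proof -
        have "\<epsilon> * (q - 1) = 1/p - 1/q" using p pq unfolding \<epsilon>_def r_def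
          by (simp add: divide_simps) (simp add: algebra_simps)
        then have "real i * \<epsilon> * (q - 1) = real i * (1/p - 1/q)" by (simp add: mult.assoc)
        then show ?thesis by (simp add: algebra_simps)
      qed
      then have "2 powr (- real i / p) * 2 powr (real i * \<epsilon> * (q - 1)) = 2 powr (- real i / q)"
        by (metis powr_add)
      then show ?thesis using B by (simp add: b_def powr_mult powr_powr)
    qed
    also have "\<dots> \<le> b i powr q + B i powr q"
    \<comment> \<open>A product of a first and a (q - 1)-st power is at most the q-th power of the
      larger factor.\<close>
    proof (cases "b i \<le> B i")
      case True
      then have "b i * B i powr (q - 1) \<le> B i * B i powr (q - 1)" by (simp add: mult_right_mono)
      also have "\<dots> = B i powr q" using B p pq by (simp add: powr_mult_base)
      finally show ?thesis by (smt (verit) powr_ge_zero)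
    next
      case False
      then have "b i * B i powr (q - 1) \<le> b i * b i powr (q - 1)" using b B p pq
        by (intro mult_left_mono powr_mono2) auto
      also have "\<dots> = b i powr q" using b p pq by (simp add: powr_mult_base)
      finally show ?thesis by (smt (verit) powr_ge_zero)
    qed
    finally show ?thesis .
  qed
  have "(\<Sum>z\<in>Z. w z * (\<Sum>i\<le>N. F i z) powr q) \<le> (\<Sum>z\<in>Z. w z * (q * (\<Sum>i\<le>N. F i z * S i z powr (q - 1))))"
    unfolding S_def using w p pq F by (intro sum_mono mult_left_mono powr_sum_telescope) auto
  also have "\<dots> = (\<Sum>z\<in>Z. \<Sum>i\<le>N. q * (w z * (F i z * S i z powr (q - 1))))"
    by (intro sum.cong refl) (simp add: sum_distrib_left mult_ac)
  also have "\<dots> = q * (\<Sum>i\<le>N. \<Sum>z\<in>Z. w z * (F i z * S i z powr (q - 1)))"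
    by (subst sum.swap) (simp add: sum_distrib_left)
  also have "\<dots> \<le> q * (\<Sum>i\<le>N. b i powr q + B i powr q)"
    using p pq key by (intro mult_left_mono sum_mono) auto
  also have "\<dots> \<le> q * ((\<Sum>i\<le>N. b i powr q) + (1 / (1 - \<theta>)) powr q * (\<Sum>i\<le>N. b i powr q))"
    using geometric_convolution[OF \<theta> _ b, where q = q and N = N] p pq by (simp add: sum.distrib B_def)
  also have "\<dots> = emb_const p q * (\<Sum>i\<le>N. b i powr q)"
    unfolding emb_const_def Let_def r_def[symmetric] \<epsilon>_def[symmetric] \<theta>_def[symmetric]
    by (simp add: algebra_simps)
  finally show ?thesis by (simp add: bq)
qed

section \<open>A discrete embedding of Jawerth--Franke type\<close>

text \<open>Each term \<open>g k powr p\<close> is at most the whole p-sum, which absorbs the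
  surplus exponent s / p - 1.\<close>

lemma sum_powr_le_powr_sum:
  fixes g :: "'a \<Rightarrow> real"
  assumes p: "0 < p" "p \<le> s" and g: "\<And>k. k \<in> A \<Longrightarrow> g k \<ge> 0"
  shows "(\<Sum>k\<in>A. g k powr s) \<le> (\<Sum>k\<in>A. g k powr p) powr (s / p)"
proof (cases "finite A")
  case False then show ?thesis by simp
next
  case fin: True
  define T where "T = (\<Sum>k\<in>A. g k powr p)"
  have T: "T \<ge> 0" by (auto simp: T_def intro!: sum_nonneg)
  have "g k powr s \<le> g k powr p * T powr (s / p - 1)" if k: "k \<in> A" for k
  proof -
    have "g k powr p \<le> T" unfolding T_def using fin k by (intro member_le_sum) auto
    then have "(g k powr p) powr (s / p - 1) \<le> T powr (s / p - 1)"
      using p by (intro powr_mono2) auto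
    moreover have "g k powr s = g k powr p * (g k powr p) powr (s / p - 1)"
      using p g[OF k] by (simp add: powr_powr right_diff_distrib flip: powr_add)
    ultimately show ?thesis by (simp add: mult_left_mono)
  qed
  then have "(\<Sum>k\<in>A. g k powr s) \<le> (\<Sum>k\<in>A. g k powr p * T powr (s / p - 1))" by (intro sum_mono)
  also have "\<dots> = T * T powr (s / p - 1)" by (simp add: T_def sum_distrib_right)
  also have "\<dots> = T powr (s / p)" using T p by (simp add: powr_mult_base)
  finally show ?thesis by (simp add: T_def)
qed

text \<open>Incidence of the Faber function of level \<open>m\<close> and position \<open>k\<close> with the dyadic interval
  number \<open>z\<close> of level \<open>N\<close>; both functions of level \<open>-1\<close> live on the whole unit interval.\<close>

definition dyadic_inc :: "nat \<Rightarrow> int \<Rightarrow> int \<Rightarrow> int \<Rightarrow> real" where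
  "dyadic_inc N m k z = (if m = -1 \<or> k = z div 2 ^ (N - nat m) then 1 else 0)"

lemma dyadic_inc_nonneg [simp]: "dyadic_inc N m k z \<ge> 0"
  by (simp add: dyadic_inc_def)

lemma finite_pos_set [simp]: "finite (pos_set m)"
  by (simp add: pos_set_def)

lemma int_div_less:
  fixes z a D :: int
  assumes "z < a * D" "D > 0"
  shows "z div D < a"
proof (rule ccontr)
  assume "\<not> z div D < a"
  then have "a * D \<le> z div D * D" using assms by (intro mult_right_mono) auto
  then show False using div_mult_mod_eq[of z D] pos_mod_sign[of D z] assms by linarith
qed

text \<open>A dyadic interval of level m consists of 2 ^ (N - m) intervals of level N, numbered by
  quotient and remainder. This allows all levels to be integrated on one common grid.\<close>

lemma sum_div_blocks:
  fixes g :: "int \<Rightarrow> real"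
  assumes "m \<le> N"
  shows "(\<Sum>z\<in>{0..<2 ^ N}. g (z div 2 ^ (N - m))) = 2 ^ (N - m) * (\<Sum>k\<in>{0..<2 ^ m}. g k)"
proof -
  define D :: int where "D = 2 ^ (N - m)"
  have D: "D > 0" by (simp add: D_def)
  have e: "(2::int) ^ N = 2 ^ m * D" using assms by (simp add: D_def flip: power_add)
  have "(\<Sum>z\<in>{0..<2 ^ N}. g (z div D)) = (\<Sum>(k, r)\<in>{0..<2 ^ m} \<times> {0..<D}. g k)"
  proof (intro sum.reindex_bij_witness[of _ "\<lambda>(k, r). k * D + r" "\<lambda>z. (z div D, z mod D)"])
    fix z assume z: "z \<in> {0..<(2::int) ^ N}"
    have "z div D < 2 ^ m" using z D e by (intro int_div_less) auto
    then show "(z div D, z mod D) \<in> {0..<2 ^ m} \<times> {0..<D}"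
      using z D by (auto simp: pos_imp_zdiv_nonneg_iff)
  next
    fix b assume "b \<in> {0..<(2::int) ^ m} \<times> {0..<D}"
    then obtain k r where b: "b = (k, r)" "0 \<le> k" "k < 2 ^ m" "0 \<le> r" "r < D" by auto
    have "k * D + r < (k + 1) * D" using b by (simp add: algebra_simps)
    also have "\<dots> \<le> 2 ^ m * D" using b D by (intro mult_right_mono) auto
    finally show "(case b of (k, r) \<Rightarrow> k * D + r) \<in> {0..<2 ^ N}" using b D e by auto
  qed (use D in \<open>auto simp: div_mult_self3 div_pos_pos_trivial\<close>)
  also have "\<dots> = (\<Sum>k\<in>{0..<2 ^ m}. \<Sum>r\<in>{0..<D}. g k)" by (rule sum.cartesian_product[symmetric])
  also have "\<dots> = of_int D * (\<Sum>k\<in>{0..<2 ^ m}. g k)" using D by (simp add: sum_distrib_left)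
  finally show ?thesis by (simp add: D_def)
qed

lemma sum_dyadic_inc:
  assumes m: "m \<ge> 0" "m \<le> int N" and z: "z \<in> {0..<2 ^ N}"
  shows "(\<Sum>k\<in>pos_set m. dyadic_inc N m k z * \<gamma> k) = \<gamma> (z div 2 ^ (N - nat m))"
proof -
  have e: "(2::int) ^ N = 2 ^ nat m * 2 ^ (N - nat m)" using m by (simp flip: power_add)
  have "z div 2 ^ (N - nat m) < 2 ^ nat m"
    using z e by (intro int_div_less) auto
  then have "z div 2 ^ (N - nat m) \<in> pos_set m"
    using z m by (auto simp: pos_set_def pos_imp_zdiv_nonneg_iff)
  moreover have "(\<Sum>k\<in>pos_set m. dyadic_inc N m k z * \<gamma> k) =
      (\<Sum>k\<in>pos_set m. if k = z div 2 ^ (N - nat m) then \<gamma> k else 0)"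
    using m by (intro sum.cong) (auto simp: dyadic_inc_def)
  ultimately show ?thesis by simp
qed

text \<open>On level j >= 0 the sum over k is a step function of step 2 powr (-j), so the s-th power
  of its L_s norm is 2 powr (-j) times an l_s sum, at most the power s / p of the l_p sum. Hence one
  sequence of l_p norms serves both exponents of \<open>level_sum_powr\<close>.\<close>

lemma dyadic_embedding_1d:
  fixes \<gamma> :: "int \<Rightarrow> int \<Rightarrow> real"
  assumes p: "1 < p" and pq: "p < q" and \<gamma>: "\<And>m k. \<gamma> m k \<ge> 0"
  shows "(\<Sum>z\<in>{0..<2 ^ N}. (1/2) ^ N * (\<Sum>m\<in>{-1..int N}. \<Sum>k\<in>pos_set m. dyadic_inc N m k z * \<gamma> m k) powr q)
    \<le> 2 powr q * emb_const p q * (\<Sum>m\<in>{-1..int N}. 2 powr (- real_of_int m) * (\<Sum>k\<in>pos_set m. \<gamma> m k powr p) powr (q / p))"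
proof -
  define r where "r = (q - 1) * p / (p - 1)"
  have rq: "r > q" using p pq by (simp add: r_def field_simps)
  \<comment> \<open>The index is shifted by one so that the exceptional level -1 becomes index
    0.\<close>
  define F where "F i z = (\<Sum>k\<in>pos_set (int i - 1). dyadic_inc N (int i - 1) k z * \<gamma> (int i - 1) k)" for i :: nat and z
  define t where "t m = (\<Sum>k\<in>pos_set m. \<gamma> m k powr p) powr (1 / p)" for m
  \<comment> \<open>The factor 2 covers the two overlapping functions of level -1 and, on the other
    levels, the shift of the index: (1/2) ^ j = 2 * (1/2) ^ (j + 1) and 2 <= 2 powr s.\<close>
  define a where "a i = 2 * t (int i - 1)" for i :: nat
  have F: "F i z \<ge> 0" for i z by (auto simp: F_def intro!: sum_nonneg mult_nonneg_nonneg \<gamma>)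
  have t: "t m \<ge> 0" for m by (simp add: t_def)
  have bd: "(\<Sum>z\<in>{0..<2 ^ N}. (1/2) ^ N * F i z powr s) \<le> (1/2) ^ i * a i powr s"
    if i: "i \<le> Suc N" and s: "s \<ge> p" for i s
  proof (cases i)
    case 0
    have "t (-1) = (\<gamma> (-1) 0 powr p + \<gamma> (-1) 1 powr p) powr (1/p)"
      by (simp add: t_def pos_set_def)
    moreover have "\<gamma> (-1) j = (\<gamma> (-1) j powr p) powr (1/p)" for j using p \<gamma> by (simp add: powr_powr)
    moreover have "(\<gamma> (-1) 0 powr p) powr (1/p) \<le> (\<gamma> (-1) 0 powr p + \<gamma> (-1) 1 powr p) powr (1/p)"
        "(\<gamma> (-1) 1 powr p) powr (1/p) \<le> (\<gamma> (-1) 0 powr p + \<gamma> (-1) 1 powr p) powr (1/p)"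
      using p by (auto intro!: powr_mono2)
    ultimately have "\<gamma> (-1) 0 \<le> t (-1)" "\<gamma> (-1) 1 \<le> t (-1)" by simp_all
    then have "\<gamma> (-1) 0 + \<gamma> (-1) 1 \<le> 2 * t (-1)" by simp
    moreover have "F 0 z = \<gamma> (-1) 0 + \<gamma> (-1) 1" for z by (simp add: F_def pos_set_def dyadic_inc_def)
    ultimately have "F 0 z powr s \<le> a 0 powr s" for z
      using F[of 0 z] s p by (intro powr_mono2) (auto simp: a_def)
    then have "(\<Sum>z\<in>{0..<(2::int) ^ N}. (1/2) ^ N * F 0 z powr s) \<le> (\<Sum>z\<in>{0..<(2::int) ^ N}. (1/2) ^ N * a 0 powr s)"
      by (intro sum_mono mult_left_mono) auto
    also have "\<dots> = a 0 powr s" by (simp add: power_one_over)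
    finally show ?thesis using 0 by simp
  next
    case (Suc j)
    then have j: "j \<le> N" "int i - 1 = int j" using i by auto
    have "(\<Sum>z\<in>{0..<2 ^ N}. (1/2) ^ N * F i z powr s) = (1/2) ^ N * (\<Sum>z\<in>{0..<2 ^ N}. \<gamma> (int j) (z div 2 ^ (N - j)) powr s)"
      unfolding sum_distrib_left F_def j(2)
      using j sum_dyadic_inc[of "int j" N] by (intro sum.cong refl) auto
    also have "\<dots> = (1/2) ^ N * 2 ^ (N - j) * (\<Sum>k\<in>{0..<2 ^ j}. \<gamma> (int j) k powr s)"
      using sum_div_blocks[OF j(1), of "\<lambda>k. \<gamma> (int j) k powr s"] by simp
    also have "{0..<2 ^ j} = pos_set (int j)" by (auto simp: pos_set_def)
    also have "(1/2) ^ N * 2 ^ (N - j) = (1/2::real) ^ j"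
      using j(1) by (simp add: power_diff power_one_over)
    also have "(\<Sum>k\<in>pos_set (int j). \<gamma> (int j) k powr s) \<le> (\<Sum>k\<in>pos_set (int j). \<gamma> (int j) k powr p) powr (s / p)"
      using p s \<gamma> by (intro sum_powr_le_powr_sum) auto
    also have "\<dots> = t (int j) powr s" using p by (simp add: t_def powr_powr)
    also have "(1/2) ^ j * t (int j) powr s \<le> (1/2) ^ i * a i powr s"
    proof -
      have "2 powr 1 \<le> 2 powr s" using s p by (intro powr_mono) auto
      then have "2 * t (int j) powr s \<le> 2 powr s * t (int j) powr s" by (simp add: mult_right_mono)
      also have "\<dots> = a i powr s" using t by (simp add: a_def j powr_mult)
      finally show ?thesis using Suc by simp
    qed
    finally show ?thesis by (simp add: mult_left_mono)
  qed
  have "(\<Sum>z\<in>{0..<2 ^ N}. (1/2) ^ N * (\<Sum>i\<le>Suc N. F i z) powr q) \<le> emb_const p q * (\<Sum>i\<le>Suc N. (1/2) ^ i * a i powr q)"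
    by (rule level_sum_powr[OF p pq r_def]) (use F t bd rq pq in \<open>auto simp: a_def\<close>)
  moreover have "(\<Sum>m\<in>{-1..int N}. \<Sum>k\<in>pos_set m. dyadic_inc N m k z * \<gamma> m k) = (\<Sum>i\<le>Suc N. F i z)" for z
    unfolding F_def by (intro sum.reindex_bij_witness[of _ "\<lambda>i. int i - 1" "\<lambda>m. nat (m + 1)"]) auto
  moreover have "(\<Sum>i\<le>Suc N. (1/2) ^ i * a i powr q) \<le> 2 powr q * (\<Sum>m\<in>{-1..int N}. 2 powr (- real_of_int m) * (\<Sum>k\<in>pos_set m. \<gamma> m k powr p) powr (q / p))"
  proof -
    have "(\<Sum>i\<le>Suc N. (1/2) ^ i * a i powr q) \<le> (\<Sum>i\<le>Suc N. 2 powr q * (2 powr (- (real i - 1)) * t (int i - 1) powr q))"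
    proof (intro sum_mono)
      fix i
      have "(1/2::real) ^ i = 2 powr (- real i)" by (subst powr_minus_divide, subst powr_realpow) (simp_all add: power_divide)
      also have "\<dots> \<le> 2 powr (- (real i - 1))" by (intro powr_mono) auto
      finally have "(1/2::real) ^ i \<le> 2 powr (- (real i - 1))" .
      then have "(1/2) ^ i * (2 powr q * t (int i - 1) powr q) \<le> 2 powr (- (real i - 1)) * (2 powr q * t (int i - 1) powr q)"
        by (intro mult_right_mono) auto
      then show "(1/2) ^ i * a i powr q \<le> 2 powr q * (2 powr (- (real i - 1)) * t (int i - 1) powr q)"
        using t by (simp add: a_def powr_mult mult_ac)
    qed
    also have "\<dots> = 2 powr q * (\<Sum>m\<in>{-1..int N}. 2 powr (- real_of_int m) * t m powr q)"
      unfolding sum_distrib_left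
      by (intro sum.reindex_bij_witness[of _ "\<lambda>m. nat (m + 1)" "\<lambda>i. int i - 1"]) auto
    finally show ?thesis using p by (simp add: t_def powr_powr)
  qed
  ultimately show ?thesis using emb_const_pos[OF p pq]
    by (smt (verit, best) mult.assoc mult.commute mult_left_mono sum.cong)
qed

text \<open>Inductions on the set of coordinates use this to peel off one coordinate. The inverse of
  the update resets coordinate i to \<open>undefined\<close>, as extensionality on I
  demands.\<close>

lemma sum_PiE_insert:
  fixes g :: "('i \<Rightarrow> 'a) \<Rightarrow> 'b::comm_monoid_add"
  assumes i: "i \<notin> I"
  shows "(\<Sum>f\<in>PiE (insert i I) T. g f) = (\<Sum>a\<in>T i. \<Sum>f\<in>PiE I T. g (f(i := a)))"
proof -
  have "(\<Sum>f\<in>PiE (insert i I) T. g f) = (\<Sum>(a, f)\<in>T i \<times> PiE I T. g (f(i := a)))"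
    using i by (intro sum.reindex_bij_witness[of _ "\<lambda>(a, f). f(i := a)" "\<lambda>f. (f i, f(i := undefined))"])
      (auto simp: PiE_def Pi_def extensional_def fun_eq_iff)
  then show ?thesis by (simp add: sum.cartesian_product)
qed

text \<open>Functions on a set I of coordinates replace vectors so that I can grow. With the cell y
  of the new coordinate fixed, summing over its levels and positions gives coefficients c' y in the
  remaining coordinates, to which the induction hypothesis applies. What remains is a sum over y,
  controlled by the one-variable embedding.\<close>

lemma dyadic_embedding:
  fixes c :: "('i \<Rightarrow> int) \<Rightarrow> ('i \<Rightarrow> int) \<Rightarrow> real"
  assumes p: "1 < p" and pq: "p < q" and I: "finite I" and c: "\<And>m k. c m k \<ge> 0"
  shows "(\<Sum>z\<in>PiE I (\<lambda>_. {0..<2 ^ N}). ((1/2) ^ N) ^ card I *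
      (\<Sum>m\<in>PiE I (\<lambda>_. {-1..int N}). \<Sum>k\<in>PiE I (\<lambda>i. pos_set (m i)).
         c m k * (\<Prod>i\<in>I. dyadic_inc N (m i) (k i) (z i))) powr q)
    \<le> (2 powr q * emb_const p q) ^ card I *
      (\<Sum>m\<in>PiE I (\<lambda>_. {-1..int N}). 2 powr (- real_of_int (\<Sum>i\<in>I. m i)) *
         (\<Sum>k\<in>PiE I (\<lambda>i. pos_set (m i)). c m k powr p) powr (q / p))"
  using I c
proof (induction I arbitrary: c rule: finite_induct)
  case empty
  have "q / p > 0" using p pq by simp
  then show ?case using p pq empty by (simp add: powr_powr)
next
  case (insert i I)
  define K where "K = 2 powr q * emb_const p q"
  have K: "K > 0" using emb_const_pos[OF p pq] by (simp add: K_def)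
  define Z where "Z = {0..<(2::int) ^ N}"
  define L where "L = {-1..int N}"
  define \<omega> :: real where "\<omega> = (1/2) ^ N"
  have \<omega>: "\<omega> \<ge> 0" by (simp add: \<omega>_def)
  define PI where "PI m = PiE I (\<lambda>i. pos_set (m i))" for m :: "'i \<Rightarrow> int"
  have PI_fin: "finite (PI m)" for m using insert by (auto simp: PI_def intro!: finite_PiE)
  have PI_upd: "PiE I (\<lambda>j. pos_set ((m(i := a)) j)) = PI m" for m a
    unfolding PI_def using insert by (intro PiE_cong) auto
  define c' where "c' y m k = (\<Sum>a\<in>L. \<Sum>b\<in>pos_set a. c (m(i := a)) (k(i := b)) * dyadic_inc N a b y)" for y m k
  have c': "c' y m k \<ge> 0" for y m k using insert.prems by (auto simp: c'_def intro!: sum_nonneg)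
  have card: "card (insert i I) = Suc (card I)" using insert by simp
  have split: "(\<Sum>m\<in>PiE (insert i I) (\<lambda>_. L). \<Sum>k\<in>PiE (insert i I) (\<lambda>i. pos_set (m i)).
         c m k * (\<Prod>j\<in>insert i I. dyadic_inc N (m j) (k j) ((z(i := y)) j)))
      = (\<Sum>m\<in>PiE I (\<lambda>_. L). \<Sum>k\<in>PI m. c' y m k * (\<Prod>j\<in>I. dyadic_inc N (m j) (k j) (z j)))" for y z
  proof -
    have "(\<Sum>m\<in>PiE (insert i I) (\<lambda>_. L). \<Sum>k\<in>PiE (insert i I) (\<lambda>i. pos_set (m i)).
         c m k * (\<Prod>j\<in>insert i I. dyadic_inc N (m j) (k j) ((z(i := y)) j)))
      = (\<Sum>a\<in>L. \<Sum>m\<in>PiE I (\<lambda>_. L). \<Sum>b\<in>pos_set a. \<Sum>k\<in>PI m.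
         c (m(i := a)) (k(i := b)) * (dyadic_inc N a b y * (\<Prod>j\<in>I. dyadic_inc N (m j) (k j) (z j))))"
    proof -
      have "(\<Prod>j\<in>insert i I. dyadic_inc N ((m(i := a)) j) ((k(i := b)) j) ((z(i := y)) j)) =
        dyadic_inc N a b y * (\<Prod>j\<in>I. dyadic_inc N (m j) (k j) (z j))" for m k a b
      proof -
        have "(\<Prod>j\<in>I. dyadic_inc N ((m(i := a)) j) ((k(i := b)) j) ((z(i := y)) j)) =
          (\<Prod>j\<in>I. dyadic_inc N (m j) (k j) (z j))"
          using insert by (intro prod.cong) auto
        then show ?thesis using insert by simp
      qed
      then show ?thesis
        by (simp only: sum_PiE_insert[OF insert.hyps(2)] PI_upd fun_upd_same)
    qed
    also have "\<dots> = (\<Sum>m\<in>PiE I (\<lambda>_. L). \<Sum>a\<in>L. \<Sum>b\<in>pos_set a. \<Sum>k\<in>PI m.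
         c (m(i := a)) (k(i := b)) * (dyadic_inc N a b y * (\<Prod>j\<in>I. dyadic_inc N (m j) (k j) (z j))))"
      by (rule sum.swap)
    also have "\<dots> = (\<Sum>m\<in>PiE I (\<lambda>_. L). \<Sum>a\<in>L. \<Sum>k\<in>PI m. \<Sum>b\<in>pos_set a. 
         c (m(i := a)) (k(i := b)) * (dyadic_inc N a b y * (\<Prod>j\<in>I. dyadic_inc N (m j) (k j) (z j))))"
      by (intro sum.cong refl sum.swap)
    also have "\<dots> = (\<Sum>m\<in>PiE I (\<lambda>_. L). \<Sum>k\<in>PI m. \<Sum>a\<in>L. \<Sum>b\<in>pos_set a. 
         c (m(i := a)) (k(i := b)) * (dyadic_inc N a b y * (\<Prod>j\<in>I. dyadic_inc N (m j) (k j) (z j))))"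
      by (intro sum.cong refl sum.swap)
    finally show ?thesis by (simp add: c'_def sum_distrib_right mult.assoc)
  qed
  \<comment> \<open>Minkowski in l_p over the positions k of the old coordinates moves their norm
    inside the sum over the new level; this leaves the one-variable problem for the scalars \<gamma>
    a b.\<close>
  have fib: "(\<Sum>y\<in>Z. \<omega> * (\<Sum>k\<in>PI m. c' y m k powr p) powr (q / p)) \<le>
      K * (\<Sum>a\<in>L. 2 powr (- real_of_int a) * (\<Sum>b\<in>pos_set a. \<Sum>k\<in>PI m. c (m(i := a)) (k(i := b)) powr p) powr (q / p))"
    for m
  proof -
    define \<gamma> where "\<gamma> a b = (\<Sum>k\<in>PI m. c (m(i := a)) (k(i := b)) powr p) powr (1 / p)" for a b
    have \<gamma>: "\<gamma> a b powr p = (\<Sum>k\<in>PI m. c (m(i := a)) (k(i := b)) powr p)" for a b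
      using p by (simp add: \<gamma>_def powr_powr sum_nonneg)
    have "(\<Sum>k\<in>PI m. c' y m k powr p) powr (q / p) \<le> (\<Sum>a\<in>L. \<Sum>b\<in>pos_set a. dyadic_inc N a b y * \<gamma> a b) powr q" for y
    proof -
      have "(\<Sum>k\<in>PI m. c' y m k powr p) powr (1 / p) =
         (\<Sum>k\<in>PI m. 1 * (\<Sum>ab\<in>Sigma L pos_set. c (m(i := fst ab)) (k(i := snd ab)) * dyadic_inc N (fst ab) (snd ab) y) powr p) powr (1 / p)"
        by (simp add: c'_def sum.Sigma case_prod_beta L_def)
      also have "\<dots> \<le> (\<Sum>ab\<in>Sigma L pos_set. (\<Sum>k\<in>PI m. 1 * (c (m(i := fst ab)) (k(i := snd ab)) * dyadic_inc N (fst ab) (snd ab) y) powr p) powr (1 / p))"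
        using p insert.prems by (intro minkowski_sum) auto
      also have "\<dots> = (\<Sum>ab\<in>Sigma L pos_set. dyadic_inc N (fst ab) (snd ab) y * \<gamma> (fst ab) (snd ab))"
        by (intro sum.cong refl) (auto simp: \<gamma>_def dyadic_inc_def)
      also have "\<dots> = (\<Sum>a\<in>L. \<Sum>b\<in>pos_set a. dyadic_inc N a b y * \<gamma> a b)"
        by (simp add: sum.Sigma case_prod_beta L_def)
      finally have "((\<Sum>k\<in>PI m. c' y m k powr p) powr (1 / p)) powr q \<le> (\<Sum>a\<in>L. \<Sum>b\<in>pos_set a. dyadic_inc N a b y * \<gamma> a b) powr q"
        using p pq by (intro powr_mono2) auto
      then show ?thesis by (simp add: powr_powr)
    qed
    then have "(\<Sum>y\<in>Z. \<omega> * (\<Sum>k\<in>PI m. c' y m k powr p) powr (q / p)) \<le>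
       (\<Sum>y\<in>Z. \<omega> * (\<Sum>a\<in>L. \<Sum>b\<in>pos_set a. dyadic_inc N a b y * \<gamma> a b) powr q)"
      using \<omega> by (intro sum_mono mult_left_mono)
    also have "\<dots> \<le> K * (\<Sum>a\<in>L. 2 powr (- real_of_int a) * (\<Sum>b\<in>pos_set a. \<gamma> a b powr p) powr (q / p))"
      unfolding Z_def \<omega>_def L_def K_def by (rule dyadic_embedding_1d[OF p pq]) (simp add: \<gamma>_def)
    finally show ?thesis unfolding \<gamma> .
  qed
  have "(\<Sum>z\<in>PiE (insert i I) (\<lambda>_. Z). \<omega> ^ card (insert i I) *
      (\<Sum>m\<in>PiE (insert i I) (\<lambda>_. L). \<Sum>k\<in>PiE (insert i I) (\<lambda>i. pos_set (m i)).
         c m k * (\<Prod>j\<in>insert i I. dyadic_inc N (m j) (k j) (z j))) powr q) =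
      (\<Sum>y\<in>Z. \<omega> * (\<Sum>z\<in>PiE I (\<lambda>_. Z). \<omega> ^ card I *
      (\<Sum>m\<in>PiE I (\<lambda>_. L). \<Sum>k\<in>PI m. c' y m k * (\<Prod>j\<in>I. dyadic_inc N (m j) (k j) (z j))) powr q))"
    unfolding sum_PiE_insert[OF insert.hyps(2), of _ "\<lambda>_. Z"] split card
    by (simp add: sum_distrib_left mult.assoc)
  also have "\<dots> \<le> (\<Sum>y\<in>Z. \<omega> * (K ^ card I * (\<Sum>m\<in>PiE I (\<lambda>_. L). 2 powr (- real_of_int (\<Sum>i\<in>I. m i)) *
         (\<Sum>k\<in>PI m. c' y m k powr p) powr (q / p))))"
    using insert.IH[OF c'] \<omega>
    by (intro sum_mono mult_left_mono) (auto simp: Z_def L_def \<omega>_def K_def PI_def)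
  also have "\<dots> = K ^ card I * (\<Sum>m\<in>PiE I (\<lambda>_. L). 2 powr (- real_of_int (\<Sum>i\<in>I. m i)) *
         (\<Sum>y\<in>Z. \<omega> * (\<Sum>k\<in>PI m. c' y m k powr p) powr (q / p)))"
    unfolding sum_distrib_left by (subst sum.swap) (simp add: mult_ac)
  also have "\<dots> \<le> K ^ card I * (\<Sum>m\<in>PiE I (\<lambda>_. L). 2 powr (- real_of_int (\<Sum>i\<in>I. m i)) *
         (K * (\<Sum>a\<in>L. 2 powr (- real_of_int a) * (\<Sum>b\<in>pos_set a. \<Sum>k\<in>PI m. c (m(i := a)) (k(i := b)) powr p) powr (q / p))))"
    using K fib by (intro mult_left_mono sum_mono) auto
  also have "\<dots> = K ^ card (insert i I) * (\<Sum>a\<in>L. \<Sum>m\<in>PiE I (\<lambda>_. L). 2 powr (- real_of_int (a + (\<Sum>i\<in>I. m i))) *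
         (\<Sum>b\<in>pos_set a. \<Sum>k\<in>PI m. c (m(i := a)) (k(i := b)) powr p) powr (q / p))"
    unfolding card sum_distrib_left
    by (subst sum.swap) (simp add: powr_add powr_diff powr_minus mult_ac divide_inverse del: of_int_sum)
  also have "\<dots> = K ^ card (insert i I) * (\<Sum>m\<in>PiE (insert i I) (\<lambda>_. L). 2 powr (- real_of_int (\<Sum>i\<in>insert i I. m i)) *
         (\<Sum>k\<in>PiE (insert i I) (\<lambda>i. pos_set (m i)). c m k powr p) powr (q / p))"
  proof -
    have "(\<Sum>j\<in>insert i I. (m(i := a)) j) = a + (\<Sum>j\<in>I. m j)" for m :: "'i \<Rightarrow> int" and a
    proof -
      have "(\<Sum>j\<in>I. (m(i := a)) j) = (\<Sum>j\<in>I. m j)" using insert by (intro sum.cong) auto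
      then show ?thesis using insert by simp
    qed
    then show ?thesis by (simp only: sum_PiE_insert[OF insert.hyps(2)] PI_upd fun_upd_same)
  qed
  finally show ?case unfolding Z_def L_def \<omega>_def K_def .
qed

section \<open>Faber--Schauder expansions as interpolation\<close>

lemma hat_nonneg: "hat x \<ge> 0" by (auto simp: hat_def)
lemma hat_le_1: "hat x \<le> 1" by (auto simp: hat_def)
lemma hat_eq_0: "x \<le> 0 \<or> x \<ge> 1 \<Longrightarrow> hat x = 0" by (auto simp: hat_def)

lemma faber1_nonneg: "0 \<le> x \<Longrightarrow> x \<le> 1 \<Longrightarrow> faber1 m k x \<ge> 0"
  by (auto simp: faber1_def hat_nonneg)

text \<open>A hat vanishes at both ends of its support, so the bound holds on closed cells, where a
  boundary point belongs to two numbers z. The interval of level m around cell z has the number z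
  div 2 ^ (N - nat m).\<close>

lemma faber1_le_dyadic_inc:
  assumes m: "-1 \<le> m" "m \<le> int N" and z: "0 \<le> z" "z < 2 ^ N"
    and x: "of_int z \<le> 2 ^ N * x" "2 ^ N * x \<le> of_int (z + 1)"
  shows "faber1 m k x \<le> dyadic_inc N m k z"
proof (cases "m = -1")
  case True
  have "of_int (z + 1) \<le> (2::real) ^ N" using z by (metis of_int_le_numeral_power_cancel_iff zless_imp_add1_zle)
  then have "2 ^ N * x \<le> 2 ^ N" using x by linarith
  then have "x \<le> 1" by simp
  moreover have "0 \<le> 2 ^ N * x" using x z by (smt (verit) of_int_0_le_iff)
  then have "x \<ge> 0" by (metis mult_le_cancel_left_pos mult_zero_right zero_less_numeral zero_less_power)
  ultimately show ?thesis using True by (simp add: faber1_def dyadic_inc_def)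
next
  case False
  then have m0: "m \<ge> 0" using m by simp
  define D :: int where "D = 2 ^ (N - nat m)"
  have D: "D > 0" by (simp add: D_def)
  have e: "(2::real) ^ N = 2 ^ nat m * of_int D" using m m0 by (simp add: D_def flip: power_add)
  define K where "K = z div D"
  have "z div D * D + z mod D = z" "z mod D < D" "0 \<le> z mod D" using D by auto
  then have "K * D \<le> z" "z + 1 \<le> K * D + D" unfolding K_def by linarith+
  then have "K * D \<le> z" "z + 1 \<le> (K + 1) * D" by (simp_all add: distrib_right)
  then have "real_of_int (K * D) \<le> of_int z" "real_of_int (z + 1) \<le> of_int ((K + 1) * D)"
    by (simp_all only: of_int_le_iff)
  then have "of_int K * of_int D \<le> 2 ^ nat m * x * of_int D" "2 ^ nat m * x * of_int D \<le> (of_int K + 1) * of_int D"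
  proof -
    have "2 ^ N * x = 2 ^ nat m * x * of_int D" by (simp add: e)
    moreover have "real_of_int (z + 1) = of_int z + 1" "real_of_int (K * D) = of_int K * of_int D"
      "real_of_int ((K + 1) * D) = (of_int K + 1) * of_int D" by simp_all
    ultimately show "of_int K * of_int D \<le> 2 ^ nat m * x * of_int D" "2 ^ nat m * x * of_int D \<le> (of_int K + 1) * of_int D"
      using x \<open>real_of_int (K * D) \<le> of_int z\<close> \<open>real_of_int (z + 1) \<le> of_int ((K + 1) * D)\<close> by linarith+
  qed
  then have b: "of_int K \<le> 2 ^ nat m * x" "2 ^ nat m * x \<le> of_int K + 1"
    using D by (auto simp only: mult_le_cancel_right_pos of_int_0_less_iff)
  show ?thesis
  proof (cases "k = K")
    case True then show ?thesis using False by (simp add: faber1_def dyadic_inc_def K_def D_def hat_le_1)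
  next
    case k: False
    then have "k \<le> K - 1 \<or> k \<ge> K + 1" by linarith
    then have "real_of_int k \<le> of_int (K - 1) \<or> real_of_int k \<ge> of_int (K + 1)" by (simp only: of_int_le_iff)
    then have "2 ^ nat m * x - of_int k \<le> 0 \<or> 2 ^ nat m * x - of_int k \<ge> 1" using b by auto
    then show ?thesis using False hat_eq_0 by (simp add: faber1_def)
  qed
qed

section \<open>Coefficient functionals and piecewise linear interpolation in one variable\<close>

text \<open>The one-dimensional coefficient functional of level \<open>m\<close> and position \<open>k\<close> evaluates a
  function at the nodes \<open>node m k s\<close>, \<open>s \<in> {0, 1, 2}\<close>, with the weights \<open>wgt m s\<close>.\<close>

definition node :: "int \<Rightarrow> int \<Rightarrow> nat \<Rightarrow> real" where
  "node m k s = (if m = -1 then of_int k else (of_int k + real s / 2) / 2 ^ nat m)"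

definition wgt :: "int \<Rightarrow> nat \<Rightarrow> real" where
  "wgt m s = (if m = -1 then (if s = 0 then 1 else 0) else if s = 1 then 1 else - 1 / 2)"

lemma sum_lessThan_3: "(\<Sum>s<(3::nat). g s) = g 0 + g 1 + (g 2 :: 'a::comm_monoid_add)"
  by (simp add: eval_nat_numeral add.assoc)

text \<open>The piecewise linear interpolant on the grid of step 1 / 2 ^ M. At x = 1 its second node
  lies outside the unit interval but has weight 0.\<close>

definition lin_interp :: "nat \<Rightarrow> real \<Rightarrow> (real \<Rightarrow> complex) \<Rightarrow> complex" where
  "lin_interp M x u = (let K = \<lfloor>2 ^ M * x\<rfloor>; \<sigma> = 2 ^ M * x - of_int K in
     (1 - of_real \<sigma>) * u (of_int K / 2 ^ M) + of_real \<sigma> * u ((of_int K + 1) / 2 ^ M))"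

text \<open>Halving the grid changes the interpolant on a cell only by a hat whose height
  \<open>A\<close> is the deviation of the midpoint value from the mean of the end values, and this
  is the coefficient of level M.\<close>

lemma lin_interp_Suc:
  assumes x: "0 \<le> x" "x \<le> 1"
  shows "lin_interp (Suc M) x u = lin_interp M x u +
    (\<Sum>k\<in>pos_set (int M). \<Sum>s<3. of_real (wgt (int M) s * faber1 (int M) k x) * u (node (int M) k s))"
proof -
  define K where "K = \<lfloor>2 ^ M * x\<rfloor>"
  define \<sigma> where "\<sigma> = 2 ^ M * x - of_int K"
  define A where "A k = u ((of_int k + 1 / 2) / 2 ^ M) - u (of_int k / 2 ^ M) / 2 - u ((of_int k + 1) / 2 ^ M) / 2" for k :: int
  have \<sigma>: "0 \<le> \<sigma>" "\<sigma> < 1" unfolding \<sigma>_def K_def by (auto simp: floor_less_cancel)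
  have xk: "2 ^ M * x = of_int K + \<sigma>" by (simp add: \<sigma>_def)
  have hatk: "faber1 (int M) k x = (if k = K then hat \<sigma> else 0)" for k
  proof (cases "k = K")
    case False
    then have "k \<le> K - 1 \<or> k \<ge> K + 1" by linarith
    then have "real_of_int k \<le> of_int (K - 1) \<or> real_of_int k \<ge> of_int (K + 1)" by (simp only: of_int_le_iff)
    then have "2 ^ M * x - of_int k \<le> 0 \<or> 2 ^ M * x - of_int k \<ge> 1" using \<sigma> xk by auto
    then show ?thesis using False hat_eq_0 by (simp add: faber1_def)
  qed (simp add: faber1_def \<sigma>_def)
  have "(\<Sum>k\<in>pos_set (int M). \<Sum>s<3. of_real (wgt (int M) s * faber1 (int M) k x) * u (node (int M) k s))
     = (\<Sum>k\<in>pos_set (int M). of_real (faber1 (int M) k x) * A k)"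
    by (intro sum.cong refl) (simp add: sum_lessThan_3 wgt_def node_def A_def algebra_simps)
  also have "\<dots> = (\<Sum>k\<in>pos_set (int M). if k = K then of_real (hat \<sigma>) * A K else 0)"
    by (intro sum.cong) (auto simp: hatk)
  also have "\<dots> = of_real (hat \<sigma>) * A K"
  proof (cases "K \<in> pos_set (int M)")
    \<comment> \<open>Only x = 1 falls outside: then K = 2 ^ M and \<sigma> = 0, so the hat
      vanishes.\<close>
    case False
    have "K \<ge> 0" using x by (simp add: K_def)
    moreover have "2 ^ M * x \<le> 2 ^ M" using x by (simp add: mult_left_le)
    then have "real_of_int K \<le> 2 ^ M" unfolding K_def by (meson of_int_floor_le order_trans)
    then have "K \<le> 2 ^ M" by (metis of_int_le_numeral_power_cancel_iff)
    ultimately have "K = 2 ^ M" using False by (auto simp: pos_set_def)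
    then have "\<sigma> \<le> 0" using \<open>2 ^ M * x \<le> 2 ^ M\<close> by (simp add: \<sigma>_def)
    then have "hat \<sigma> = 0" by (simp add: hat_eq_0)
    then show ?thesis by (simp add: sum.neutral)
  qed simp
  finally have sm: "(\<Sum>k\<in>pos_set (int M). \<Sum>s<3. of_real (wgt (int M) s * faber1 (int M) k x) * u (node (int M) k s))
     = of_real (hat \<sigma>) * A K" .
  have li: "lin_interp M x u = (1 - of_real \<sigma>) * u (of_int K / 2 ^ M) + of_real \<sigma> * u ((of_int K + 1) / 2 ^ M)"
    by (simp add: lin_interp_def K_def \<sigma>_def Let_def)
  show ?thesis
  \<comment> \<open>The half of the cell containing x decides both the finer cell and the branch of
    the hat.\<close>
  proof (cases "\<sigma> < 1/2")
    case True
    have "\<lfloor>2 ^ Suc M * x\<rfloor> = 2 * K" using True \<sigma> xk by (intro floor_unique) auto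
    moreover have "2 ^ Suc M * x - of_int (2 * K) = 2 * \<sigma>" using xk by simp
    ultimately have "lin_interp (Suc M) x u = (1 - of_real (2 * \<sigma>)) * u (of_int (2 * K) / 2 ^ Suc M) + of_real (2 * \<sigma>) * u ((of_int (2 * K) + 1) / 2 ^ Suc M)"
      by (simp only: lin_interp_def Let_def)
    moreover have "real_of_int (2 * K) / 2 ^ Suc M = of_int K / 2 ^ M" "(real_of_int (2 * K) + 1) / 2 ^ Suc M = (of_int K + 1/2) / 2 ^ M"
      by (auto simp: field_simps)
    moreover have "hat \<sigma> = 2 * \<sigma>" using True \<sigma> by (simp add: hat_def)
    ultimately show ?thesis unfolding li sm by (simp add: A_def algebra_simps)
  next
    case False
    have "\<lfloor>2 ^ Suc M * x\<rfloor> = 2 * K + 1" using False \<sigma> xk by (intro floor_unique) auto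
    moreover have "2 ^ Suc M * x - of_int (2 * K + 1) = 2 * \<sigma> - 1" using xk by simp
    ultimately have "lin_interp (Suc M) x u = (1 - of_real (2 * \<sigma> - 1)) * u (of_int (2 * K + 1) / 2 ^ Suc M) + of_real (2 * \<sigma> - 1) * u ((of_int (2 * K + 1) + 1) / 2 ^ Suc M)"
      by (simp only: lin_interp_def Let_def)
    moreover have "real_of_int (2 * K + 1) / 2 ^ Suc M = (of_int K + 1/2) / 2 ^ M" "(real_of_int (2 * K + 1) + 1) / 2 ^ Suc M = (of_int K + 1) / 2 ^ M"
      by (auto simp: field_simps)
    moreover have "hat \<sigma> = 2 * (1 - \<sigma>)" using False \<sigma> by (auto simp: hat_def)
    then have "complex_of_real (hat \<sigma>) = 2 - 2 * of_real \<sigma>" by simp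
    ultimately show ?thesis unfolding li sm A_def by (simp only:) (simp add: algebra_simps diff_divide_distrib)
  qed
qed

text \<open>Level -1 is the chord between the end values, and every further level refines the grid
  once; so partial sums of the series are interpolants.\<close>

lemma faber1_expansion:
  assumes x: "0 \<le> x" "x \<le> 1"
  shows "(\<Sum>m\<in>{-1..<int M}. \<Sum>k\<in>pos_set m. \<Sum>s<3. of_real (wgt m s * faber1 m k x) * u (node m k s)) = lin_interp M x u"
proof (induction M)
  case 0
  have "{-1..<int 0} = {-1}" by auto
  moreover have "lin_interp 0 x u = (1 - of_real x) * u 0 + of_real x * u 1"
  proof (cases "x = 1")
    case False
    then have "\<lfloor>x\<rfloor> = 0" using x by (intro floor_unique) auto
    then show ?thesis by (simp add: lin_interp_def)
  qed (simp add: lin_interp_def)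
  ultimately show ?case by (simp add: pos_set_def sum_lessThan_3 wgt_def faber1_def node_def)
next
  case (Suc M)
  have "{-1..<int (Suc M)} = insert (int M) {-1..<int M}" by auto
  then show ?case using Suc by (simp add: lin_interp_Suc[OF x])
qed

lemma lin_interp_convex:
  assumes x: "0 \<le> x" "x \<le> 1"
  obtains a b \<sigma> where "0 \<le> \<sigma>" "\<sigma> \<le> 1" "0 \<le> a" "a \<le> 1" "0 \<le> b" "b \<le> 1"
    "\<bar>a - x\<bar> \<le> 1 / 2 ^ M" "\<bar>b - x\<bar> \<le> 1 / 2 ^ M"
    "\<And>u. lin_interp M x u = (1 - of_real \<sigma>) * u a + of_real \<sigma> * u b"
proof -
  define K where "K = \<lfloor>2 ^ M * x\<rfloor>"
  define \<sigma> where "\<sigma> = 2 ^ M * x - of_int K"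
  have \<sigma>: "0 \<le> \<sigma>" "\<sigma> < 1" unfolding \<sigma>_def K_def by (auto simp: floor_less_cancel)
  have K0: "K \<ge> 0" using x by (simp add: K_def)
  have xk: "x = (of_int K + \<sigma>) / 2 ^ M" by (simp add: \<sigma>_def)
  have li: "lin_interp M x u = (1 - of_real \<sigma>) * u (of_int K / 2 ^ M) + of_real \<sigma> * u ((of_int K + 1) / 2 ^ M)" for u
    by (simp add: lin_interp_def K_def \<sigma>_def Let_def)
  have a: "0 \<le> of_int K / (2::real) ^ M" "of_int K / 2 ^ M \<le> x" using K0 \<sigma> xk by (auto simp: divide_right_mono)
  have ax: "x - of_int K / 2 ^ M = \<sigma> / 2 ^ M" by (subst xk) (simp add: add_divide_distrib)
  have bx: "(of_int K + 1) / 2 ^ M - x = (1 - \<sigma>) / 2 ^ M" by (subst xk) (simp add: add_divide_distrib diff_divide_distrib)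
  have s1: "\<sigma> / 2 ^ M \<le> 1 / 2 ^ M" "(1 - \<sigma>) / 2 ^ M \<le> 1 / 2 ^ M" using \<sigma> by (auto simp: divide_right_mono)
  show thesis
  \<comment> \<open>For \<sigma> = 0 the node K + 1 may lie outside the unit interval, namely at x =
    1; having weight 0, it is replaced by the node K.\<close>
  proof (cases "\<sigma> = 0")
    case True
    show ?thesis
      by (rule that[of 0 "of_int K / 2 ^ M" "of_int K / 2 ^ M"]) (use a ax x s1 li True in auto)
  next
    case False
    have "2 ^ M * x \<le> 2 ^ M" using x by (simp add: mult_left_le)
    moreover have "2 ^ M * x > of_int K" using False \<sigma> by (simp add: \<sigma>_def)
    ultimately have "of_int K < (2::real) ^ M" by linarith
    then have "K < 2 ^ M" by (simp add: of_int_less_iff)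
    then have "K + 1 \<le> 2 ^ M" by simp
    then have "real_of_int (K + 1) \<le> 2 ^ M" by (metis of_int_le_numeral_power_cancel_iff)
    then have b: "(of_int K + 1) / (2::real) ^ M \<le> 1" by simp
    have "\<bar>of_int K / 2 ^ M - x\<bar> \<le> 1 / 2 ^ M" "\<bar>(of_int K + 1) / 2 ^ M - x\<bar> \<le> 1 / 2 ^ M"
      unfolding bx abs_minus_commute[of "of_int K / 2 ^ M"] ax using \<sigma> s1 by (simp_all add: abs_of_nonneg)
    moreover have "of_int K / (2::real) ^ M \<le> 1" using a x by linarith
    ultimately show ?thesis using K0 \<sigma> a x b li
      by (intro that[of \<sigma> "of_int K / 2 ^ M" "(of_int K + 1) / 2 ^ M"]) auto
  qed
qed

section \<open>Tensor product interpolation on the cube\<close>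

definition tensor_interp :: "'i set \<Rightarrow> nat \<Rightarrow> (('i \<Rightarrow> real) \<Rightarrow> complex) \<Rightarrow> ('i \<Rightarrow> real) \<Rightarrow> complex" where
  "tensor_interp I M f x = (\<Sum>m\<in>PiE I (\<lambda>_. {-1..<int M}). \<Sum>k\<in>PiE I (\<lambda>i. pos_set (m i)). \<Sum>s\<in>PiE I (\<lambda>_. {..<3}).
     of_real (\<Prod>i\<in>I. wgt (m i) (s i) * faber1 (m i) (k i) (x i)) *
     f (\<lambda>j. if j \<in> I then node (m j) (k j) (s j) else x j))"

text \<open>Coordinates outside I are frozen at x, which makes induction on I possible. Weights,
  hats and nodes separate over the coordinates, so the sums belonging to coordinate i can be moved
  outside and collapse by \<open>faber1_expansion\<close>: the tensor operator is iterated
  one-variable interpolation.\<close>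

lemma tensor_interp_insert:
  assumes i: "i \<notin> I" and I: "finite I" and x: "0 \<le> x i" "x i \<le> 1"
  shows "tensor_interp (insert i I) M f x = lin_interp M (x i) (\<lambda>t. tensor_interp I M f (x(i := t)))"
proof -
  define L where "L = {-1..<int M}"
  define PI where "PI m = PiE I (\<lambda>i. pos_set (m i))" for m :: "'a \<Rightarrow> int"
  define S where "S = PiE I (\<lambda>_. {..<3::nat})"
  have PI_upd: "PiE I (\<lambda>j. pos_set ((m(i := a)) j)) = PI m" for m a
    unfolding PI_def using i by (intro PiE_cong) auto
  have pr: "(\<Prod>j\<in>insert i I. wgt ((m(i := a)) j) ((s(i := t)) j) * faber1 ((m(i := a)) j) ((k(i := b)) j) (x j)) =
      (wgt a t * faber1 a b (x i)) * (\<Prod>j\<in>I. wgt (m j) (s j) * faber1 (m j) (k j) ((x(i := node a b t)) j))"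
    for m a s t k b
  proof -
    have "(\<Prod>j\<in>I. wgt ((m(i := a)) j) ((s(i := t)) j) * faber1 ((m(i := a)) j) ((k(i := b)) j) (x j)) =
        (\<Prod>j\<in>I. wgt (m j) (s j) * faber1 (m j) (k j) ((x(i := node a b t)) j))"
      using i by (intro prod.cong) auto
    then show ?thesis using i I by simp
  qed
  have ar: "(\<lambda>j. if j \<in> insert i I then node ((m(i := a)) j) ((k(i := b)) j) ((s(i := t)) j) else x j) =
      (\<lambda>j. if j \<in> I then node (m j) (k j) (s j) else (x(i := node a b t)) j)" for m a s t k b
    using i by (auto simp: fun_eq_iff)
  have "tensor_interp (insert i I) M f x = (\<Sum>a\<in>L. \<Sum>m\<in>PiE I (\<lambda>_. L). \<Sum>b\<in>pos_set a. \<Sum>k\<in>PI m. \<Sum>t<3. \<Sum>s\<in>S.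
     of_real ((wgt a t * faber1 a b (x i)) * (\<Prod>j\<in>I. wgt (m j) (s j) * faber1 (m j) (k j) ((x(i := node a b t)) j))) *
     f (\<lambda>j. if j \<in> I then node (m j) (k j) (s j) else (x(i := node a b t)) j))"
    unfolding tensor_interp_def L_def[symmetric]
    by (simp only: sum_PiE_insert[OF i] PI_upd fun_upd_same pr ar S_def)
  also have "\<dots> = (\<Sum>a\<in>L. \<Sum>b\<in>pos_set a. \<Sum>m\<in>PiE I (\<lambda>_. L). \<Sum>k\<in>PI m. \<Sum>t<3. \<Sum>s\<in>S.
     of_real ((wgt a t * faber1 a b (x i)) * (\<Prod>j\<in>I. wgt (m j) (s j) * faber1 (m j) (k j) ((x(i := node a b t)) j))) *
     f (\<lambda>j. if j \<in> I then node (m j) (k j) (s j) else (x(i := node a b t)) j))"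
    by (intro sum.cong refl sum.swap)
  also have "\<dots> = (\<Sum>a\<in>L. \<Sum>b\<in>pos_set a. \<Sum>m\<in>PiE I (\<lambda>_. L). \<Sum>t<3. \<Sum>k\<in>PI m. \<Sum>s\<in>S.
     of_real ((wgt a t * faber1 a b (x i)) * (\<Prod>j\<in>I. wgt (m j) (s j) * faber1 (m j) (k j) ((x(i := node a b t)) j))) *
     f (\<lambda>j. if j \<in> I then node (m j) (k j) (s j) else (x(i := node a b t)) j))"
    by (intro sum.cong refl sum.swap)
  also have "\<dots> = (\<Sum>a\<in>L. \<Sum>b\<in>pos_set a. \<Sum>t<3. \<Sum>m\<in>PiE I (\<lambda>_. L). \<Sum>k\<in>PI m. \<Sum>s\<in>S.
     of_real ((wgt a t * faber1 a b (x i)) * (\<Prod>j\<in>I. wgt (m j) (s j) * faber1 (m j) (k j) ((x(i := node a b t)) j))) *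
     f (\<lambda>j. if j \<in> I then node (m j) (k j) (s j) else (x(i := node a b t)) j))"
    by (intro sum.cong refl sum.swap)
  also have "\<dots> = (\<Sum>a\<in>L. \<Sum>b\<in>pos_set a. \<Sum>t<3. of_real (wgt a t * faber1 a b (x i)) * tensor_interp I M f (x(i := node a b t)))"
    unfolding tensor_interp_def L_def[symmetric] PI_def[symmetric] S_def[symmetric]
    by (simp add: sum_distrib_left mult.assoc)
  also have "\<dots> = lin_interp M (x i) (\<lambda>t. tensor_interp I M f (x(i := t)))"
    unfolding L_def by (rule faber1_expansion[OF x])
  finally show ?thesis .
qed

text \<open>By \<open>lin_interp_convex\<close> in each coordinate, the interpolant is a convex
  combination of values of f at cube points close to x. Closeness to an arbitrary constant c is the
  form of this that survives the induction; later c is the value at x.\<close>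

lemma tensor_interp_near:
  assumes "finite I" and "\<And>j. 0 \<le> x j \<and> x j \<le> 1"
    and "\<And>y. (\<And>j. 0 \<le> y j \<and> y j \<le> 1) \<Longrightarrow> (\<And>j. \<bar>y j - x j\<bar> \<le> 1 / 2 ^ M) \<Longrightarrow> (\<And>j. j \<notin> I \<Longrightarrow> y j = x j) \<Longrightarrow> norm (f y - c) \<le> \<epsilon>"
  shows "norm (tensor_interp I M f x - c) \<le> \<epsilon>"
  using assms
proof (induction I arbitrary: x rule: finite_induct)
  case empty
  then show ?case by (simp add: tensor_interp_def)
next
  case (insert i I)
  have xi: "0 \<le> x i" "x i \<le> 1" using insert.prems by auto
  obtain a b \<sigma> where ab: "0 \<le> \<sigma>" "\<sigma> \<le> 1" "0 \<le> a" "a \<le> 1" "0 \<le> b" "b \<le> 1"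
    "\<bar>a - x i\<bar> \<le> 1 / 2 ^ M" "\<bar>b - x i\<bar> \<le> 1 / 2 ^ M"
    "\<And>u. lin_interp M (x i) u = (1 - of_real \<sigma>) * u a + of_real \<sigma> * u b"
    using lin_interp_convex[OF xi, of M] by metis
  have st: "norm (tensor_interp I M f (x(i := t)) - c) \<le> \<epsilon>" if t: "0 \<le> t" "t \<le> 1" "\<bar>t - x i\<bar> \<le> 1 / 2 ^ M" for t
  proof (rule insert.IH)
    fix y assume y: "\<And>j. 0 \<le> y j \<and> y j \<le> 1" "\<And>j. \<bar>y j - (x(i := t)) j\<bar> \<le> 1 / 2 ^ M" "\<And>j. j \<notin> I \<Longrightarrow> y j = (x(i := t)) j"
    show "norm (f y - c) \<le> \<epsilon>"
    proof (rule insert.prems(2))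
      show "\<bar>y j - x j\<bar> \<le> 1 / 2 ^ M" for j
        using y(2)[of j] y(3)[of i] t insert.hyps by (cases "j = i") auto
      show "j \<notin> insert i I \<Longrightarrow> y j = x j" for j using y(3)[of j] by auto
    qed (use y in auto)
  qed (use insert.prems t in auto)
  have "tensor_interp (insert i I) M f x - c = (1 - of_real \<sigma>) * (tensor_interp I M f (x(i := a)) - c) + of_real \<sigma> * (tensor_interp I M f (x(i := b)) - c)"
    by (simp add: tensor_interp_insert[where M = M and f = f and x = x, OF insert.hyps(2,1) xi] ab(9) algebra_simps)
  also have "norm \<dots> \<le> norm (1 - of_real \<sigma> :: complex) * norm (tensor_interp I M f (x(i := a)) - c) + norm (of_real \<sigma> :: complex) * norm (tensor_interp I M f (x(i := b)) - c)"
    by (intro norm_triangle_le) (simp add: norm_mult)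
  also have "norm (1 - of_real \<sigma> :: complex) = 1 - \<sigma>" using ab by (metis norm_of_real of_real_1 of_real_diff abs_of_nonneg diff_ge_0_iff_ge)
  also have "norm (of_real \<sigma> :: complex) = \<sigma>" using ab by simp
  also have "(1 - \<sigma>) * norm (tensor_interp I M f (x(i := a)) - c) + \<sigma> * norm (tensor_interp I M f (x(i := b)) - c) \<le> (1 - \<sigma>) * \<epsilon> + \<sigma> * \<epsilon>"
    using ab st[of a] st[of b] by (intro add_mono mult_left_mono) auto
  finally show ?case by (simp add: algebra_simps)
qed

section \<open>Faber coefficients as combinations of point values\<close>

lemma diff2_set_expansion:
  fixes A :: "('d::finite) set"
  shows "diff2_set A h f x = (\<Sum>s\<in>PiE A (\<lambda>_. {..<3}).
     of_real (\<Prod>i\<in>A. if s i = Suc 0 then -2 else 1) * f (\<chi> j. if j \<in> A then x $ j + real (s j) * h j else x $ j))"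
proof (induction A arbitrary: x rule: finite_induct[OF finite])
  case 1
  then show ?case by (simp add: diff2_set_empty)
next
  case (2 i A)
  define G where "G y = diff2_set A h f y" for y
  define S where "S = PiE A (\<lambda>_. {..<3::nat})"
  have pr: "(\<Prod>j\<in>insert i A. if (s(i := t)) j = Suc 0 then - 2 else (1::real)) =
     (if t = Suc 0 then -2 else 1) * (\<Prod>j\<in>A. if s j = Suc 0 then -2 else 1)" for s t
  proof -
    have "(\<Prod>j\<in>A. if (s(i := t)) j = Suc 0 then - 2 else (1::real)) = (\<Prod>j\<in>A. if s j = Suc 0 then -2 else 1)"
      using 2 by (intro prod.cong) auto
    then show ?thesis using 2 by simp
  qed
  have ar: "(\<chi> j. if j \<in> insert i A then x $ j + real ((s(i := t)) j) * h j else x $ j) =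
     (\<chi> j. if j \<in> A then (x + (real t * h i) *\<^sub>R axis i 1) $ j + real (s j) * h j else (x + (real t * h i) *\<^sub>R axis i 1) $ j)" for s t
    using 2 by (auto simp: vec_eq_iff axis_def)
  have "(\<Sum>s\<in>PiE (insert i A) (\<lambda>_. {..<3}). of_real (\<Prod>i\<in>insert i A. if s i = Suc 0 then -2 else 1) * f (\<chi> j. if j \<in> insert i A then x $ j + real (s j) * h j else x $ j))
    = (\<Sum>t<3. of_real (if t = Suc 0 then -2 else 1) * G (x + (real t * h i) *\<^sub>R axis i 1))"
    unfolding sum_PiE_insert[OF 2(2)] pr ar G_def 2(3)
    by (simp add: sum_distrib_left mult.assoc)
  also have "\<dots> = diff2_set (insert i A) h f x"
    unfolding sum_lessThan_3 by (simp add: diff2_set_insert[OF 2(2)] diff2_def G_def mult.commute)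
  finally show ?case by simp
qed

text \<open>The normalising power of -2 contributes -1/2 for each active coordinate and turns the
  pattern 1, -2, 1 into \<open>wgt\<close>. In an inactive coordinate only s = 0 has nonzero weight,
  so the sum may treat all coordinates alike.\<close>

lemma faber_coeff_expansion:
  fixes m k :: "int ^ 'd"
  assumes m: "\<And>i. m $ i \<ge> -1"
  shows "faber_coeff m k f = (\<Sum>s\<in>PiE UNIV (\<lambda>_. {..<3}). of_real (\<Prod>i\<in>UNIV. wgt (m $ i) (s i)) * f (\<chi> i. node (m $ i) (k $ i) (s i)))"
proof -
  define A where "A = active m"
  define h where "h i = 2 powr (- real_of_int (m $ i + 1))" for i
  define g where "g s = of_real (\<Prod>i\<in>UNIV. wgt (m $ i) (s i)) * f (\<chi> i. node (m $ i) (k $ i) (s i))" for s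
  \<comment> \<open>Extends a choice of nodes on the active coordinates by 0, the only node of
    nonzero weight at level -1.\<close>
  define e where "e s i = (if i \<in> A then s i else (0::nat))" for s i
  have pp: "2 powr (- real_of_int l) = 1 / 2 ^ nat l" if "l \<ge> 0" for l
    using that by (subst powr_minus_divide) (simp add: powr_real_of_int)
  have nd: "node (m $ i) (k $ i) (e s i) = (if i \<in> A then grid_point m k $ i + real (s i) * h i else grid_point m k $ i)" for s i
  proof (cases "i \<in> A")
    case True
    then have "m $ i \<ge> 0" "m $ i \<noteq> -1" using m[of i] by (auto simp: A_def active_def)
    then have "nat (m $ i + 1) = Suc (nat (m $ i))" by simp
    then show ?thesis using True \<open>m $ i \<ge> 0\<close> pp[of "m $ i"] pp[of "m $ i + 1"]
      by (simp add: e_def node_def grid_point_def h_def field_simps)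
  next
    case False
    then have "m $ i = -1" by (simp add: A_def active_def)
    then show ?thesis using False by (simp add: e_def node_def grid_point_def)
  qed
  have wg: "(\<Prod>i\<in>UNIV. wgt (m $ i) (e s i)) = (- 1/2) ^ card A * (\<Prod>i\<in>A. if s i = Suc 0 then -2 else 1)" for s
  proof -
    have "(\<Prod>i\<in>UNIV. wgt (m $ i) (e s i)) = (\<Prod>i\<in>A. wgt (m $ i) (e s i))"
      by (intro prod.mono_neutral_right) (auto simp: e_def wgt_def A_def active_def)
    also have "\<dots> = (\<Prod>i\<in>A. (- 1/2) * (if s i = Suc 0 then -2 else 1))"
      by (intro prod.cong) (auto simp: e_def wgt_def A_def active_def)
    also have "\<dots> = (- 1/2) ^ card A * (\<Prod>i\<in>A. if s i = Suc 0 then -2 else 1)"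
      by (simp only: prod.distrib prod_constant)
    finally show ?thesis .
  qed
  have "faber_coeff m k f = (-2) powi (- int (card A)) *
     (\<Sum>s\<in>PiE A (\<lambda>_. {..<3}). of_real (\<Prod>i\<in>A. if s i = Suc 0 then -2 else 1) *
       f (\<chi> j. if j \<in> A then grid_point m k $ j + real (s j) * h j else grid_point m k $ j))"
    unfolding faber_coeff_def diff2_set_expansion A_def h_def ..
  also have "(-2) powi (- int (card A)) = (of_real ((- 1/2) ^ card A) :: complex)"
  proof -
    have "(-2) powi (- int (card A)) = inverse ((-2 :: complex) ^ card A)" by (simp add: power_int_minus)
    also have "\<dots> = (inverse (-2)) ^ card A" by (rule power_inverse[symmetric])
    also have "inverse (-2 :: complex) = of_real (- 1/2)" by simp
    finally show ?thesis by (simp only: of_real_power)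
  qed
  also have "of_real ((- 1/2) ^ card A) * (\<Sum>s\<in>PiE A (\<lambda>_. {..<3}). of_real (\<Prod>i\<in>A. if s i = Suc 0 then -2 else 1) *
       f (\<chi> j. if j \<in> A then grid_point m k $ j + real (s j) * h j else grid_point m k $ j)) =
     (\<Sum>s\<in>PiE A (\<lambda>_. {..<3}). g (e s))"
    unfolding g_def wg nd by (simp add: sum_distrib_left mult.assoc)
  also have "\<dots> = (\<Sum>s\<in>{s \<in> PiE UNIV (\<lambda>_. {..<3}). \<forall>i. i \<notin> A \<longrightarrow> s i = 0}. g s)"
    by (intro sum.reindex_bij_witness[of _ "\<lambda>s. restrict s A" e])
      (auto simp: e_def fun_eq_iff PiE_def Pi_def extensional_def restrict_def)
  also have "\<dots> = (\<Sum>s\<in>PiE UNIV (\<lambda>_. {..<3}). g s)"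
  proof (intro sum.mono_neutral_left ballI)
    fix s :: "'d \<Rightarrow> nat"
    assume "s \<in> PiE UNIV (\<lambda>_. {..<3}) - {s \<in> PiE UNIV (\<lambda>_. {..<3}). \<forall>i. i \<notin> A \<longrightarrow> s i = 0}"
    then obtain i where i: "i \<notin> A" "s i \<noteq> 0" by auto
    then have "wgt (m $ i) (s i) = 0" by (auto simp: wgt_def A_def active_def)
    then have "(\<Prod>i\<in>UNIV. wgt (m $ i) (s i)) = 0" by (intro prod_zero) auto
    then show "g s = 0" by (simp add: g_def)
  qed (auto simp: finite_PiE)
  finally show ?thesis by (simp add: g_def)
qed

lemma sum_vec_reindex:
  fixes T :: "'d::finite \<Rightarrow> 'a set"
  shows "(\<Sum>k\<in>{k. \<forall>i. k $ i \<in> T i}. g k) = (\<Sum>k\<in>PiE UNIV T. g (\<chi> i. k i))"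
  by (intro sum.reindex_bij_witness[of _ vec_lambda vec_nth]) (auto simp: PiE_def Pi_def)

lemma tensor_interp_vec:
  fixes x :: "real ^ 'd"
  shows "tensor_interp UNIV M (\<lambda>y. f (vec_lambda y)) (vec_nth x) =
    (\<Sum>m\<in>PiE UNIV (\<lambda>_. {-1..<int M}). \<Sum>k\<in>PiE UNIV (\<lambda>i. pos_set (m i)).
       faber_coeff (vec_lambda m) (vec_lambda k) f * of_real (faber (vec_lambda m) (vec_lambda k) x))"
  unfolding tensor_interp_def
proof (intro sum.cong refl)
  fix m k :: "'d \<Rightarrow> int"
  assume "m \<in> PiE UNIV (\<lambda>_. {-1..<int M})"
  then have m: "vec_lambda m $ i \<ge> -1" for i by (auto simp: PiE_def Pi_def)
  show "(\<Sum>s\<in>PiE UNIV (\<lambda>_. {..<3}).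
          of_real (\<Prod>i\<in>UNIV. wgt (m i) (s i) * faber1 (m i) (k i) (x $ i)) * f (\<chi> j. if j \<in> UNIV then node (m j) (k j) (s j) else x $ j)) =
       faber_coeff (vec_lambda m) (vec_lambda k) f * of_real (faber (vec_lambda m) (vec_lambda k) x)"
    unfolding faber_coeff_expansion[OF m] faber_def prod.distrib sum_distrib_right of_real_mult
    by (intro sum.cong refl) simp
qed

section \<open>Error bounds from coefficient bounds\<close>

lemma sum_half_pow_le: "(\<Sum>a\<in>{int n + 1..int N}. (1/2::real) ^ nat \<bar>a\<bar>) \<le> (1/2) ^ n"
proof (induction N)
  case 0 then show ?case by simp
next
  case (Suc N)
  show ?case
  proof (cases "n \<le> N")
    case True
    have "(\<Sum>a\<in>{int n + 1..int M}. (1/2::real) ^ nat \<bar>a\<bar>) = (1/2) ^ n - (1/2) ^ M" if "n \<le> M" for M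
      using that
    proof (induction M rule: dec_induct)
      case (step M)
      have "{int n + 1..int (Suc M)} = insert (int (Suc M)) {int n + 1..int M}" using step by auto
      moreover have "nat \<bar>1 + int M\<bar> = Suc M" by simp
      ultimately show ?case using step by simp
    qed simp
    then show ?thesis using True by (metis le_SucI diff_left_mono diff_zero zero_le_power zero_le_divide_1_iff zero_le_numeral)
  qed auto
qed

text \<open>One coordinate of level a is split off. For |a| <= n the others must exceed n - |a|, and
  the two powers of 1/2 recombine to (1/2) ^ n for each of at most n + 2 values of a; this count
  yields one power of n + 1 for every coordinate after the first. For |a| > n a geometric tail is
  enough.\<close>

lemma hyperbolic_tail:
  assumes "finite I"
  shows "(\<Sum>m\<in>PiE I (\<lambda>_. {-1..int N}). if n < (\<Sum>i\<in>I. nat \<bar>m i\<bar>) then (1/2::real) ^ (\<Sum>i\<in>I. nat \<bar>m i\<bar>) else 0)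
     \<le> 4 ^ card I * (real n + 1) ^ (card I - 1) * (1/2) ^ n"
  using assms
proof (induction I arbitrary: n rule: finite_induct)
  case empty
  then show ?case by simp
next
  case (insert i I)
  define L where "L = {-1..int N}"
  define PI where "PI = PiE I (\<lambda>_. L)"
  define s where "s m = (\<Sum>i\<in>I. nat \<bar>m i\<bar>)" for m :: "'a \<Rightarrow> int"
  define S where "S n = (\<Sum>m\<in>PI. if n < s m then (1/2::real) ^ s m else 0)" for n
  have IH: "S n \<le> 4 ^ card I * (real n + 1) ^ (card I - 1) * (1/2) ^ n" for n
    unfolding S_def PI_def L_def s_def by (rule insert.IH)
  have L_split: "L = insert (-1) {0..int N}" by (auto simp: L_def)
  \<comment> \<open>The contributions are 1/2 from a = -1, 1 from a = 0 and at most 1 from a >=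
    1.\<close>
  have Lsum: "(\<Sum>a\<in>L. (1/2::real) ^ nat \<bar>a\<bar>) \<le> 5/2"
  proof -
    have "{0..int N} = insert 0 {int 0 + 1..int N}" by auto
    then have "(\<Sum>a\<in>{0..int N}. (1/2::real) ^ nat \<bar>a\<bar>) = 1 + (\<Sum>a\<in>{int 0 + 1..int N}. (1/2::real) ^ nat \<bar>a\<bar>)" by simp
    then show ?thesis using sum_half_pow_le[of 0 N] by (simp add: L_split)
  qed
  have tot: "(\<Sum>m\<in>PI. (1/2::real) ^ s m) \<le> (5/2) ^ card I"
  proof -
    have "(\<Sum>m\<in>PI. (1/2::real) ^ s m) = (\<Sum>m\<in>PI. \<Prod>i\<in>I. (1/2::real) ^ nat \<bar>m i\<bar>)"
      by (simp add: s_def power_sum)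
    also have "\<dots> = (\<Prod>i\<in>I. \<Sum>a\<in>L. (1/2::real) ^ nat \<bar>a\<bar>)"
      unfolding PI_def using insert by (intro prod_sum_PiE[symmetric]) (auto simp: L_def)
    also have "\<dots> = (\<Sum>a\<in>L. (1/2::real) ^ nat \<bar>a\<bar>) ^ card I" by simp
    also have "\<dots> \<le> (5/2) ^ card I" using Lsum by (intro power_mono) (auto intro!: sum_nonneg)
    finally show ?thesis .
  qed
  have s_upd: "(\<Sum>j\<in>insert i I. nat \<bar>(m(i := a)) j\<bar>) = nat \<bar>a\<bar> + s m" for m :: "'a \<Rightarrow> int" and a
  proof -
    have "(\<Sum>j\<in>I. nat \<bar>(m(i := a)) j\<bar>) = s m" unfolding s_def using insert by (intro sum.cong) auto
    then show ?thesis using insert by simp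
  qed
  have "(\<Sum>m\<in>PiE (insert i I) (\<lambda>_. L). if n < (\<Sum>j\<in>insert i I. nat \<bar>m j\<bar>) then (1/2::real) ^ (\<Sum>j\<in>insert i I. nat \<bar>m j\<bar>) else 0)
    = (\<Sum>a\<in>L. \<Sum>m\<in>PI. if n < nat \<bar>a\<bar> + s m then (1/2) ^ (nat \<bar>a\<bar> + s m) else 0)"
    unfolding sum_PiE_insert[OF insert.hyps(2)] s_upd PI_def ..
  also have "\<dots> \<le> (\<Sum>a\<in>L. (if nat \<bar>a\<bar> \<le> n then (1/2) ^ nat \<bar>a\<bar> * S (n - nat \<bar>a\<bar>) else 0) +
        (if n < nat \<bar>a\<bar> then (1/2) ^ nat \<bar>a\<bar> * (5/2) ^ card I else 0))"
  proof (intro sum_mono)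
    fix a
    show "(\<Sum>m\<in>PI. if n < nat \<bar>a\<bar> + s m then (1/2::real) ^ (nat \<bar>a\<bar> + s m) else 0) \<le> (if nat \<bar>a\<bar> \<le> n then (1/2) ^ nat \<bar>a\<bar> * S (n - nat \<bar>a\<bar>) else 0) +
        (if n < nat \<bar>a\<bar> then (1/2) ^ nat \<bar>a\<bar> * (5/2) ^ card I else 0)"
    proof (cases "nat \<bar>a\<bar> \<le> n")
      case True
      have "(\<Sum>m\<in>PI. if n < nat \<bar>a\<bar> + s m then (1/2::real) ^ (nat \<bar>a\<bar> + s m) else 0) = (1/2) ^ nat \<bar>a\<bar> * S (n - nat \<bar>a\<bar>)"
        unfolding S_def sum_distrib_left using True by (intro sum.cong) (auto simp: power_add)
      then show ?thesis using True by simp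
    next
      case False
      have "(\<Sum>m\<in>PI. if n < nat \<bar>a\<bar> + s m then (1/2::real) ^ (nat \<bar>a\<bar> + s m) else 0) = (1/2) ^ nat \<bar>a\<bar> * (\<Sum>m\<in>PI. (1/2::real) ^ s m)"
        unfolding sum_distrib_left using False by (intro sum.cong) (auto simp: power_add)
      also have "\<dots> \<le> (1/2) ^ nat \<bar>a\<bar> * (5/2) ^ card I" using tot by (intro mult_left_mono) auto
      finally show ?thesis using False by simp
    qed
  qed
  also have "\<dots> = (\<Sum>a\<in>L. if nat \<bar>a\<bar> \<le> n then (1/2) ^ nat \<bar>a\<bar> * S (n - nat \<bar>a\<bar>) else 0) +
      (\<Sum>a\<in>L. if n < nat \<bar>a\<bar> then (1/2) ^ nat \<bar>a\<bar> else 0) * (5/2) ^ card I"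
    unfolding sum.distrib sum_distrib_right by (intro arg_cong2[where f = "(+)"] refl sum.cong) auto
  also have "(\<Sum>a\<in>L. if n < nat \<bar>a\<bar> then (1/2::real) ^ nat \<bar>a\<bar> else 0) \<le> 2 * (1/2) ^ n"
  proof -
    have "(\<Sum>a\<in>{0..int N}. if n < nat \<bar>a\<bar> then (1/2::real) ^ nat \<bar>a\<bar> else 0) = (\<Sum>a\<in>{int n + 1..int N}. (1/2::real) ^ nat \<bar>a\<bar>)"
      by (intro sum.mono_neutral_cong_right) auto
    also have "\<dots> \<le> (1/2) ^ n" by (rule sum_half_pow_le)
    finally have "(\<Sum>a\<in>{0..int N}. if n < nat \<bar>a\<bar> then (1/2::real) ^ nat \<bar>a\<bar> else 0) \<le> (1/2) ^ n" .
    moreover have "(\<Sum>a\<in>L. if n < nat \<bar>a\<bar> then (1/2::real) ^ nat \<bar>a\<bar> else 0) =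
        (if n < 1 then 1/2 else 0) + (\<Sum>a\<in>{0..int N}. if n < nat \<bar>a\<bar> then (1/2::real) ^ nat \<bar>a\<bar> else 0)"
      unfolding L_split by (subst sum.insert) auto
    moreover have "(if n < 1 then 1/2 else 0) \<le> (1/2::real) ^ n" by auto
    ultimately show ?thesis by linarith
  qed
  also have "(\<Sum>a\<in>L. if nat \<bar>a\<bar> \<le> n then (1/2) ^ nat \<bar>a\<bar> * S (n - nat \<bar>a\<bar>) else 0) \<le> 2 * 4 ^ card I * (real n + 1) ^ (card (insert i I) - 1) * (1/2) ^ n"
  \<comment> \<open>For empty I the natural number \<open>card I - 1\<close> is cut off at 0 and no
    factor n + 1 may be spent; there the term vanishes, because an empty sum of levels exceeds
    nothing.\<close>
  proof (cases "I = {}")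
    case True
    then have "S n = 0" for n by (simp add: S_def PI_def s_def)
    then show ?thesis by (simp add: sum.neutral)
  next
    case False
    then have cI: "card I > 0" using insert by (simp add: card_gt_0_iff)
    have "(\<Sum>a\<in>L. if nat \<bar>a\<bar> \<le> n then (1/2) ^ nat \<bar>a\<bar> * S (n - nat \<bar>a\<bar>) else 0) =
      (\<Sum>a\<in>{a\<in>L. nat \<bar>a\<bar> \<le> n}. (1/2) ^ nat \<bar>a\<bar> * S (n - nat \<bar>a\<bar>))"
      by (intro sum.mono_neutral_cong_right) (auto simp: L_def)
    also have "\<dots> \<le> (\<Sum>a\<in>{a\<in>L. nat \<bar>a\<bar> \<le> n}. 4 ^ card I * (real n + 1) ^ (card I - 1) * (1/2) ^ n)"
    proof (intro sum_mono)
      fix a assume a: "a \<in> {a\<in>L. nat \<bar>a\<bar> \<le> n}"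
      have "(1/2) ^ nat \<bar>a\<bar> * S (n - nat \<bar>a\<bar>) \<le> (1/2) ^ nat \<bar>a\<bar> * (4 ^ card I * (real (n - nat \<bar>a\<bar>) + 1) ^ (card I - 1) * (1/2) ^ (n - nat \<bar>a\<bar>))"
        using IH by (intro mult_left_mono) auto
      also have "\<dots> \<le> (1/2) ^ nat \<bar>a\<bar> * (4 ^ card I * (real n + 1) ^ (card I - 1) * (1/2) ^ (n - nat \<bar>a\<bar>))"
        by (intro mult_left_mono mult_right_mono power_mono) auto
      also have "\<dots> = 4 ^ card I * (real n + 1) ^ (card I - 1) * ((1/2) ^ nat \<bar>a\<bar> * (1/2) ^ (n - nat \<bar>a\<bar>))" by (simp add: mult_ac)
      also have "(1/2::real) ^ nat \<bar>a\<bar> * (1/2) ^ (n - nat \<bar>a\<bar>) = (1/2) ^ n"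
        using a by (simp flip: power_add)
      finally show "(1/2) ^ nat \<bar>a\<bar> * S (n - nat \<bar>a\<bar>) \<le> 4 ^ card I * (real n + 1) ^ (card I - 1) * (1/2) ^ n" .
    qed
    also have "\<dots> = real (card {a\<in>L. nat \<bar>a\<bar> \<le> n}) * (4 ^ card I * (real n + 1) ^ (card I - 1) * (1/2) ^ n)" by simp
    also have "\<dots> \<le> 2 * (real n + 1) * (4 ^ card I * (real n + 1) ^ (card I - 1) * (1/2) ^ n)"
    proof (intro mult_right_mono)
      have "card {a\<in>L. nat \<bar>a\<bar> \<le> n} \<le> card {-1..int n}" by (intro card_mono) (auto simp: L_def)
      then have "real (card {a\<in>L. nat \<bar>a\<bar> \<le> n}) \<le> real (n + 2)" by (simp only: of_nat_le_iff) simp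
      then show "real (card {a\<in>L. nat \<bar>a\<bar> \<le> n}) \<le> 2 * (real n + 1)" by simp
    qed auto
    also have "\<dots> = 2 * 4 ^ card I * ((real n + 1) * (real n + 1) ^ (card I - 1)) * (1/2) ^ n" by (simp add: mult_ac)
    also have "(real n + 1) * (real n + 1) ^ (card I - 1) = (real n + 1) ^ (card (insert i I) - 1)"
      using cI insert by (simp flip: power_Suc)
    finally show ?thesis .
  qed
  \<comment> \<open>Of the constant 4 * 4 ^ card I one half was used for |a| <= n; the other half
    absorbs this term.\<close>
  also have "2 * (1/2) ^ n * (5/2) ^ card I \<le> 2 * (1/2::real) ^ n * (4 ^ card I * (real n + 1) ^ (card (insert i I) - 1))"
  proof (intro mult_left_mono)
    have "(5/2::real) ^ card I * 1 \<le> 4 ^ card I * (real n + 1) ^ (card (insert i I) - 1)"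
      by (intro mult_mono power_mono one_le_power) auto
    then show "(5/2::real) ^ card I \<le> 4 ^ card I * (real n + 1) ^ (card (insert i I) - 1)" by simp
  qed auto
  finally show ?case using insert unfolding L_def by (simp add: mult_right_mono algebra_simps)
qed

text \<open>Here the exponent is the sum of m rather than of |m|. The two differ at level -1 only,
  by 2 against 1/2, hence a factor 4 per coordinate; another 4 comes from
  \<open>hyperbolic_tail\<close> and a 2 from n + 1 <= 2 n, together 32.\<close>

lemma hyperbolic_tail_powr:
  assumes n: "n \<ge> 1"
  shows "(\<Sum>m\<in>PiE (UNIV::'d::finite set) (\<lambda>_. {-1..int N}). if n < (\<Sum>i\<in>UNIV. nat \<bar>m i\<bar>) then 2 powr (- real_of_int (\<Sum>i\<in>UNIV. m i)) else 0)
     \<le> 32 ^ CARD('d) * real n ^ (CARD('d) - 1) * (1/2) ^ n"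
proof -
  define S where "S m = (\<Sum>i\<in>UNIV. nat \<bar>m i\<bar>)" for m :: "'d \<Rightarrow> int"
  have bd: "2 powr (- real_of_int (\<Sum>i\<in>UNIV. m i)) \<le> 4 ^ CARD('d) * (1/2) ^ S m" if "m \<in> PiE UNIV (\<lambda>_. {-1..int N})" for m :: "'d \<Rightarrow> int"
  proof -
    have "2 powr (- real_of_int (\<Sum>i\<in>UNIV. m i)) = (\<Prod>i\<in>UNIV. 2 powr (- real_of_int (m i)))"
      by (simp add: powr_sum flip: sum_negf)
    also have "\<dots> \<le> (\<Prod>i\<in>UNIV. 4 * (1/2) ^ nat \<bar>m i\<bar>)"
    proof (intro prod_mono conjI)
      fix i
      have mi: "m i \<ge> -1" using that by (auto simp: PiE_def Pi_def)
      show "2 powr (- real_of_int (m i)) \<le> 4 * (1/2) ^ nat \<bar>m i\<bar>"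
      proof (cases "m i = -1")
        case False
        then have "m i \<ge> 0" using mi by simp
        then have "2 powr (- real_of_int (m i)) = (1/2) ^ nat \<bar>m i\<bar>"
          by (subst powr_minus_divide) (simp add: powr_real_of_int power_one_over)
        then show ?thesis by simp
      qed simp
    qed auto
    also have "\<dots> = 4 ^ CARD('d) * (1/2) ^ S m" by (simp add: prod.distrib S_def power_sum)
    finally show ?thesis .
  qed
  have "(\<Sum>m\<in>PiE (UNIV::'d set) (\<lambda>_. {-1..int N}). if n < S m then 2 powr (- real_of_int (\<Sum>i\<in>UNIV. m i)) else 0) \<le>
     (\<Sum>m\<in>PiE (UNIV::'d set) (\<lambda>_. {-1..int N}). 4 ^ CARD('d) * (if n < S m then (1/2) ^ S m else 0))"
    by (intro sum_mono) (use bd in auto)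
  also have "\<dots> \<le> 4 ^ CARD('d) * (4 ^ CARD('d) * (real n + 1) ^ (CARD('d) - 1) * (1/2) ^ n)"
    unfolding sum_distrib_left[symmetric] S_def by (intro mult_left_mono hyperbolic_tail) auto
  also have "(real n + 1) ^ (CARD('d) - 1) \<le> (2 * real n) ^ (CARD('d) - 1)"
    using n by (intro power_mono) auto
  also have "(2 * real n) ^ (CARD('d) - 1) \<le> 2 ^ CARD('d) * real n ^ (CARD('d) - 1)"
    unfolding power_mult_distrib by (intro mult_right_mono power_increasing) auto
  also have "4 ^ CARD('d) * (4 ^ CARD('d) * (2 ^ CARD('d) * real n ^ (CARD('d) - 1)) * (1/2) ^ n) =
     (4 * 4 * 2) ^ CARD('d) * real n ^ (CARD('d) - 1) * (1/2::real) ^ n"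
    unfolding power_mult_distrib by (simp only: mult_ac)
  finally show ?thesis by (simp add: S_def mult_right_mono mult_left_mono)
qed

section \<open>The truncation error on dyadic cells\<close>

lemma abs_sum_eq: "(\<Sum>i\<in>UNIV. \<bar>m i\<bar>) \<le> int n \<longleftrightarrow> \<not> n < (\<Sum>i\<in>(UNIV::'d::finite set). nat \<bar>m i\<bar>)"
proof -
  have "(\<Sum>i\<in>UNIV. \<bar>m i\<bar>) = int (\<Sum>i\<in>UNIV. nat \<bar>m i\<bar>)" by simp
  then show ?thesis by linarith
qed

text \<open>The cross is written inside the cube of levels up to N, where it can be subtracted term
  by term from the interpolant.\<close>

lemma faber_trunc_alt:
  fixes x :: "real ^ 'd"
  assumes "n \<le> N"
  shows "faber_trunc n f x = (\<Sum>m\<in>PiE UNIV (\<lambda>_. {-1..int N}). if n < (\<Sum>i\<in>UNIV. nat \<bar>m i\<bar>) then 0 else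
    (\<Sum>k\<in>PiE UNIV (\<lambda>i. pos_set (m i)). faber_coeff (vec_lambda m) (vec_lambda k) f * of_real (faber (vec_lambda m) (vec_lambda k) x)))"
proof -
  have "faber_trunc n f x = (\<Sum>m\<in>{m. \<forall>i. m $ i \<in> {-1..int N}}. if n < (\<Sum>i\<in>UNIV. nat \<bar>m $ i\<bar>) then 0 else
    (\<Sum>k\<in>pos_set_d m. faber_coeff m k f * of_real (faber m k x)))"
    unfolding faber_trunc_def
  proof (rule sum.mono_neutral_cong_left)
    show "finite {m :: int ^ 'd. \<forall>i. m $ i \<in> {-1..int N}}" by (rule finite_vec_range) simp
    show "levels n \<subseteq> {m :: int ^ 'd. \<forall>i. m $ i \<in> {-1..int N}}"
    proof
      fix m :: "int ^ 'd" assume m: "m \<in> levels n"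
      have "\<bar>m $ i\<bar> \<le> (\<Sum>i\<in>UNIV. \<bar>m $ i\<bar>)" for i by (rule member_le_sum) auto
      then show "m \<in> {m. \<forall>i. m $ i \<in> {-1..int N}}" using m assms by (auto simp: levels_def) (smt (verit) of_nat_mono)
    qed
  qed (auto simp: levels_def abs_sum_eq)
  also have "\<dots> = (\<Sum>m\<in>PiE UNIV (\<lambda>_. {-1..int N}). if n < (\<Sum>i\<in>UNIV. nat \<bar>vec_lambda m $ i\<bar>) then 0 else
    (\<Sum>k\<in>pos_set_d (vec_lambda m). faber_coeff (vec_lambda m) k f * of_real (faber (vec_lambda m) k x)))"
    by (rule sum_vec_reindex)
  finally show ?thesis unfolding pos_set_d_def sum_vec_reindex vec_lambda_beta .
qed

text \<open>Interpolant and truncation share their terms, so exactly the levels with |m| > n remain.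
  The bound depends on x only through a cell containing it, which makes it the integrand of
  \<open>dyadic_embedding\<close>.\<close>

lemma interp_minus_trunc_bound:
  fixes x :: "real ^ 'd" and f :: "real ^ 'd \<Rightarrow> complex"
  assumes n: "n \<le> N" and x: "x \<in> unit_cube"
    and z: "z \<in> PiE UNIV (\<lambda>_. {0..<2 ^ N})" and zx: "\<And>i. of_int (z i) \<le> 2 ^ N * x $ i" "\<And>i. 2 ^ N * x $ i \<le> of_int (z i + 1)"
  shows "norm (tensor_interp UNIV (Suc N) (\<lambda>y. f (vec_lambda y)) (vec_nth x) - faber_trunc n f x) \<le>
     (\<Sum>m\<in>PiE UNIV (\<lambda>_. {-1..int N}). \<Sum>k\<in>PiE UNIV (\<lambda>i. pos_set (m i)).
       (if n < (\<Sum>i\<in>UNIV. nat \<bar>m i\<bar>) then norm (faber_coeff (vec_lambda m) (vec_lambda k) f) else 0) * (\<Prod>i\<in>UNIV. dyadic_inc N (m i) (k i) (z i)))"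
proof -
  have e: "{-1..<int (Suc N)} = {-1..int N}" by auto
  have eq: "tensor_interp UNIV (Suc N) (\<lambda>y. f (vec_lambda y)) (vec_nth x) - faber_trunc n f x =
     (\<Sum>m\<in>PiE UNIV (\<lambda>_. {-1..int N}). \<Sum>k\<in>PiE UNIV (\<lambda>i. pos_set (m i)).
       (if n < (\<Sum>i\<in>UNIV. nat \<bar>m i\<bar>) then faber_coeff (vec_lambda m) (vec_lambda k) f * of_real (faber (vec_lambda m) (vec_lambda k) x) else 0))"
    unfolding tensor_interp_vec faber_trunc_alt[OF n] sum_subtractf[symmetric] e
    by (intro sum.cong refl) auto
  show ?thesis
    unfolding eq
  proof (intro sum_norm_le)
    fix m k :: "'d \<Rightarrow> int"
    assume m: "m \<in> PiE UNIV (\<lambda>_. {-1..int N})" and "k \<in> PiE UNIV (\<lambda>i. pos_set (m i))"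
    have x01: "0 \<le> x $ i" "x $ i \<le> 1" for i using x by (auto simp: mem_box_cart)
    have "0 \<le> faber (vec_lambda m) (vec_lambda k) x" unfolding faber_def
      using x01 by (intro prod_nonneg) (auto intro: faber1_nonneg)
    moreover have "faber (vec_lambda m) (vec_lambda k) x \<le> (\<Prod>i\<in>UNIV. dyadic_inc N (m i) (k i) (z i))"
      unfolding faber_def
    proof (intro prod_mono conjI)
      fix i
      show "faber1 (vec_lambda m $ i) (vec_lambda k $ i) (x $ i) \<le> dyadic_inc N (m i) (k i) (z i)"
        using m z zx by (simp, intro faber1_le_dyadic_inc) (auto simp: PiE_def Pi_def)
    qed (use x01 in \<open>auto intro: faber1_nonneg\<close>)
    ultimately show "norm (if n < (\<Sum>i\<in>UNIV. nat \<bar>m i\<bar>) then faber_coeff (vec_lambda m) (vec_lambda k) f * of_real (faber (vec_lambda m) (vec_lambda k) x) else 0)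
       \<le> (if n < (\<Sum>i\<in>UNIV. nat \<bar>m i\<bar>) then norm (faber_coeff (vec_lambda m) (vec_lambda k) f) else 0) * (\<Prod>i\<in>UNIV. dyadic_inc N (m i) (k i) (z i))"
      by (auto simp: norm_mult intro!: mult_left_mono)
  qed
qed

text \<open>The integrand is compared with a sum of indicators of closed cells of volume 2 powr (- N
  d); their overlaps at the boundaries only increase that sum.\<close>

lemma nn_integral_step_bound:
  fixes h :: "real ^ 'd \<Rightarrow> ennreal" and U :: "('d \<Rightarrow> int) \<Rightarrow> real"
  assumes U: "\<And>z. U z \<ge> 0"
    and h: "\<And>x z. x \<in> unit_cube \<Longrightarrow> z \<in> PiE UNIV (\<lambda>_. {0..<2 ^ N}) \<Longrightarrow>
       (\<And>i. of_int (z i) \<le> 2 ^ N * x $ i) \<Longrightarrow> (\<And>i. 2 ^ N * x $ i \<le> of_int (z i + 1)) \<Longrightarrow> h x \<le> ennreal (U z)"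
  shows "(\<integral>\<^sup>+x. h x \<partial>lebesgue_on unit_cube) \<le> ennreal (\<Sum>z\<in>PiE UNIV (\<lambda>_. {0..<2 ^ N}). ((1/2) ^ N) ^ CARD('d) * U z)"
proof -
  define Z :: "('d \<Rightarrow> int) set" where "Z = PiE UNIV (\<lambda>_. {0..<2 ^ N})"
  have Z: "finite Z" by (simp add: Z_def finite_PiE)
  define cell where "cell z = (cbox (\<chi> i. of_int (z i) / 2 ^ N) (\<chi> i. (of_int (z i) + 1) / 2 ^ N) :: (real ^ 'd) set)" for z :: "'d \<Rightarrow> int"
  have cell: "x \<in> cell z \<longleftrightarrow> (\<forall>i. of_int (z i) \<le> 2 ^ N * x $ i \<and> 2 ^ N * x $ i \<le> of_int (z i + 1))" for x z
    unfolding cell_def mem_box_cart by (simp add: field_simps)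
  have "(\<integral>\<^sup>+x. h x \<partial>lebesgue_on unit_cube) = (\<integral>\<^sup>+x. h x * indicator unit_cube x \<partial>lebesgue)"
    by (rule nn_integral_restrict_space) auto
  also have "\<dots> \<le> (\<integral>\<^sup>+x. (\<Sum>z\<in>Z. ennreal (U z) * indicator (cell z) x) \<partial>lebesgue)"
  proof (intro nn_integral_mono)
    fix x :: "real ^ 'd"
    show "h x * indicator unit_cube x \<le> (\<Sum>z\<in>Z. ennreal (U z) * indicator (cell z) x)"
    proof (cases "x \<in> unit_cube")
      case True
      \<comment> \<open>The minimum assigns points with coordinate 1 to the last cell.\<close>
      define z where "z i = min \<lfloor>2 ^ N * x $ i\<rfloor> (2 ^ N - 1)" for i
      have x01: "0 \<le> x $ i" "x $ i \<le> 1" for i using True by (auto simp: mem_box_cart)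
      have zZ: "z \<in> Z" using x01 by (auto simp: Z_def z_def)
      have zb: "of_int (z i) \<le> 2 ^ N * x $ i" "2 ^ N * x $ i \<le> of_int (z i + 1)" for i
      proof -
        have "real_of_int (z i) \<le> of_int \<lfloor>2 ^ N * x $ i\<rfloor>" unfolding z_def by simp
        then show "of_int (z i) \<le> 2 ^ N * x $ i" by (meson of_int_floor_le order_trans)
        have "2 ^ N * x $ i \<le> 2 ^ N" using x01 by (simp add: mult_left_le)
        moreover have "2 ^ N * x $ i \<le> of_int (\<lfloor>2 ^ N * x $ i\<rfloor> + 1)" by linarith
        ultimately show "2 ^ N * x $ i \<le> of_int (z i + 1)" unfolding z_def min_def by auto
      qed
      have "h x \<le> ennreal (U z)" using h[OF True, of z] zZ zb by (simp add: Z_def)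
      also have "\<dots> = ennreal (U z) * indicator (cell z) x" using zb by (simp add: cell)
      also have "\<dots> \<le> (\<Sum>z\<in>Z. ennreal (U z) * indicator (cell z) x)" using Z zZ by (intro member_le_sum) auto
      finally show ?thesis using True by simp
    qed simp
  qed
  also have "\<dots> = (\<Sum>z\<in>Z. ennreal (U z) * emeasure lebesgue (cell z))"
  proof -
    have [measurable]: "cell z \<in> sets lebesgue" for z by (simp add: cell_def)
    show ?thesis by (subst nn_integral_sum) (simp_all add: nn_integral_cmult_indicator)
  qed
  also have "\<dots> = (\<Sum>z\<in>Z. ennreal (((1/2) ^ N) ^ CARD('d) * U z))"
  proof (intro sum.cong refl)
    fix z
    have "emeasure lebesgue (cell z) = ennreal (measure lborel (cell z))"
      by (simp add: cell_def emeasure_lborel_cbox_eq measure_def)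
    also have "measure lborel (cell z) = (\<Prod>i\<in>UNIV. (of_int (z i) + 1) / 2 ^ N - of_int (z i) / 2 ^ N)"
      unfolding cell_def by (subst content_cbox_cart) (auto simp: interval_eq_empty_cart field_simps)
    also have "\<dots> = ((1/2) ^ N) ^ CARD('d)" by (simp add: power_one_over flip: diff_divide_distrib)
    finally show "ennreal (U z) * emeasure lebesgue (cell z) = ennreal (((1/2) ^ N) ^ CARD('d) * U z)"
      using U by (simp add: ennreal_mult mult.commute)
  qed
  also have "\<dots> = ennreal (\<Sum>z\<in>Z. ((1/2) ^ N) ^ CARD('d) * U z)" using U by (intro sum_ennreal) auto
  finally show ?thesis by (simp add: Z_def)
qed

text \<open>\<open>tensor_interp_near\<close> evaluates f only at cube points close to x, so
  continuity relative to the cube is enough; the distance is estimated through the l_1 norm.\<close>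

lemma tensor_interp_tendsto:
  fixes x :: "real ^ 'd" and f :: "real ^ 'd \<Rightarrow> complex"
  assumes f: "continuous_on unit_cube f" and x: "x \<in> unit_cube"
  shows "(\<lambda>N. tensor_interp UNIV (Suc N) (\<lambda>y. f (vec_lambda y)) (vec_nth x)) \<longlonglongrightarrow> f x"
proof (rule LIMSEQ_I)
  fix e :: real assume e: "e > 0"
  then obtain d where d: "d > 0" "\<And>y. y \<in> unit_cube \<Longrightarrow> dist y x < d \<Longrightarrow> dist (f y) (f x) < e / 2"
    using f x unfolding continuous_on_iff by (meson half_gt_zero)
  have "(\<lambda>N. real CARD('d) * (1/2) ^ Suc N) \<longlonglongrightarrow> real CARD('d) * 0"
    by (intro tendsto_intros LIMSEQ_Suc LIMSEQ_realpow_zero) auto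
  then have "\<forall>\<^sub>F N in sequentially. real CARD('d) * (1/2) ^ Suc N < d" using d by (intro order_tendstoD) auto
  then obtain N0 where N0: "\<And>N. N \<ge> N0 \<Longrightarrow> real CARD('d) * (1/2) ^ Suc N < d" by (auto simp: eventually_sequentially)
  have "norm (tensor_interp UNIV (Suc N) (\<lambda>y. f (vec_lambda y)) (vec_nth x) - f x) \<le> e / 2" if "N \<ge> N0" for N
  proof (rule tensor_interp_near)
    fix y :: "'d \<Rightarrow> real"
    assume y: "\<And>j. 0 \<le> y j \<and> y j \<le> 1" "\<And>j. \<bar>y j - x $ j\<bar> \<le> 1 / 2 ^ Suc N"
    have "norm (vec_lambda y - x) \<le> (\<Sum>j\<in>UNIV. \<bar>(vec_lambda y - x) $ j\<bar>)" by (rule norm_le_l1_cart)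
    also have "\<dots> \<le> (\<Sum>j\<in>(UNIV::'d set). 1 / 2 ^ Suc N)" using y by (intro sum_mono) auto
    also have "\<dots> = real CARD('d) * (1/2) ^ Suc N" by (simp add: power_one_over)
    also have "\<dots> < d" using N0 that by auto
    finally have "dist (vec_lambda y) x < d" by (simp add: dist_norm)
    moreover have "vec_lambda y \<in> (unit_cube :: (real ^ 'd) set)" using y by (auto simp: mem_box_cart)
    ultimately show "norm (f (vec_lambda y) - f x) \<le> e / 2" using d(2) by (force simp: dist_norm)
  qed (use x in \<open>auto simp: mem_box_cart\<close>)
  then show "\<exists>no. \<forall>N\<ge>no. norm (tensor_interp UNIV (Suc N) (\<lambda>y. f (vec_lambda y)) (vec_nth x) - f x) < e"
    using e by (intro exI[of _ N0]) force
qed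

lemma faber_measurable [measurable]: "faber m k \<in> borel_measurable borel"
proof -
  have "hat \<in> borel_measurable borel" unfolding hat_def by measurable
  then have [measurable]: "faber1 a b \<in> borel_measurable borel" for a b unfolding faber1_def by measurable
  show ?thesis unfolding faber_def by measurable
qed

text \<open>The bound holds for every cubic interpolant with N >= n, with a constant free of N, and
  passes to f by Fatou's lemma. Coefficients inside the cross are set to 0, so the uniform bound A
  factors out and the weights of the remaining levels add up to the hyperbolic tail.\<close>

lemma faber_error:
  fixes f :: "real ^ 'd \<Rightarrow> complex"
  assumes p: "1 \<le> p" and pq: "p < q" and n: "n \<ge> 1" and f: "continuous_on unit_cube f" and A: "A \<ge> 0"
    and coeff: "\<And>m :: int ^ 'd. (\<And>i. m $ i \<ge> -1) \<Longrightarrow> (\<Sum>k\<in>pos_set_d m. norm (faber_coeff m k f) powr p) \<le> A powr p"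
  shows "(\<integral>\<^sup>+x. ennreal (norm (f x - faber_trunc n f x) powr q) \<partial>lebesgue_on unit_cube) \<le>
    ennreal ((32 * (2 powr q * emb_const ((p + q) / 2) q)) ^ CARD('d) * (real n ^ (CARD('d) - 1) * (1/2) ^ n) * A powr q)"
proof -
  define s where "s = (p + q) / 2"
  have s: "1 < s" "s < q" "p < s" using p pq by (auto simp: s_def)
  define K where "K = 2 powr q * emb_const s q"
  have K: "K > 0" using emb_const_pos[OF s(1,2)] by (simp add: K_def)
  define B where "B = (32 * K) ^ CARD('d) * (real n ^ (CARD('d) - 1) * (1/2) ^ n) * A powr q"
  define tail where "tail m \<longleftrightarrow> n < (\<Sum>i\<in>UNIV. nat \<bar>m i\<bar>)" for m :: "'d \<Rightarrow> int"
  define c where "c m k = (if tail m then norm (faber_coeff (vec_lambda m) (vec_lambda k) f) else 0)" for m k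
  define P where "P N x = tensor_interp UNIV (Suc N) (\<lambda>y. f (vec_lambda y)) (vec_nth x)" for N x
  have bound: "(\<integral>\<^sup>+x. ennreal (norm (P N x - faber_trunc n f x) powr q) \<partial>lebesgue_on unit_cube) \<le> ennreal B" if N: "N \<ge> n" for N
  proof -
    define V where "V z = (\<Sum>m\<in>PiE UNIV (\<lambda>_. {-1..int N}). \<Sum>k\<in>PiE UNIV (\<lambda>i. pos_set (m i)).
       c m k * (\<Prod>i\<in>UNIV. dyadic_inc N (m i) (k i) (z i)))" for z
    have cs: "(\<Sum>k\<in>PiE UNIV (\<lambda>i. pos_set (m i)). c m k powr s) powr (q / s) \<le> (if tail m then A powr q else 0)"
      if m: "m \<in> PiE UNIV (\<lambda>_. {-1..int N})" for m
    proof (cases "tail m")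
      case True
      have "(\<Sum>k\<in>PiE UNIV (\<lambda>i. pos_set (m i)). c m k powr p) = (\<Sum>k\<in>pos_set_d (vec_lambda m). norm (faber_coeff (vec_lambda m) k f) powr p)"
        using True by (simp add: c_def pos_set_d_def sum_vec_reindex)
      also have "\<dots> \<le> A powr p" using m by (intro coeff) (auto simp: PiE_def Pi_def)
      finally have "(\<Sum>k\<in>PiE UNIV (\<lambda>i. pos_set (m i)). c m k powr p) powr (s / p) \<le> (A powr p) powr (s / p)"
        using s p by (intro powr_mono2) (auto intro!: sum_nonneg)
      moreover have "(\<Sum>k\<in>PiE UNIV (\<lambda>i. pos_set (m i)). c m k powr s) \<le> (\<Sum>k\<in>PiE UNIV (\<lambda>i. pos_set (m i)). c m k powr p) powr (s / p)"
        using s p by (intro sum_powr_le_powr_sum) (auto simp: c_def)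
      ultimately have "(\<Sum>k\<in>PiE UNIV (\<lambda>i. pos_set (m i)). c m k powr s) \<le> A powr s" using p by (simp add: powr_powr)
      then have "(\<Sum>k\<in>PiE UNIV (\<lambda>i. pos_set (m i)). c m k powr s) powr (q / s) \<le> (A powr s) powr (q / s)"
        using s by (intro powr_mono2) (auto intro!: sum_nonneg)
      then show ?thesis using s True by (simp add: powr_powr)
    qed (simp add: c_def)
    have "(\<integral>\<^sup>+x. ennreal (norm (P N x - faber_trunc n f x) powr q) \<partial>lebesgue_on unit_cube) \<le>
       ennreal (\<Sum>z\<in>PiE UNIV (\<lambda>_. {0..<2 ^ N}). ((1/2) ^ N) ^ CARD('d) * V z powr q)"
    proof (rule nn_integral_step_bound)
      fix x :: "real ^ 'd" and z :: "'d \<Rightarrow> int"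
      assume "x \<in> unit_cube" "z \<in> PiE UNIV (\<lambda>_. {0..<2 ^ N})" "\<And>i. of_int (z i) \<le> 2 ^ N * x $ i" "\<And>i. 2 ^ N * x $ i \<le> of_int (z i + 1)"
      from interp_minus_trunc_bound[where f = f, OF N this]
      have "norm (P N x - faber_trunc n f x) \<le> V z" by (simp add: P_def V_def c_def tail_def)
      then show "ennreal (norm (P N x - faber_trunc n f x) powr q) \<le> ennreal (V z powr q)"
        using s p by (intro ennreal_leI powr_mono2) auto
    qed auto
    also have "(\<Sum>z\<in>PiE UNIV (\<lambda>_. {0..<2 ^ N}). ((1/2) ^ N) ^ CARD('d) * V z powr q) \<le>
       K ^ CARD('d) * (\<Sum>m\<in>PiE UNIV (\<lambda>_. {-1..int N}). 2 powr (- real_of_int (\<Sum>i\<in>UNIV. m i)) *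
         (\<Sum>k\<in>PiE UNIV (\<lambda>i. pos_set (m i)). c m k powr s) powr (q / s))"
      unfolding V_def K_def by (rule dyadic_embedding[OF s(1,2)]) (auto simp: c_def)
    also have "\<dots> \<le> K ^ CARD('d) * (\<Sum>m\<in>PiE UNIV (\<lambda>_. {-1..int N}). 2 powr (- real_of_int (\<Sum>i\<in>UNIV. m i)) *
         (if tail m then A powr q else 0))"
      using K cs by (intro mult_left_mono sum_mono) auto
    also have "\<dots> = K ^ CARD('d) * A powr q * (\<Sum>m\<in>PiE (UNIV::'d set) (\<lambda>_. {-1..int N}). if tail m then 2 powr (- real_of_int (\<Sum>i\<in>UNIV. m i)) else 0)"
      unfolding sum_distrib_left by (intro sum.cong) auto
    also have "\<dots> \<le> K ^ CARD('d) * A powr q * (32 ^ CARD('d) * real n ^ (CARD('d) - 1) * (1/2) ^ n)"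
      unfolding tail_def using K n by (intro mult_left_mono hyperbolic_tail_powr) auto
    also have "\<dots> = B" by (simp add: B_def power_mult_distrib mult_ac)
    finally show ?thesis by (simp add: ennreal_leI)
  qed
  have meas: "(\<lambda>x. ennreal (norm (P N x - faber_trunc n f x) powr q)) \<in> borel_measurable (lebesgue_on unit_cube)" for N
  proof -
    have "(\<lambda>x. ennreal (norm (P N x - faber_trunc n f x) powr q)) \<in> borel_measurable borel"
      unfolding P_def tensor_interp_vec faber_trunc_def by measurable
    then have "(\<lambda>x. ennreal (norm (P N x - faber_trunc n f x) powr q)) \<in> borel_measurable lebesgue"
      by (intro measurable_completion) simp
    then show ?thesis by (rule measurable_restrict_space1)
  qed
  have "(\<integral>\<^sup>+x. ennreal (norm (f x - faber_trunc n f x) powr q) \<partial>lebesgue_on unit_cube) =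
     (\<integral>\<^sup>+x. liminf (\<lambda>N. ennreal (norm (P N x - faber_trunc n f x) powr q)) \<partial>lebesgue_on unit_cube)"
  proof (intro nn_integral_cong)
    fix x :: "real ^ 'd" assume "x \<in> space (lebesgue_on unit_cube)"
    then have x: "x \<in> unit_cube" by simp
    have "(\<lambda>N. ennreal (norm (P N x - faber_trunc n f x) powr q)) \<longlonglongrightarrow> ennreal (norm (f x - faber_trunc n f x) powr q)"
      unfolding P_def using s p by (intro tendsto_ennrealI tendsto_powr2 tendsto_intros tensor_interp_tendsto[OF f x]) auto
    then show "ennreal (norm (f x - faber_trunc n f x) powr q) = liminf (\<lambda>N. ennreal (norm (P N x - faber_trunc n f x) powr q))"
      by (rule lim_imp_Liminf[OF sequentially_bot, symmetric])
  qed
  also have "\<dots> \<le> liminf (\<lambda>N. \<integral>\<^sup>+x. ennreal (norm (P N x - faber_trunc n f x) powr q) \<partial>lebesgue_on unit_cube)"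
    by (intro nn_integral_liminf meas)
  also have "\<dots> \<le> liminf (\<lambda>N. ennreal B)"
    by (intro Liminf_mono) (use bound in \<open>auto simp: eventually_sequentially\<close>)
  also have "\<dots> = ennreal B" by (simp add: Liminf_const)
  finally show ?thesis by (simp add: B_def K_def s_def)
qed

section \<open>Fejer and de la Vallee Poussin kernels\<close>

text \<open>The Fejer kernel of the real line, normalised such that integrating it against exp (- i
  s y) gives exactly the triangle \<open>tri\<close>; \<open>sinc\<close> fills the removable
  singularity at 0.\<close>

definition fejer :: "real \<Rightarrow> real" where
  "fejer s = (sinc (s / 2))\<^sup>2 / (2 * pi)"

definition tri :: "real \<Rightarrow> real" where
  "tri y = max 0 (1 - \<bar>y\<bar>)"

lemma fejer_eq: "s \<noteq> 0 \<Longrightarrow> fejer s = (1 - cos s) / (pi * s\<^sup>2)"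
proof -
  assume "s \<noteq> 0"
  have "cos s = 1 - 2 * (sin (s / 2))\<^sup>2" using cos_double_sin[of "s / 2"] by simp
  then show ?thesis using \<open>s \<noteq> 0\<close> by (simp add: fejer_def power_divide field_simps)
qed

lemma fejer_0: "fejer 0 = 1 / (2 * pi)" by (simp add: fejer_def)

lemma fejer_nonneg: "fejer s \<ge> 0" by (simp add: fejer_def)

lemma fejer_even: "fejer (- s) = fejer s"
  by (simp add: fejer_def)

lemma fejer_measurable [measurable]: "fejer \<in> borel_measurable borel"
  unfolding fejer_def by measurable

lemma isCont_fejer: "isCont fejer x"
  unfolding fejer_def by (intro continuous_intros isCont_o2[where g = sinc, OF _ isCont_sinc]) auto

lemma continuous_on_fejer: "continuous_on A fejer"
  by (simp add: continuous_at_imp_continuous_on isCont_fejer)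

lemma tri_measurable [measurable]: "tri \<in> borel_measurable borel"
  unfolding tri_def by measurable

text \<open>Integration by parts gives the antiderivative \<open>F\<close>, whose limit pi / 2 at
  infinity is the Dirichlet integral. Nonnegativity yields integrability on the half line, evenness
  the other half, and a dilation the general a.\<close>

lemma integral_one_minus_cos:
  "has_bochner_integral lborel (\<lambda>y. (1 - cos (a * y)) / y\<^sup>2) (pi * \<bar>a\<bar>)"
proof -
  define f :: "real \<Rightarrow> real" where "f y = (1 - cos y) / y\<^sup>2" for y
  define F :: "real \<Rightarrow> real" where "F y = Si y - (1 - cos y) / y" for y
  have [measurable]: "f \<in> borel_measurable borel" unfolding f_def by measurable
  have f0: "f y \<ge> 0" for y by (simp add: f_def)
  have lim0: "(F \<longlongrightarrow> 0) (at_right 0)"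
  proof -
    have "(Si \<longlongrightarrow> Si 0) (at_right 0)" using isCont_Si[of 0] by (simp add: isCont_def filterlim_at_split)
    moreover have "Si 0 = 0" by (simp add: Si_def zero_ereal_def[symmetric])
    moreover have "((\<lambda>y::real. (1 - cos y) / y) \<longlongrightarrow> 0) (at_right 0)"
    proof -
      have "((\<lambda>y::real. (cos y - cos 0) / (y - 0)) \<longlongrightarrow> - sin 0) (at 0)"
        using DERIV_cos[of "0::real"] by (simp add: has_field_derivative_iff)
      then have "((\<lambda>y::real. (cos y - cos 0) / (y - 0)) \<longlongrightarrow> - sin 0) (at_right 0)"
        by (simp only: filterlim_at_split)
      from tendsto_minus[OF this]
      show ?thesis by (simp add: minus_divide_left)
    qed
    ultimately show ?thesis unfolding F_def by (auto intro: tendsto_eq_intros)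
  qed
  have lim1: "(F \<longlongrightarrow> pi / 2) at_top"
  proof -
    have "((\<lambda>y::real. (1 - cos y) / y) \<longlongrightarrow> 0) at_top"
    proof (rule Lim_null_comparison)
      show "\<forall>\<^sub>F y::real in at_top. norm ((1 - cos y) / y) \<le> 2 / y"
        using eventually_gt_at_top[of 0]
      proof eventually_elim
        case (elim y)
        have "\<bar>1 - cos y\<bar> \<le> 2" using cos_ge_minus_one[of y] cos_le_one[of y] by linarith
        then show ?case using elim by (simp add: divide_right_mono)
      qed
      show "((\<lambda>y::real. 2 / y) \<longlongrightarrow> 0) at_top"
        by (intro tendsto_divide_0[OF tendsto_const] filterlim_at_top_imp_at_infinity filterlim_ident)
    qed
    then show ?thesis unfolding F_def using Si_at_top by (auto intro: tendsto_eq_intros)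
  qed
  have half: "set_integrable lborel {0<..} f" "(LBINT y=0..\<infinity>. f y) = pi / 2 - 0"
  proof -
    have d: "DERIV F y :> f y" if "0 < ereal y" for y
    proof -
      have "y > 0" using that by simp
      then have "(F has_real_derivative sinc y - (sin y * y - (1 - cos y)) / (y * y)) (at y)"
        unfolding F_def by (auto intro!: derivative_eq_intros DERIV_Si)
      moreover have "sinc y - (sin y * y - (1 - cos y)) / (y * y) = f y"
        using \<open>y > 0\<close> by (simp add: f_def field_simps power2_eq_square)
      ultimately show ?thesis by simp
    qed
    have c: "isCont f y" if "0 < ereal y" for y
      using that unfolding f_def by (intro continuous_intros) auto
    have t0: "((F \<circ> real_of_ereal) \<longlongrightarrow> 0) (at_right 0)"
      using lim0 by (simp add: zero_ereal_def ereal_tendsto_simps)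
    have t1: "((F \<circ> real_of_ereal) \<longlongrightarrow> pi / 2) (at_left \<infinity>)"
      using lim1 by (simp add: ereal_tendsto_simps)
    have e: "einterval 0 \<infinity> = {0<..}" by (auto simp: einterval_def zero_ereal_def)
    show "set_integrable lborel {0<..} f" "(LBINT y=0..\<infinity>. f y) = pi / 2 - 0"
      using interval_integral_FTC_nonneg[where F = F and f = f and a = 0 and b = \<infinity>, OF _ d c _ t0 t1] f0 e by auto
  qed
  have hb: "has_bochner_integral lborel (\<lambda>y. indicator {0<..} y * f y) (pi / 2)"
  proof -
    have "integral\<^sup>L lborel (\<lambda>y. indicator {0<..} y * f y) = (LBINT y=0..\<infinity>. f y)"
      unfolding interval_lebesgue_integral_def set_lebesgue_integral_def
      by (auto simp: einterval_def zero_ereal_def greaterThan_def intro!: Bochner_Integration.integral_cong)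
    moreover have "integrable lborel (\<lambda>y. indicator {0<..} y * f y)"
      using half(1) by (simp add: set_integrable_def)
    ultimately show ?thesis using half(2) by (simp add: has_bochner_integral_iff)
  qed
  have "has_bochner_integral lborel (\<lambda>y. indicator {0<..} (0 + (-1) * y) * f (0 + (-1) * y)) ((pi / 2) /\<^sub>R \<bar>-1\<bar>)"
    using hb by (subst (asm) lborel_has_bochner_integral_real_affine_iff[of "-1" _ _ 0]) auto
  then have hb': "has_bochner_integral lborel (\<lambda>y. indicator {..<0} y * f y) (pi / 2)"
    by (rule has_bochner_integral_cong[THEN iffD1, rotated 3]) (auto simp: f_def indicator_def)
  have "has_bochner_integral lborel f (pi / 2 + pi / 2)"
    by (rule has_bochner_integral_cong[THEN iffD1, OF refl _ refl has_bochner_integral_add[OF hb hb']])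
      (auto simp: f_def indicator_def)
  then have F: "has_bochner_integral lborel f pi" by simp
  show ?thesis
  proof (cases "a = 0")
    case False
    have "has_bochner_integral lborel (\<lambda>y. f (0 + a * y)) (pi /\<^sub>R \<bar>a\<bar>)"
      using F False by (subst (asm) lborel_has_bochner_integral_real_affine_iff[of a _ _ 0]) auto
    then have "has_bochner_integral lborel (\<lambda>y. a\<^sup>2 * f (0 + a * y)) (a\<^sup>2 * (pi /\<^sub>R \<bar>a\<bar>))"
      by (intro has_bochner_integral_mult_right)
    moreover have "a\<^sup>2 * (pi /\<^sub>R \<bar>a\<bar>) = pi * \<bar>a\<bar>" using False by (simp add: field_simps power2_eq_square abs_mult_self_eq)
    moreover have "(\<lambda>y. a\<^sup>2 * f (0 + a * y)) = (\<lambda>y. (1 - cos (a * y)) / y\<^sup>2)"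
      using False by (auto simp: f_def fun_eq_iff power_mult_distrib)
    ultimately show ?thesis by (simp only:)
  qed (simp add: has_bochner_integral_iff)
qed

section \<open>The Fourier pair of Fejer kernel and triangle\<close>

lemma fejer_ae: "AE s in lborel. fejer s = (1 - cos (1 * s)) / s\<^sup>2 / pi"
proof -
  have "AE s in lborel. s \<noteq> (0::real)" by (rule AE_lborel_singleton)
  then show ?thesis by eventually_elim (simp add: fejer_eq)
qed

lemma fejer_integrable: "integrable lborel fejer"
proof -
  have "integrable lborel (\<lambda>s. (1 - cos (1 * s)) / s\<^sup>2 / pi)"
    using integral_one_minus_cos[of 1] by (intro integrable_divide) (simp add: has_bochner_integral_iff)
  moreover have "integrable lborel (\<lambda>s. (1 - cos (1 * s)) / s\<^sup>2 / pi) \<longleftrightarrow> integrable lborel fejer"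
    using fejer_ae by (intro integrable_cong_AE) auto
  ultimately show ?thesis by simp
qed

text \<open>The product (1 - cos s) cos (s y) is half the second difference, at a = y + 1, y, y - 1,
  of 1 - cos (a s). Divided by s^2 these functions integrate to pi |a|, and half the second
  difference of the absolute value is the triangle.\<close>

lemma fejer_cos_transform: "(\<integral>s. fejer s * cos (s * y) \<partial>lborel) = tri y"
proof -
  define J :: "real \<Rightarrow> real \<Rightarrow> real" where "J a s = (1 - cos (a * s)) / s\<^sup>2" for a s
  have J: "integrable lborel (J a)" "integral\<^sup>L lborel (J a) = pi * \<bar>a\<bar>" for a
  proof -
    have "J a = (\<lambda>s. (1 - cos (a * s)) / s\<^sup>2)" by (simp add: J_def fun_eq_iff)
    then show "integrable lborel (J a)" "integral\<^sup>L lborel (J a) = pi * \<bar>a\<bar>"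
      using integral_one_minus_cos[of a] by (auto simp: has_bochner_integral_iff)
  qed
  have "(\<integral>s. fejer s * cos (s * y) \<partial>lborel) = (\<integral>s. (J (1 + y) s + J (1 - y) s - 2 * J y s) / (2 * pi) \<partial>lborel)"
  proof (rule integral_cong_AE)
    show "AE s in lborel. fejer s * cos (s * y) = (J (1 + y) s + J (1 - y) s - 2 * J y s) / (2 * pi)"
      using fejer_ae
    proof eventually_elim
      case (elim s)
      have "cos ((1 + y) * s) + cos ((1 - y) * s) = 2 * cos s * cos (s * y)"
      proof -
        have "(1 + y) * s = s + s * y" "(1 - y) * s = s - s * y" by (simp_all add: algebra_simps)
        then show ?thesis by (simp add: cos_add cos_diff)
      qed
      then have c: "cos ((1 + y) * s) = 2 * cos s * cos (s * y) - cos ((1 - y) * s)" by simp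
      have "J (1 + y) s + J (1 - y) s - 2 * J y s = (2 * cos (s * y) - 2 * cos s * cos (s * y)) / s\<^sup>2"
        unfolding J_def c by (simp add: mult.commute flip: add_divide_distrib diff_divide_distrib)
      then have "(J (1 + y) s + J (1 - y) s - 2 * J y s) / (2 * pi) = (2 * cos (s * y) - 2 * cos s * cos (s * y)) / s\<^sup>2 / (2 * pi)"
        by (simp only:)
      then show ?case unfolding elim by (cases "s = 0") (simp_all add: field_simps)
    qed
  qed (auto simp: J_def)
  also have "\<dots> = (pi * \<bar>1 + y\<bar> + pi * \<bar>1 - y\<bar> - 2 * (pi * \<bar>y\<bar>)) / (2 * pi)"
    by (simp add: J)
  also have "\<dots> = (\<bar>1 + y\<bar> + \<bar>1 - y\<bar> - 2 * \<bar>y\<bar>) / 2"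
    by (simp add: field_simps)
  also have "\<dots> = tri y" by (auto simp: tri_def max_def abs_if field_simps)
  finally show ?thesis .
qed

lemma fejer_transform:
  "(\<integral>s. of_real (fejer s) * exp (- \<i> * of_real (s * y)) \<partial>lborel) = of_real (tri y)" (is "?I = _")
proof -
  have ic: "integrable lborel (\<lambda>s. fejer s * cos (s * y))"
    by (rule Bochner_Integration.integrable_bound[OF fejer_integrable]) (auto simp: abs_mult fejer_nonneg mult_left_le)
  have isn: "integrable lborel (\<lambda>s. fejer s * sin (s * y))"
    by (rule Bochner_Integration.integrable_bound[OF fejer_integrable]) (auto simp: abs_mult fejer_nonneg mult_left_le)
  have "(\<integral>s. fejer s * sin (s * y) \<partial>lborel) = \<bar>-1\<bar> *\<^sub>R (\<integral>s. fejer (0 + (-1) * s) * sin ((0 + (-1) * s) * y) \<partial>lborel)"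
    by (rule lborel_integral_real_affine) simp
  also have "\<dots> = - (\<integral>s. fejer s * sin (s * y) \<partial>lborel)" by (simp add: fejer_even)
  finally have z: "(\<integral>s. fejer s * sin (s * y) \<partial>lborel) = 0" by simp
  have "(\<lambda>s. of_real (fejer s) * exp (- \<i> * of_real (s * y))) = (\<lambda>s. complex_of_real (fejer s * cos (s * y)) - \<i> * of_real (fejer s * sin (s * y)))"
  proof
    fix s
    have "exp (- \<i> * complex_of_real (s * y)) = of_real (cos (s * y)) - \<i> * of_real (sin (s * y))"
      using cis_conv_exp[of "- (s * y)"] by (simp add: complex_eq_iff)
    then show "of_real (fejer s) * exp (- \<i> * of_real (s * y)) = complex_of_real (fejer s * cos (s * y)) - \<i> * of_real (fejer s * sin (s * y))"
      by (simp only:) (simp add: algebra_simps)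
  qed
  then have "?I = (\<integral>s. complex_of_real (fejer s * cos (s * y)) - \<i> * of_real (fejer s * sin (s * y)) \<partial>lborel)"
    by (simp only:)
  also have "\<dots> = complex_of_real (\<integral>s. fejer s * cos (s * y) \<partial>lborel) - \<i> * of_real (\<integral>s. fejer s * sin (s * y) \<partial>lborel)"
    using ic isn by (subst Bochner_Integration.integral_diff) (simp_all del: of_real_mult)
  finally show ?thesis by (simp add: z fejer_cos_transform)
qed

text \<open>Integration by parts, with c = 1 and c = -1 for the two slopes of the triangle. In
  \<open>tri_transform\<close> the terms in 1 / x cancel and those with c / x^2 survive.\<close>

lemma exp_i_integral:
  assumes x: "x \<noteq> 0" and c: "c = 1 \<or> c = -1" and ab: "a \<le> b"
  shows "has_bochner_integral lborel (\<lambda>y. indicator {a..b} y *\<^sub>R (of_real (1 + c * y) * exp (\<i> * of_real (y * x))))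
    ((of_real (1 + c * b) / (\<i> * x) + c / x\<^sup>2) * exp (\<i> * of_real (b * x)) - (of_real (1 + c * a) / (\<i> * x) + c / x\<^sup>2) * exp (\<i> * of_real (a * x)))"
proof -
  define F where "F y = (of_real (1 + c * y) / (\<i> * x) + c / x\<^sup>2) * exp (\<i> * of_real (y * x))" for y :: real
  have "has_bochner_integral lborel (\<lambda>y. indicator {a..b} y *\<^sub>R (of_real (1 + c * y) * exp (\<i> * of_real (y * x)))) (F b - F a)"
  proof (rule has_bochner_integral_FTC_Icc[OF ab])
    fix y :: real
    have g: "((\<lambda>y. (1 + of_real c * y) / (\<i> * of_real x) + of_real c / (of_real x)\<^sup>2) has_field_derivative of_real c / (\<i> * of_real x)) (at (of_real y))"
      using x by (auto intro!: derivative_eq_intros)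
    have "((\<lambda>y. ((1 + of_real c * y) / (\<i> * of_real x) + of_real c / (of_real x)\<^sup>2) * exp (\<i> * (y * of_real x))) has_field_derivative
        (of_real (1 + c * y) * exp (\<i> * of_real (y * x)))) (at (of_real y))"
      using x by (auto intro!: derivative_eq_intros g simp: field_simps power2_eq_square)
    from has_vector_derivative_real_field[OF this]
    show "(F has_vector_derivative of_real (1 + c * y) * exp (\<i> * of_real (y * x))) (at y within {a..b})"
      unfolding F_def of_real_add of_real_mult of_real_1 of_real_divide of_real_power .
  qed (intro continuous_intros)
  then show ?thesis by (simp add: F_def)
qed

lemma tri_integrable: "integrable lborel tri"
proof -
  have "integrable lborel (\<lambda>y. indicator {-1..1::real} y *\<^sub>R (1 - \<bar>y\<bar>))"
    by (intro borel_integrable_compact continuous_intros) auto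
  moreover have "(\<lambda>y. indicator {-1..1::real} y *\<^sub>R (1 - \<bar>y\<bar>)) = tri" by (auto simp: tri_def indicator_def fun_eq_iff)
  ultimately show ?thesis by simp
qed

text \<open>Together with \<open>fejer_transform\<close> this is Fourier inversion for one explicit
  pair, and no further case of inversion enters later.\<close>

lemma tri_transform:
  "(\<integral>y. of_real (tri y) * exp (\<i> * of_real (y * x)) \<partial>lborel) = of_real (2 * pi * fejer x)"
proof -
  define E where "E y = exp (\<i> * of_real (y * x))" for y :: real
  \<comment> \<open>The two closed halves overlap at y = 0, so G agrees with the integrand only away
    from this point.\<close>
  define G where "G y = indicator {-1..0} y *\<^sub>R (of_real (1 + 1 * y) * E y) + indicator {0..1} y *\<^sub>R (of_real (1 + (-1) * y) * E y)" for y :: real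
  have eqG: "of_real (tri y) * E y = G y" if "y \<noteq> 0" for y
    using that by (auto simp: G_def tri_def indicator_def)
  have ae: "AE y in lborel. of_real (tri y) * E y = G y"
    using AE_lborel_singleton[of "0::real"] by eventually_elim (rule eqG)
  have [measurable]: "E \<in> borel_measurable borel" unfolding E_def by (intro borel_measurable_continuous_onI continuous_intros)
  have "(\<integral>y. of_real (tri y) * E y \<partial>lborel) = integral\<^sup>L lborel G"
    by (rule integral_cong_AE[OF _ _ ae]) (auto simp: G_def)
  also have "\<dots> = of_real (2 * pi * fejer x)"
  proof (cases "x = 0")
    case True
    have "G = (\<lambda>y. of_real (indicator {-1..0} y *\<^sub>R (1 + y) + indicator {0..1} y *\<^sub>R (1 - y)))"
      by (auto simp: G_def E_def True fun_eq_iff indicator_def)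
    then have "integral\<^sup>L lborel G = of_real (\<integral>y. indicator {-1..0} y *\<^sub>R (1 + y) + indicator {0..1} y *\<^sub>R (1 - y) \<partial>lborel)"
      by (simp only: integral_complex_of_real)
    moreover have "has_bochner_integral lborel (\<lambda>y::real. indicator {-1..0} y *\<^sub>R (1 + y)) ((0 + 0\<^sup>2/2) - ((-1) + (-1)\<^sup>2/2))"
      by (rule has_bochner_integral_FTC_Icc) (auto intro!: derivative_eq_intros continuous_intros simp flip: has_real_derivative_iff_has_vector_derivative)
    then have "has_bochner_integral lborel (\<lambda>y::real. indicator {-1..0} y *\<^sub>R (1 + y) + indicator {0..1} y *\<^sub>R (1 - y)) (((0 + 0\<^sup>2/2) - ((-1) + (-1)\<^sup>2/2)) + ((1 - 1\<^sup>2/2) - (0 - 0\<^sup>2/2)))"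
      by (rule has_bochner_integral_add)
        (rule has_bochner_integral_FTC_Icc, auto intro!: derivative_eq_intros continuous_intros simp flip: has_real_derivative_iff_has_vector_derivative)
    then have "(\<integral>y. indicator {-1..0} y *\<^sub>R (1 + y) + indicator {0..1::real} y *\<^sub>R (1 - y) \<partial>lborel) = 1"
      using has_bochner_integral_integral_eq by fastforce
    ultimately show ?thesis using True by (simp add: fejer_0)
  next
    case False
    have Geq: "G = (\<lambda>y. indicator {-1..0} y *\<^sub>R (of_real (1 + 1 * y) * exp (\<i> * of_real (y * x))) +
        indicator {0..1} y *\<^sub>R (of_real (1 + (-1) * y) * exp (\<i> * of_real (y * x))))"
      by (simp add: G_def E_def fun_eq_iff)
    have "has_bochner_integral lborel G
       (((of_real (1 + 1 * 0) / (\<i> * x) + of_real (1 / x\<^sup>2)) * exp (\<i> * of_real (0 * x)) - (of_real (1 + 1 * (-1)) / (\<i> * x) + of_real (1 / x\<^sup>2)) * exp (\<i> * of_real (-1 * x)))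
       + ((of_real (1 + (-1) * 1) / (\<i> * x) + of_real ((-1) / x\<^sup>2)) * exp (\<i> * of_real (1 * x)) - (of_real (1 + (-1) * 0) / (\<i> * x) + of_real ((-1) / x\<^sup>2)) * exp (\<i> * of_real (0 * x))))"
      unfolding Geq by (intro has_bochner_integral_add exp_i_integral[OF False]) simp_all
    then have "integral\<^sup>L lborel G = (2 - (E 1 + E (-1))) / x\<^sup>2"
      by (simp add: has_bochner_integral_iff E_def add_divide_distrib diff_divide_distrib)
    moreover have "E 1 + E (-1) = of_real (2 * cos x)"
      using cis_conv_exp[of x] cis_conv_exp[of "-x"] by (simp add: E_def complex_eq_iff)
    moreover have "2 * pi * fejer x = (2 - 2 * cos x) / x\<^sup>2" using False by (simp add: fejer_eq field_simps)
    ultimately show ?thesis by simp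
  qed
  finally show ?thesis by (simp add: E_def)
qed

section \<open>Bounded variation of the Fejer kernel\<close>

lemma fejer_bound: "fejer s \<le> 1"
proof -
  have "\<bar>sinc (s / 2)\<bar> \<le> 1"
    using abs_sin_x_le_abs_x[of "s / 2"] by (auto simp: divide_le_eq_1)
  then have "(sinc (s / 2))\<^sup>2 \<le> 1" by (rule abs_square_le_1[THEN iffD2])
  then show ?thesis using pi_ge_two by (simp add: fejer_def divide_le_eq)
qed

lemma fejer_has_derivative:
  assumes "s \<noteq> 0"
  shows "(fejer has_real_derivative (s * sin s - 2 * (1 - cos s)) / (pi * s ^ 3)) (at s)"
proof -
  have "((\<lambda>s. (1 - cos s) / (pi * s\<^sup>2)) has_real_derivative (s * sin s - 2 * (1 - cos s)) / (pi * s ^ 3)) (at s)"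
    using assms by (auto intro!: derivative_eq_intros simp: field_simps power2_eq_square power3_eq_cube)
  then show ?thesis
    by (rule DERIV_cong_ev[THEN iffD1, OF refl _ refl, rotated])
      (rule eventually_mono[OF t1_space_nhds[OF assms]], simp add: fejer_eq)
qed

lemma abs_le_by_derivative:
  fixes g g' :: "real \<Rightarrow> real"
  assumes "s \<ge> 0" "\<And>t. 0 \<le> t \<Longrightarrow> t \<le> s \<Longrightarrow> (g has_real_derivative g' t) (at t)" "\<And>t. 0 \<le> t \<Longrightarrow> t \<le> s \<Longrightarrow> \<bar>g' t\<bar> \<le> B"
    "g 0 = 0"
  shows "\<bar>g s\<bar> \<le> B * s"
proof (cases "s = 0")
  case False
  then obtain z where "0 < z" "z < s" "g s - g 0 = (s - 0) * g' z"
    using MVT2[of 0 s g g'] assms by auto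
  then show ?thesis using assms(1,3,4) by (simp add: abs_mult mult.commute mult_right_mono)
qed (use assms in auto)

text \<open>The numerator N is O(s^3) at 0, by integrating -s sin s and then s cos s - sin s, and
  O(s) at infinity. The majorant is the derivative of arctan, chosen for its bounded primitive. The
  constant 10 = 2 * 5 comes from s > 1, where |N| <= 5 s and 1 + s^2 <= 2 s^2.\<close>

lemma fejer_derivative_bound:
  assumes s: "s > 0"
  shows "\<bar>(s * sin s - 2 * (1 - cos s)) / (pi * s ^ 3)\<bar> \<le> 10 / pi * (1 / (1 + s\<^sup>2))"
proof -
  define N where "N = s * sin s - 2 * (1 - cos s)"
  have b1: "\<bar>N\<bar> \<le> s ^ 3"
  proof -
    have d: "\<bar>t * cos t - sin t\<bar> \<le> s * t" if "0 \<le> t" "t \<le> s" for t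
    proof (rule abs_le_by_derivative[where g' = "\<lambda>t. - t * sin t"])
      show "\<bar>- u * sin u\<bar> \<le> s" if "0 \<le> u" "u \<le> t" for u
      proof -
        have "\<bar>u\<bar> * \<bar>sin u\<bar> \<le> \<bar>u\<bar> * 1" by (intro mult_left_mono) auto
        then show ?thesis using that \<open>t \<le> s\<close> by (simp add: abs_mult)
      qed
    qed (use that in \<open>auto intro!: derivative_eq_intros\<close>)
    have "\<bar>N\<bar> \<le> (s * s) * s" unfolding N_def
    proof (rule abs_le_by_derivative[where g' = "\<lambda>t. t * cos t - sin t"])
      show "\<bar>t * cos t - sin t\<bar> \<le> s * s" if "0 \<le> t" "t \<le> s" for t
        using d[OF that] that s by (meson mult_left_mono order_trans less_imp_le)
    qed (use s in \<open>auto intro!: derivative_eq_intros\<close>)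
    then show ?thesis by (simp add: power3_eq_cube)
  qed
  have "(1 + s\<^sup>2) * \<bar>N\<bar> \<le> 10 * s ^ 3"
  proof (cases "s \<le> 1")
    case True
    then have "1 + s\<^sup>2 \<le> 2" using s by (simp add: power_le_one)
    then have "(1 + s\<^sup>2) * \<bar>N\<bar> \<le> 2 * s ^ 3" using b1 s by (intro mult_mono) auto
    moreover have "0 < s ^ 3" using s by simp
    ultimately show ?thesis by linarith
  next
    case False
    have "\<bar>N\<bar> \<le> \<bar>s * sin s\<bar> + \<bar>2 * (1 - cos s)\<bar>" unfolding N_def by (rule abs_triangle_ineq4)
    moreover have "\<bar>s * sin s\<bar> \<le> s * 1" using s by (simp add: abs_mult)
    moreover have "2 * (1 - cos s) \<le> 4" "- (2 * (1 - cos s)) \<le> 4"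
      using cos_ge_minus_one[of s] cos_le_one[of s] by (smt (verit))+
    then have "\<bar>2 * (1 - cos s)\<bar> \<le> 4" by (simp only: abs_le_iff)
    ultimately have "\<bar>N\<bar> \<le> 5 * s" using False by linarith
    moreover have "1 + s\<^sup>2 \<le> 2 * s\<^sup>2" using False by (simp add: power2_eq_square mult_ge1_I)
    ultimately have "(1 + s\<^sup>2) * \<bar>N\<bar> \<le> (2 * s\<^sup>2) * (5 * s)" by (intro mult_mono) auto
    then show ?thesis by (simp add: power3_eq_cube power2_eq_square)
  qed
  then have "\<bar>N\<bar> / s ^ 3 \<le> 10 / (1 + s\<^sup>2)" using s by (simp add: field_simps add_pos_nonneg)
  then have "\<bar>N\<bar> / s ^ 3 / pi \<le> 10 / (1 + s\<^sup>2) / pi" by (intro divide_right_mono) auto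
  then show ?thesis using s by (simp add: N_def abs_divide abs_mult mult.commute)
qed

text \<open>By the derivative bound, adding or subtracting \<open>fejer\<close> leaves 10 / pi times
  arctan increasing. The derivative formula divides by 0 at the origin, so monotonicity is taken
  from the open interval and continuity.\<close>

lemma fejer_bv_pos:
  assumes a: "0 \<le> a" and ab: "a \<le> b"
  shows "\<bar>fejer b - fejer a\<bar> \<le> 10 / pi * (arctan b - arctan a)"
proof -
  have der: "((\<lambda>s. 10 / pi * arctan s + c * fejer s) has_real_derivative (10 / pi * (1 / (1 + s\<^sup>2)) + c * ((s * sin s - 2 * (1 - cos s)) / (pi * s ^ 3)))) (at s)" if "s > 0" for s c
    using that fejer_has_derivative[of s] by (auto intro!: derivative_eq_intros simp: divide_inverse)
  have cont: "continuous_on {a..b} (\<lambda>s. 10 / pi * arctan s + c * fejer s)" for c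
    by (intro continuous_intros continuous_on_fejer)
  have inc: "10 / pi * arctan a + c * fejer a \<le> 10 / pi * arctan b + c * fejer b" if c: "\<bar>c\<bar> = 1" for c
  proof (rule DERIV_nonneg_imp_increasing_open[OF ab _ cont])
    fix x assume x: "a < x" "x < b"
    then have "x > 0" using a by simp
    define D where "D = (x * sin x - 2 * (1 - cos x)) / (pi * x ^ 3)"
    have "\<bar>c * D\<bar> \<le> 10 / pi * (1 / (1 + x\<^sup>2))"
      using fejer_derivative_bound[OF \<open>x > 0\<close>] c by (simp only: abs_mult D_def mult_1)
    then have "0 \<le> 10 / pi * (1 / (1 + x\<^sup>2)) + c * D" by linarith
    then show "\<exists>y. ((\<lambda>s. 10 / pi * arctan s + c * fejer s) has_real_derivative y) (at x) \<and> 0 \<le> y"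
      using der[OF \<open>x > 0\<close>, of c] unfolding D_def by blast
  qed
  from inc[of 1] inc[of "-1"] show ?thesis by (simp add: algebra_simps diff_divide_distrib abs_le_iff)
qed

lemma fejer_bv:
  assumes "a \<le> b"
  shows "\<bar>fejer b - fejer a\<bar> \<le> 10 / pi * (arctan b - arctan a)"
proof -
  have neg: "\<bar>fejer b - fejer a\<bar> \<le> 10 / pi * (arctan b - arctan a)" if "a \<le> b" "b \<le> 0" for a b
  proof -
    have "\<bar>fejer (- a) - fejer (- b)\<bar> \<le> 10 / pi * (arctan (- a) - arctan (- b))"
      using that by (intro fejer_bv_pos) auto
    also have "arctan (- a) - arctan (- b) = arctan b - arctan a" by (simp add: arctan_minus)
    finally show ?thesis by (simp only: fejer_even abs_minus_commute)
  qed
  consider "0 \<le> a" | "b \<le> 0" | "a \<le> 0" "0 \<le> b" by linarith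
  then show ?thesis
  proof cases
    case 3
    have "\<bar>fejer b - fejer a\<bar> \<le> \<bar>fejer b - fejer 0\<bar> + \<bar>fejer 0 - fejer a\<bar>" by linarith
    also have "\<dots> \<le> 10 / pi * (arctan b - arctan 0) + 10 / pi * (arctan 0 - arctan a)"
      using fejer_bv_pos[of 0 b] neg[of a 0] 3 by simp
    finally show ?thesis by (simp add: algebra_simps diff_divide_distrib)
  qed (use assms neg fejer_bv_pos in auto)
qed

text \<open>The de la Vallee Poussin kernel: a difference of two dilated Fejer kernels, chosen such
  that its Fourier transform equals 1 on \<open>[- 2, 2]\<close>.\<close>

definition vp :: "real \<Rightarrow> real" where
  "vp y = 8 * fejer (4 * y) - 2 * fejer (2 * y)"

definition vp_mass :: real where
  "vp_mass = (\<integral>y. \<bar>vp y\<bar> \<partial>lborel)"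

text \<open>An increasing function dominating the variation of \<open>vp\<close>: the coefficients
  are 8 and 2 times the constant of \<open>fejer_bv\<close>. Since arctan varies by at most pi, its
  total increment is at most 80 + 20 = 100.\<close>

definition vp_var :: "real \<Rightarrow> real" where
  "vp_var y = 80 / pi * arctan (4 * y) + 20 / pi * arctan (2 * y)"

lemma vp_measurable [measurable]: "vp \<in> borel_measurable borel"
  unfolding vp_def by measurable

lemma vp_bound: "\<bar>vp y\<bar> \<le> 10"
  using fejer_bound[of "4 * y"] fejer_bound[of "2 * y"] fejer_nonneg[of "4 * y"] fejer_nonneg[of "2 * y"]
  by (simp add: vp_def)

lemma vp_bv:
  assumes "a \<le> b"
  shows "\<bar>vp b - vp a\<bar> \<le> vp_var b - vp_var a"
proof -
  have "\<bar>vp b - vp a\<bar> \<le> 8 * \<bar>fejer (4 * b) - fejer (4 * a)\<bar> + 2 * \<bar>fejer (2 * b) - fejer (2 * a)\<bar>"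
    unfolding vp_def by (simp add: abs_if)
  also have "\<dots> \<le> 8 * (10 / pi * (arctan (4 * b) - arctan (4 * a))) + 2 * (10 / pi * (arctan (2 * b) - arctan (2 * a)))"
    using assms by (intro add_mono mult_left_mono fejer_bv) auto
  finally show ?thesis by (simp add: vp_var_def algebra_simps)
qed

lemma vp_var_bound: "vp_var b - vp_var a \<le> 100"
proof -
  have "arctan (4 * b) - arctan (4 * a) \<le> pi" "arctan (2 * b) - arctan (2 * a) \<le> pi"
    using arctan_bounded[of "4 * b"] arctan_bounded[of "4 * a"] arctan_bounded[of "2 * b"] arctan_bounded[of "2 * a"] by linarith+
  then have "80 / pi * (arctan (4 * b) - arctan (4 * a)) + 20 / pi * (arctan (2 * b) - arctan (2 * a)) \<le> 80 / pi * pi + 20 / pi * pi"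
    by (intro add_mono mult_left_mono) auto
  then show ?thesis by (simp add: vp_var_def algebra_simps)
qed

lemma lborel_integral_dilate:
  fixes f :: "real \<Rightarrow> 'a::{banach, second_countable_topology}"
  assumes "a > 0"
  shows "integrable lborel (\<lambda>y. f (a * y)) \<longleftrightarrow> integrable lborel f"
    "(\<integral>y. f (a * y) \<partial>lborel) = (\<integral>y. f y \<partial>lborel) /\<^sub>R a"
  using lborel_integrable_real_affine_iff[of a f 0] lborel_integral_real_affine[of a f 0] assms by auto

lemma vp_integrable: "integrable lborel vp"
  unfolding vp_def using fejer_integrable
  by (intro Bochner_Integration.integrable_diff integrable_mult_right) (simp_all add: lborel_integral_dilate)

lemma fejer_dilate_transform:
  assumes a: "a > 0"
  shows "(\<integral>y. of_real (a * fejer (a * y)) * exp (- \<i> * of_real (y * t)) \<partial>lborel) = of_real (tri (t / a))"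
proof -
  have "(\<integral>y. of_real (a * fejer (a * y)) * exp (- \<i> * of_real (y * t)) \<partial>lborel) =
     (\<integral>y. of_real a * (of_real (fejer (a * y)) * exp (- \<i> * of_real (a * y * (t / a)))) \<partial>lborel)"
    using a by (intro Bochner_Integration.integral_cong) (auto simp: mult_ac)
  also have "\<dots> = of_real a * (\<integral>y. of_real (fejer (a * y)) * exp (- \<i> * of_real (a * y * (t / a))) \<partial>lborel)"
    by simp
  also have "\<dots> = of_real a * ((\<integral>y. of_real (fejer y) * exp (- \<i> * of_real (y * (t / a))) \<partial>lborel) /\<^sub>R a)"
    by (subst lborel_integral_dilate(2)[OF a, of "\<lambda>y. of_real (fejer y) * exp (- \<i> * of_real (y * (t / a)))"]) simp
  also have "\<dots> = of_real (tri (t / a))" unfolding fejer_transform using a by (simp add: scaleR_conv_of_real)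
  finally show ?thesis .
qed

lemma integrable_mult_bounded:
  fixes g h :: "'a::euclidean_space \<Rightarrow> complex"
  assumes "integrable lborel g" "h \<in> borel_measurable borel" "\<And>y. norm (h y) \<le> B"
  shows "integrable lborel (\<lambda>y. g y * h y)"
proof (rule Bochner_Integration.integrable_bound[where f = "\<lambda>y. B * norm (g y)"])
  show "(\<lambda>y. g y * h y) \<in> borel_measurable lborel" using assms by (intro borel_measurable_times) auto
  have "B \<ge> 0" using assms(3)[of undefined] by (meson norm_ge_zero order_trans)
  then show "AE y in lborel. norm (g y * h y) \<le> norm (B * norm (g y))"
    using assms(3) by (auto simp: norm_mult abs_mult mult.commute[of B] intro!: mult_left_mono)
qed (use assms in auto)

text \<open>On [-2, 2] both triangles are linear on either side of 0, and in 2 tri (t / 4) - tri (t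
  / 2) the slopes cancel.\<close>

lemma vp_transform:
  assumes t: "\<bar>t\<bar> \<le> 2"
  shows "(\<integral>y. of_real (vp y) * exp (- \<i> * of_real (y * t)) \<partial>lborel) = 1"
proof -
  have i: "integrable lborel (\<lambda>y. of_real (a * fejer (a * y)) * exp (- \<i> * of_real (y * t)))" if "a > 0" for a
    using that fejer_integrable
    by (intro integrable_mult_bounded[where B = 1] integrable_of_real integrable_mult_right)
      (auto simp: lborel_integral_dilate intro!: borel_measurable_continuous_onI continuous_intros)
  define A where "A y = of_real (4 * fejer (4 * y)) * exp (- \<i> * of_real (y * t))" for y
  define B where "B y = of_real (2 * fejer (2 * y)) * exp (- \<i> * of_real (y * t))" for y
  have AB: "integrable lborel A" "integrable lborel B" using i[of 4] i[of 2] unfolding A_def B_def by auto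
  have "(\<integral>y. of_real (vp y) * exp (- \<i> * of_real (y * t)) \<partial>lborel) = (\<integral>y. 2 * A y - B y \<partial>lborel)"
    by (intro Bochner_Integration.integral_cong) (auto simp: vp_def A_def B_def algebra_simps)
  also have "\<dots> = 2 * integral\<^sup>L lborel A - integral\<^sup>L lborel B" using AB by simp
  also have "\<dots> = of_real (2 * tri (t / 4) - tri (t / 2))"
    unfolding A_def B_def by (subst (1 2) fejer_dilate_transform) auto
  also have "2 * tri (t / 4) - tri (t / 2) = 1" using t by (auto simp: tri_def)
  finally show ?thesis by simp
qed

section \<open>Dilated kernels and their Faber coefficients\<close>

definition vp_scaled :: "real \<Rightarrow> real \<Rightarrow> real" where
  "vp_scaled a y = a * vp (a * y)"

lemma vp_scaled_measurable [measurable]: "vp_scaled a \<in> borel_measurable borel"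
  unfolding vp_scaled_def by measurable

lemma vp_scaled_integrable: "a > 0 \<Longrightarrow> integrable lborel (vp_scaled a)"
  unfolding vp_scaled_def by (intro integrable_mult_right) (simp add: lborel_integral_dilate vp_integrable)

text \<open>The dilation preserves the L_1 norm, so the mass does not depend on the band width a;
  only supremum and variation grow linearly in a.\<close>

lemma vp_scaled_mass:
  assumes "a > 0" shows "(\<integral>y. \<bar>vp_scaled a (t - y)\<bar> \<partial>lborel) = vp_mass"
    and "integrable lborel (\<lambda>y. vp_scaled a (t - y))"
proof -
  show "integrable lborel (\<lambda>y. vp_scaled a (t - y))"
    using lborel_integrable_real_affine[OF vp_scaled_integrable[OF assms], of "-1" t] by simp
  have "(\<integral>y. \<bar>vp_scaled a (t - y)\<bar> \<partial>lborel) = (\<integral>y. \<bar>vp_scaled a y\<bar> \<partial>lborel)"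
    using lborel_integral_real_affine[of "-1" "\<lambda>y. \<bar>vp_scaled a y\<bar>" t] by simp
  also have "\<dots> = a * (\<integral>y. \<bar>vp (a * y)\<bar> \<partial>lborel)" using assms by (simp add: vp_scaled_def abs_mult)
  also have "\<dots> = vp_mass" using assms lborel_integral_dilate(2)[OF assms, of "\<lambda>y. \<bar>vp y\<bar>"] by (simp add: vp_mass_def)
  finally show "(\<integral>y. \<bar>vp_scaled a (t - y)\<bar> \<partial>lborel) = vp_mass" .
qed

lemma vp_scaled_transform:
  assumes a: "a > 0" and t: "\<bar>t\<bar> \<le> 2 * a"
  shows "(\<integral>y. of_real (vp_scaled a y) * exp (- \<i> * of_real (y * t)) \<partial>lborel) = 1"
proof -
  have "(\<integral>y. of_real (vp_scaled a y) * exp (- \<i> * of_real (y * t)) \<partial>lborel) =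
     (\<integral>y. of_real a * (of_real (vp (a * y)) * exp (- \<i> * of_real (a * y * (t / a)))) \<partial>lborel)"
    using a by (intro Bochner_Integration.integral_cong) (auto simp: vp_scaled_def mult_ac)
  also have "\<dots> = of_real a * ((\<integral>y. of_real (vp y) * exp (- \<i> * of_real (y * (t / a))) \<partial>lborel) /\<^sub>R a)"
    by (subst lborel_integral_dilate(2)[OF a, of "\<lambda>y. of_real (vp y) * exp (- \<i> * of_real (y * (t / a)))", symmetric]) simp
  also have "\<dots> = 1" using a t by (subst vp_transform) (auto simp: scaleR_conv_of_real field_simps)
  finally show ?thesis .
qed

lemma vp_mass_nonneg: "vp_mass \<ge> 0"
  by (simp add: vp_mass_def)

text \<open>The coefficient functional applied to the translated kernel t -> vp_scaled a (t - y), as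
  a function of y. By reproduction it is the density whose integral against a band-limited function
  is the coefficient of that function.\<close>

definition vp_coeff :: "real \<Rightarrow> int \<Rightarrow> int \<Rightarrow> real \<Rightarrow> real" where
  "vp_coeff a m k y = (\<Sum>s<3. wgt m s * vp_scaled a (node m k s - y))"

lemma vp_coeff_measurable [measurable]: "vp_coeff a m k \<in> borel_measurable borel"
  unfolding vp_coeff_def by measurable

lemma vp_coeff_mass:
  assumes a: "a > 0"
  shows "integrable lborel (vp_coeff a m k)" "(\<integral>y. \<bar>vp_coeff a m k y\<bar> \<partial>lborel) \<le> 2 * vp_mass"
proof -
  show i: "integrable lborel (vp_coeff a m k)" unfolding vp_coeff_def
    using vp_scaled_mass(2)[OF a] by (intro Bochner_Integration.integrable_sum integrable_mult_right) auto
  have "(\<integral>y. \<bar>vp_coeff a m k y\<bar> \<partial>lborel) \<le> (\<integral>y. (\<Sum>s<3. \<bar>wgt m s\<bar> * \<bar>vp_scaled a (node m k s - y)\<bar>) \<partial>lborel)"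
  proof (intro integral_mono)
    show "integrable lborel (\<lambda>y. \<Sum>s<3. \<bar>wgt m s\<bar> * \<bar>vp_scaled a (node m k s - y)\<bar>)"
      using vp_scaled_mass(2)[OF a] by (intro Bochner_Integration.integrable_sum integrable_mult_right integrable_abs) auto
    show "\<bar>vp_coeff a m k y\<bar> \<le> (\<Sum>s<3. \<bar>wgt m s\<bar> * \<bar>vp_scaled a (node m k s - y)\<bar>)" for y
      unfolding vp_coeff_def abs_mult[symmetric] by (rule sum_abs)
  qed (use i in auto)
  also have "\<dots> = (\<Sum>s<3. \<bar>wgt m s\<bar> * vp_mass)"
    using vp_scaled_mass[OF a] by (subst Bochner_Integration.integral_sum) auto
  also have "\<dots> = (\<Sum>s<3. \<bar>wgt m s\<bar>) * vp_mass" by (simp add: sum_distrib_right)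
  \<comment> \<open>The absolute weights are 1/2, 1, 1/2, and at level -1 a single 1.\<close>
  also have "(\<Sum>s<3. \<bar>wgt m s\<bar>) \<le> 2" by (simp add: sum_lessThan_3 wgt_def)
  finally show "(\<integral>y. \<bar>vp_coeff a m k y\<bar> \<partial>lborel) \<le> 2 * vp_mass"
    using vp_mass_nonneg by (simp add: mult_right_mono)
qed

lemma sum_int_telescope: "(\<Sum>k\<in>{0..int n - 1}. g (k + 1) - g k) = g (int n) - (g 0 :: real)"
proof (induction n)
  case (Suc n)
  have "{0..int (Suc n) - 1} = insert (int n) {0..int n - 1}" by auto
  then show ?case using Suc by (simp add: add.commute)
qed simp

text \<open>The coefficients of level \<open>m\<close> use second differences over adjacent intervals, so their
  sum is controlled by the total variation of the kernel, uniformly in \<open>m\<close>.\<close>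

lemma vp_coeff_sum:
  assumes a: "a > 0" and m: "m \<ge> -1"
  shows "(\<Sum>k\<in>pos_set m. \<bar>vp_coeff a m k y\<bar>) \<le> 100 * a"
proof (cases "m = -1")
  case True
  \<comment> \<open>At level -1 the two coefficients are the end values, bounded by the supremum 10
    a each.\<close>
  have "\<bar>vp_scaled a t\<bar> \<le> 10 * a" for t using a vp_bound[of "a * t"] by (simp add: vp_scaled_def abs_mult)
  from this[of "-y"] this[of "1 - y"] show ?thesis using True a
    by (simp add: pos_set_def vp_coeff_def sum_lessThan_3 wgt_def node_def)
next
  case False
  \<comment> \<open>\<open>g\<close> samples a primitive of the variation at the interval ends, so
    the bounds of adjacent intervals telescope; the factor 1/2 comes from the weights of the second
    difference.\<close>
  define g where "g k = a / 2 * vp_var (a * (of_int k / 2 ^ nat m - y))" for k :: int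
  have "\<bar>vp_coeff a m k y\<bar> \<le> g (k + 1) - g k" for k
  proof -
    define n where "n s = a * (node m k s - y)" for s
    have nn: "n 0 \<le> n 1" "n 1 \<le> n 2" using a False by (auto simp: n_def node_def divide_right_mono)
    have eq: "vp_coeff a m k y = a / 2 * ((vp (n 1) - vp (n 0)) - (vp (n 2) - vp (n 1)))"
      using False by (simp add: vp_coeff_def sum_lessThan_3 wgt_def vp_scaled_def n_def algebra_simps)
    have "\<bar>vp_coeff a m k y\<bar> = a / 2 * \<bar>(vp (n 1) - vp (n 0)) - (vp (n 2) - vp (n 1))\<bar>"
      unfolding eq abs_mult using a by simp
    also have "\<dots> \<le> a / 2 * ((vp_var (n 1) - vp_var (n 0)) + (vp_var (n 2) - vp_var (n 1)))"
      using a vp_bv[OF nn(1)] vp_bv[OF nn(2)] by (intro mult_left_mono) auto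
    also have "\<dots> = g (k + 1) - g k" using False by (simp add: g_def n_def node_def algebra_simps)
    finally show ?thesis .
  qed
  then have "(\<Sum>k\<in>pos_set m. \<bar>vp_coeff a m k y\<bar>) \<le> (\<Sum>k\<in>pos_set m. g (k + 1) - g k)" by (intro sum_mono)
  also have "\<dots> = (\<Sum>k\<in>{0..int (2 ^ nat m) - 1}. g (k + 1) - g k)" using False by (simp add: pos_set_def)
  also have "\<dots> = g (int (2 ^ nat m)) - g 0" by (rule sum_int_telescope)
  also have "\<dots> = a / 2 * (vp_var (a * (of_int (int (2 ^ nat m)) / 2 ^ nat m - y)) - vp_var (a * (of_int 0 / 2 ^ nat m - y)))"
    by (simp add: g_def right_diff_distrib)
  also have "\<dots> \<le> a / 2 * 100" using a vp_var_bound by (intro mult_left_mono) auto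
  finally show ?thesis using a by simp
qed

section \<open>Band-limited functions\<close>

lemma vec_lambda_measurable: "(vec_lambda :: ('d::finite \<Rightarrow> real) \<Rightarrow> real ^ 'd) \<in> PiM UNIV (\<lambda>_. lborel) \<rightarrow>\<^sub>M borel"
  by (rule borel_measurable_euclidean_space[THEN iffD2])
    (auto simp: Basis_vec_def inner_axis intro!: measurable_component_singleton)

text \<open>Agreement on boxes identifies the measures. This makes product measures available for
  vectors, hence Fubini for integrands that factor over the coordinates.\<close>

lemma lborel_vec_eq: "(lborel :: (real ^ 'd) measure) = distr (PiM UNIV (\<lambda>_. lborel)) borel vec_lambda"
proof (rule lborel_eqI)
  interpret product_sigma_finite "\<lambda>_ :: 'd. lborel :: real measure" ..
  fix l u :: "real ^ 'd" assume lu: "\<And>b. b \<in> Basis \<Longrightarrow> l \<bullet> b \<le> u \<bullet> b"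
  have lu': "l $ i \<le> u $ i" for i using lu[of "axis i 1"] by (simp add: inner_axis axis_in_Basis_iff)
  have "emeasure (distr (PiM UNIV (\<lambda>_. lborel)) borel vec_lambda) (box l u) =
      emeasure (PiM UNIV (\<lambda>_. lborel)) (vec_lambda -` box l u \<inter> space (PiM UNIV (\<lambda>_. lborel)))"
    by (rule emeasure_distr[OF vec_lambda_measurable]) simp
  also have "vec_lambda -` box l u \<inter> space (PiM UNIV (\<lambda>_. lborel)) = PiE UNIV (\<lambda>i. box (l $ i) (u $ i))"
    by (auto simp: mem_box_cart space_PiM PiE_def Pi_def)
  also have "emeasure (PiM UNIV (\<lambda>_. lborel)) \<dots> = (\<Prod>i\<in>UNIV. emeasure lborel (box (l $ i) (u $ i)))"
    by (rule emeasure_PiM) auto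
  also have "\<dots> = (\<Prod>i\<in>UNIV. ennreal ((u - l) $ i))" using lu' by simp
  also have "\<dots> = ennreal (\<Prod>i\<in>UNIV. (u - l) $ i)" using lu' by (intro prod_ennreal) auto
  also have "(\<Prod>i\<in>UNIV. (u - l) $ i) = (\<Prod>b\<in>Basis. (u - l) \<bullet> b)"
  proof -
    have B: "(Basis :: (real ^ 'd) set) = (\<lambda>i. axis i 1) ` UNIV" by (auto simp: Basis_vec_def)
    show ?thesis unfolding B by (subst prod.reindex) (auto simp: inj_on_def axis_eq_axis inner_axis)
  qed
  finally show "emeasure (distr (PiM UNIV (\<lambda>_. lborel)) borel vec_lambda) (box l u) = (\<Prod>b\<in>Basis. (u - l) \<bullet> b)" .
qed simp

lemma integral_prod_vec:
  fixes u :: "'d::finite \<Rightarrow> real \<Rightarrow> 'b::{real_normed_field, banach, second_countable_topology}"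
  assumes u: "\<And>i. integrable lborel (u i)"
  shows "integrable lborel (\<lambda>x :: real ^ 'd. \<Prod>i\<in>UNIV. u i (x $ i))"
    and "(\<integral>x. (\<Prod>i\<in>UNIV. u i (x $ i)) \<partial>lborel) = (\<Prod>i\<in>UNIV. integral\<^sup>L lborel (u i))"
proof -
  interpret product_sigma_finite "\<lambda>_ :: 'd. lborel :: real measure" ..
  have [measurable]: "u i \<in> borel_measurable borel" for i using borel_measurable_integrable[OF u] by simp
  have m: "(\<lambda>x :: real ^ 'd. \<Prod>i\<in>UNIV. u i (x $ i)) \<in> borel_measurable borel" by measurable
  show "integrable lborel (\<lambda>x :: real ^ 'd. \<Prod>i\<in>UNIV. u i (x $ i))"
    unfolding lborel_vec_eq using product_integrable_prod[of UNIV u] u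
    by (subst integrable_distr_eq[OF vec_lambda_measurable m]) auto
  show "(\<integral>x. (\<Prod>i\<in>UNIV. u i (x $ i)) \<partial>lborel) = (\<Prod>i\<in>UNIV. integral\<^sup>L lborel (u i))"
    unfolding lborel_vec_eq using product_integral_prod[of UNIV u] u
    by (subst integral_distr[OF vec_lambda_measurable m]) auto
qed

section \<open>Fourier integrals and reproduction by the kernel\<close>

lemma lborel_integral_reflect:
  fixes f :: "'a::euclidean_space \<Rightarrow> 'b::{banach, second_countable_topology}"
  assumes f: "f \<in> borel_measurable borel"
  shows "(\<integral>y. f y \<partial>lborel) = (\<integral>y. f (x - y) \<partial>lborel)"
proof -
  have e: "(lborel :: 'a measure) = distr lborel borel (\<lambda>y. x - y)"
    using lborel_affine[of "-1" x] by (simp add: density_1)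
  show ?thesis by (subst e, subst integral_distr[OF _ f]) simp_all
qed

lemma exp_inner_vec:
  fixes x y :: "real ^ 'd"
  shows "exp (c * of_real (x \<bullet> y)) = (\<Prod>i\<in>UNIV. exp (c * complex_of_real (x $ i * y $ i)))"
  by (simp add: inner_vec_def sum_distrib_left flip: exp_sum)

lemma continuous_on_band_limited:
  fixes F :: "'a::euclidean_space \<Rightarrow> complex"
  assumes F: "integrable lborel F"
  shows "continuous_on A (\<lambda>x. \<integral>\<xi>. F \<xi> * exp (\<i> * of_real (x \<bullet> \<xi>)) \<partial>lborel)"
proof -
  have [measurable]: "F \<in> borel_measurable borel" using borel_measurable_integrable[OF F] by simp
  have "(\<lambda>n. \<integral>\<xi>. F \<xi> * exp (\<i> * of_real (X n \<bullet> \<xi>)) \<partial>lborel) \<longlonglongrightarrow> (\<integral>\<xi>. F \<xi> * exp (\<i> * of_real (x \<bullet> \<xi>)) \<partial>lborel)"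
    if X: "X \<longlonglongrightarrow> x" for X x
  proof (rule integral_dominated_convergence[where w = "\<lambda>\<xi>. norm (F \<xi>)"])
    show "AE \<xi> in lborel. (\<lambda>n. F \<xi> * exp (\<i> * of_real (X n \<bullet> \<xi>))) \<longlonglongrightarrow> F \<xi> * exp (\<i> * of_real (x \<bullet> \<xi>))"
      using X by (intro AE_I2 tendsto_intros)
  qed (use F in \<open>auto simp: norm_mult intro!: borel_measurable_times borel_measurable_continuous_onI[where f = "\<lambda>\<xi>. exp (\<i> * complex_of_real (_ \<bullet> \<xi>))"] continuous_intros\<close>)
  then show ?thesis by (auto simp: continuous_on_sequentially o_def)
qed

definition vp_kernel :: "('d::finite \<Rightarrow> real) \<Rightarrow> real ^ 'd \<Rightarrow> real" where
  "vp_kernel a y = (\<Prod>i\<in>UNIV. vp_scaled (a i) (y $ i))"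

lemma vp_kernel_measurable [measurable]: "vp_kernel a \<in> borel_measurable borel"
  unfolding vp_kernel_def by measurable

lemma vp_kernel_shift_integrable:
  assumes "\<And>i. a i > 0" shows "integrable lborel (\<lambda>y. vp_kernel a (x - y))"
  unfolding vp_kernel_def using assms by (simp, intro integral_prod_vec[where u = "\<lambda>i t. vp_scaled (a i) (x $ i - t)"] vp_scaled_mass(2))

lemma vp_kernel_transform:
  assumes a: "\<And>i. a i > 0" and \<xi>: "\<And>i. \<bar>\<xi> $ i\<bar> \<le> 2 * a i"
  shows "(\<integral>y. of_real (vp_kernel a y) * exp (- \<i> * of_real (y \<bullet> \<xi>)) \<partial>lborel) = 1"
proof -
  have i: "integrable lborel (\<lambda>t. of_real (vp_scaled (a i) t) * exp (- \<i> * of_real (t * \<xi> $ i)))" for i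
    by (rule integrable_mult_bounded[where B = 1])
      (auto intro!: vp_scaled_integrable a borel_measurable_continuous_onI continuous_intros integrable_of_real)
  have "(\<integral>y. of_real (vp_kernel a y) * exp (- \<i> * of_real (y \<bullet> \<xi>)) \<partial>lborel) =
     (\<integral>y. (\<Prod>i\<in>UNIV. of_real (vp_scaled (a i) (y $ i)) * exp (- \<i> * of_real (y $ i * \<xi> $ i))) \<partial>lborel)"
    unfolding vp_kernel_def exp_inner_vec by (simp add: prod.distrib)
  also have "\<dots> = (\<Prod>i\<in>UNIV. \<integral>t. of_real (vp_scaled (a i) t) * exp (- \<i> * of_real (t * \<xi> $ i)) \<partial>lborel)"
    using i by (rule integral_prod_vec)
  also have "\<dots> = 1" using vp_scaled_transform[OF a \<xi>] by simp
  finally show ?thesis .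
qed

text \<open>The product of F and g is integrable on the product space and majorises the integrand; E
  will always be an exponential.\<close>

lemma integral_swap:
  fixes F g :: "'a::euclidean_space \<Rightarrow> complex" and E :: "'a \<Rightarrow> 'a \<Rightarrow> complex"
  assumes F: "integrable lborel F" and g: "integrable lborel g"
    and E: "(\<lambda>(x, y). E x y) \<in> borel_measurable (borel \<Otimes>\<^sub>M borel)" and E1: "\<And>x y. norm (E x y) \<le> 1"
  shows "(\<integral>y. g y * (\<integral>x. F x * E x y \<partial>lborel) \<partial>lborel) = (\<integral>x. F x * (\<integral>y. g y * E x y \<partial>lborel) \<partial>lborel)"
proof -
  have [measurable]: "F \<in> borel_measurable borel" "g \<in> borel_measurable borel"
    using borel_measurable_integrable[OF F] borel_measurable_integrable[OF g] by auto
  have E': "(\<lambda>z. E (fst z) (snd z)) \<in> borel_measurable (lborel \<Otimes>\<^sub>M lborel)"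
    by (subst measurable_cong_sets[OF sets_pair_measure_cong[OF sets_lborel sets_lborel] refl])
      (use E in \<open>simp add: case_prod_beta\<close>)
  have "integrable (lborel \<Otimes>\<^sub>M lborel) (\<lambda>z. F (fst z) * g (snd z))"
  proof (rule lborel_pair.Fubini_integrable)
    show "(\<lambda>z. F (fst z) * g (snd z)) \<in> borel_measurable (lborel \<Otimes>\<^sub>M lborel)" by measurable
    have "(\<lambda>x. \<integral>y. norm (F (fst (x, y)) * g (snd (x, y))) \<partial>lborel) = (\<lambda>x. norm (F x) * (\<integral>y. norm (g y) \<partial>lborel))"
      by (simp add: norm_mult)
    then show "integrable lborel (\<lambda>x. \<integral>y. norm (F (fst (x, y)) * g (snd (x, y))) \<partial>lborel)" using F by simp
    show "AE x in lborel. integrable lborel (\<lambda>y. F (fst (x, y)) * g (snd (x, y)))" using g by simp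
  qed
  then have "integrable (lborel \<Otimes>\<^sub>M lborel) (\<lambda>z. F (fst z) * g (snd z) * E (fst z) (snd z))"
  proof (rule Bochner_Integration.integrable_bound)
    show "(\<lambda>z. F (fst z) * g (snd z) * E (fst z) (snd z)) \<in> borel_measurable (lborel \<Otimes>\<^sub>M lborel)"
      by (rule borel_measurable_times[OF _ E']) measurable
    show "AE z in lborel \<Otimes>\<^sub>M lborel. norm (F (fst z) * g (snd z) * E (fst z) (snd z)) \<le> norm (F (fst z) * g (snd z))"
      using E1 by (intro AE_I2) (simp add: norm_mult mult_left_le)
  qed
  then have "integrable (lborel \<Otimes>\<^sub>M lborel) (\<lambda>(x, y). F x * g y * E x y)"
    by (subst case_prod_beta')
  then have "(\<integral>y. (\<integral>x. F x * g y * E x y \<partial>lborel) \<partial>lborel) = (\<integral>x. (\<integral>y. F x * g y * E x y \<partial>lborel) \<partial>lborel)"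
    by (rule lborel_pair.Fubini_integral)
  moreover have "(\<integral>x. F x * g y * E x y \<partial>lborel) = g y * (\<integral>x. F x * E x y \<partial>lborel)" for y
    by (simp add: mult.assoc mult.left_commute[of _ "g y"])
  moreover have "(\<integral>y. F x * g y * E x y \<partial>lborel) = F x * (\<integral>y. g y * E x y \<partial>lborel)" for x
    by (simp add: mult.assoc)
  ultimately show ?thesis by simp
qed

text \<open>Convolution with the kernel multiplies F by a transform equal to 1 on its support. One
  exchange of integrals carries this out on the frequency side, where F and the kernel supply the
  integrability.\<close>

lemma band_limited_reproduce:
  fixes F :: "real ^ 'd \<Rightarrow> complex"
  assumes F: "integrable lborel F" and a: "\<And>i. a i > 0"
    and supp: "\<And>\<xi>. F \<xi> \<noteq> 0 \<Longrightarrow> \<forall>i. \<bar>\<xi> $ i\<bar> \<le> 2 * a i"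
    and h: "\<And>x. h x = (\<integral>\<xi>. F \<xi> * exp (\<i> * of_real (x \<bullet> \<xi>)) \<partial>lborel)"
  shows "h x = (\<integral>y. h y * of_real (vp_kernel a (x - y)) \<partial>lborel)"
proof -
  have "(\<integral>y. h y * of_real (vp_kernel a (x - y)) \<partial>lborel) = (\<integral>y. of_real (vp_kernel a (x - y)) * (\<integral>\<xi>. F \<xi> * exp (\<i> * of_real (y \<bullet> \<xi>)) \<partial>lborel) \<partial>lborel)"
    by (simp add: h mult.commute)
  also have "\<dots> = (\<integral>\<xi>. F \<xi> * (\<integral>y. of_real (vp_kernel a (x - y)) * exp (\<i> * of_real (y \<bullet> \<xi>)) \<partial>lborel) \<partial>lborel)"
  proof (rule integral_swap[OF F])
    show "integrable lborel (\<lambda>y. complex_of_real (vp_kernel a (x - y)))"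
      by (intro integrable_of_real vp_kernel_shift_integrable a)
    have "(\<lambda>(x, y). exp (\<i> * complex_of_real (y \<bullet> x))) \<in> borel_measurable (borel :: ((real ^ 'd) \<times> (real ^ 'd)) measure)"
      by (intro borel_measurable_continuous_onI) (auto simp: case_prod_beta intro!: continuous_intros)
    then show "(\<lambda>(x, y). exp (\<i> * complex_of_real (y \<bullet> x))) \<in> borel_measurable ((borel :: (real ^ 'd) measure) \<Otimes>\<^sub>M (borel :: (real ^ 'd) measure))"
      by (simp add: borel_prod)
  qed simp
  also have "\<dots> = (\<integral>\<xi>. F \<xi> * exp (\<i> * of_real (x \<bullet> \<xi>)) \<partial>lborel)"
  proof (intro Bochner_Integration.integral_cong refl)
    fix \<xi>
    show "F \<xi> * (\<integral>y. of_real (vp_kernel a (x - y)) * exp (\<i> * of_real (y \<bullet> \<xi>)) \<partial>lborel) = F \<xi> * exp (\<i> * of_real (x \<bullet> \<xi>))"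
    proof (cases "F \<xi> = 0")
      case False
      then have s: "\<bar>\<xi> $ i\<bar> \<le> 2 * a i" for i using supp by blast
      have "(\<integral>y. of_real (vp_kernel a (x - y)) * exp (\<i> * of_real (y \<bullet> \<xi>)) \<partial>lborel) =
         (\<integral>y. of_real (vp_kernel a y) * exp (\<i> * of_real ((x - y) \<bullet> \<xi>)) \<partial>lborel)"
        using lborel_integral_reflect[where f = "\<lambda>y. of_real (vp_kernel a (x - y)) * exp (\<i> * of_real (y \<bullet> \<xi>))" and x = x]
        by (simp add: borel_measurable_times borel_measurable_continuous_onI continuous_intros)
      also have "\<dots> = (\<integral>y. (of_real (vp_kernel a y) * exp (- \<i> * of_real (y \<bullet> \<xi>))) * exp (\<i> * of_real (x \<bullet> \<xi>)) \<partial>lborel)"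
        by (intro Bochner_Integration.integral_cong refl) (simp add: inner_diff_left right_diff_distrib exp_diff exp_minus divide_inverse)
      also have "\<dots> = exp (\<i> * of_real (x \<bullet> \<xi>))" using vp_kernel_transform[OF a s] by simp
      finally show ?thesis by simp
    qed simp
  qed
  finally show ?thesis by (simp add: h)
qed

section \<open>Jensen's inequality and Schur's test\<close>

lemma powr_tangent:
  fixes t \<mu> p :: real
  assumes p: "p \<ge> 1" and t: "t \<ge> 0" and l: "\<mu> > 0"
  shows "t \<le> \<mu> powr (1 - p) * t powr p / p + (1 - 1 / p) * \<mu>"
proof (cases "p = 1")
  case False
  then have p1: "p > 1" using p by simp
  define r where "r = p / (p - 1)"
  have r: "r > 1" "1/p + 1/r = 1" "1/r = 1 - 1/p" using p1 by (auto simp: r_def field_simps)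
  have "t / \<mu> * 1 \<le> (t / \<mu>) powr p / p + 1 powr r / r" using p1 r t l by (intro Youngs_inequality) auto
  then have "t / \<mu> \<le> (t / \<mu>) powr p / p + (1 - 1 / p)" using r by simp
  then have "t / \<mu> * \<mu> \<le> ((t / \<mu>) powr p / p + (1 - 1 / p)) * \<mu>" using l by (intro mult_right_mono) auto
  also have "\<dots> = \<mu> * (t / \<mu>) powr p / p + (1 - 1 / p) * \<mu>" by (simp add: distrib_right)
  also have "\<mu> * (t / \<mu>) powr p = \<mu> powr (1 - p) * t powr p" using l t by (simp add: powr_divide powr_diff)
  finally show ?thesis using l by simp
qed (use l t in simp)

text \<open>The tangent of the convex function t powr p at \<mu> is integrated against D. In
  contrast to Hoelder's inequality this includes p = 1, where the conjugate exponent is infinite,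
  and it tolerates a mass below R.\<close>

lemma weighted_jensen:
  fixes g D :: "'a \<Rightarrow> real"
  assumes p: "p \<ge> 1" and R: "R > 0" and D: "integrable M D" "\<And>y. D y \<ge> 0" "integral\<^sup>L M D \<le> R"
    and g: "\<And>y. g y \<ge> 0" "integrable M (\<lambda>y. g y * D y)" "integrable M (\<lambda>y. g y powr p * D y)"
    and d: "0 \<le> d" "d \<le> (\<integral>y. g y * D y \<partial>M)"
  shows "d powr p \<le> R powr (p - 1) * (\<integral>y. g y powr p * D y \<partial>M)"
proof (cases "d = 0")
  case True
  then show ?thesis using D g by (auto intro!: mult_nonneg_nonneg integral_nonneg)
next
  case False
  then have d0: "d > 0" using d by simp
  \<comment> \<open>At the tangent point d / R the linear terms sum to at most (1 - 1/p) d, which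
    leaves d / p on the left.\<close>
  define \<mu> where "\<mu> = d / R"
  have l: "\<mu> > 0" using d0 R by (simp add: \<mu>_def)
  define X where "X = (\<integral>y. g y powr p * D y \<partial>M)"
  have "d \<le> (\<integral>y. g y * D y \<partial>M)" by fact
  also have "\<dots> \<le> (\<integral>y. \<mu> powr (1 - p) / p * (g y powr p * D y) + (1 - 1 / p) * \<mu> * D y \<partial>M)"
  proof (intro integral_mono)
    fix y
    have "g y * D y \<le> (\<mu> powr (1 - p) * g y powr p / p + (1 - 1 / p) * \<mu>) * D y"
      using powr_tangent[OF p g(1) l] D(2) by (intro mult_right_mono) auto
    then show "g y * D y \<le> \<mu> powr (1 - p) / p * (g y powr p * D y) + (1 - 1 / p) * \<mu> * D y"
      by (simp add: algebra_simps)
  qed (use g D in auto)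
  also have "\<dots> = \<mu> powr (1 - p) / p * X + (1 - 1 / p) * \<mu> * integral\<^sup>L M D"
    using g D by (simp add: X_def)
  also have "\<dots> \<le> \<mu> powr (1 - p) / p * X + (1 - 1 / p) * \<mu> * R"
    using p l D by (intro add_left_mono mult_left_mono) auto
  also have "(1 - 1 / p) * \<mu> * R = (1 - 1 / p) * d" using R by (simp add: \<mu>_def)
  finally have "d / p \<le> \<mu> powr (1 - p) * X / p" by (simp add: algebra_simps)
  then have "d \<le> \<mu> powr (1 - p) * X" using p by (simp add: divide_le_cancel)
  then have "\<mu> powr (p - 1) * d \<le> \<mu> powr (p - 1) * (\<mu> powr (1 - p) * X)" by (intro mult_left_mono) auto
  also have "\<dots> = X" using l by (simp flip: powr_add mult.assoc)
  finally have "\<mu> powr (p - 1) * d \<le> X" .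
  then have "R powr (p - 1) * (\<mu> powr (p - 1) * d) \<le> R powr (p - 1) * X" by (intro mult_left_mono) auto
  moreover have "R powr (p - 1) * (\<mu> powr (p - 1) * d) = d powr p"
    using R d0 by (simp add: \<mu>_def powr_divide powr_mult_base mult.commute[of _ d])
  ultimately show ?thesis by (simp add: X_def)
qed

text \<open>Jensen with respect to |D k| uses the mass R and contributes the power p - 1; summing
  over k under the integral uses S once. The bound B on h makes the products integrable and does not
  enter the estimate.\<close>

lemma schur_bound:
  fixes h :: "real ^ 'd \<Rightarrow> complex" and D :: "'k \<Rightarrow> real ^ 'd \<Rightarrow> real"
  assumes p: "p \<ge> 1" and R: "R > 0" and h: "h \<in> borel_measurable borel" "\<And>y. norm (h y) \<le> B" "integrable lborel (\<lambda>y. norm (h y) powr p)"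
    and D: "\<And>k. k \<in> A \<Longrightarrow> integrable lborel (D k)" "\<And>k. k \<in> A \<Longrightarrow> (\<integral>y. \<bar>D k y\<bar> \<partial>lborel) \<le> R"
      "\<And>y. (\<Sum>k\<in>A. \<bar>D k y\<bar>) \<le> S"
    and d: "\<And>k. k \<in> A \<Longrightarrow> d k = (\<integral>y. h y * of_real (D k y) \<partial>lborel)"
  shows "(\<Sum>k\<in>A. norm (d k) powr p) \<le> R powr (p - 1) * S * (\<integral>y. norm (h y) powr p \<partial>lborel)"
proof -
  have [measurable]: "h \<in> borel_measurable borel" by fact
  have Dm [measurable]: "D k \<in> borel_measurable borel" if "k \<in> A" for k using borel_measurable_integrable[OF D(1)[OF that]] by simp
  have B: "B \<ge> 0" using h(2)[of undefined] by (meson norm_ge_zero order_trans)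
  have i1: "integrable lborel (\<lambda>y. norm (h y) * \<bar>D k y\<bar>)" if k: "k \<in> A" for k
  proof (rule Bochner_Integration.integrable_bound[OF integrable_mult_right[OF integrable_abs[OF D(1)[OF k]], of B]])
    show "AE y in lborel. norm (norm (h y) * \<bar>D k y\<bar>) \<le> norm (B * \<bar>D k y\<bar>)"
      using h(2) B by (auto simp: abs_mult intro!: mult_right_mono)
  qed (use Dm[OF k] in measurable)
  have i2: "integrable lborel (\<lambda>y. norm (h y) powr p * \<bar>D k y\<bar>)" if k: "k \<in> A" for k
  proof (rule Bochner_Integration.integrable_bound[OF integrable_mult_right[OF integrable_abs[OF D(1)[OF k]], of "B powr p"]])
    show "AE y in lborel. norm (norm (h y) powr p * \<bar>D k y\<bar>) \<le> norm (B powr p * \<bar>D k y\<bar>)"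
      using h(2) B p by (auto simp: abs_mult intro!: mult_right_mono powr_mono2)
  qed (use Dm[OF k] in measurable)
  have "norm (d k) powr p \<le> R powr (p - 1) * (\<integral>y. norm (h y) powr p * \<bar>D k y\<bar> \<partial>lborel)" if k: "k \<in> A" for k
  proof (rule weighted_jensen[OF p R])
    have "norm (d k) \<le> (\<integral>y. norm (h y * of_real (D k y)) \<partial>lborel)"
      unfolding d[OF k] by (rule integral_norm_bound)
    then show "norm (d k) \<le> (\<integral>y. norm (h y) * \<bar>D k y\<bar> \<partial>lborel)" by (simp add: norm_mult)
  qed (use k D i1 i2 in auto)
  then have "(\<Sum>k\<in>A. norm (d k) powr p) \<le> (\<Sum>k\<in>A. R powr (p - 1) * (\<integral>y. norm (h y) powr p * \<bar>D k y\<bar> \<partial>lborel))"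
    by (intro sum_mono)
  also have "\<dots> = R powr (p - 1) * (\<integral>y. (\<Sum>k\<in>A. norm (h y) powr p * \<bar>D k y\<bar>) \<partial>lborel)"
    using i2 by (subst Bochner_Integration.integral_sum) (auto simp: sum_distrib_left)
  also have "\<dots> \<le> R powr (p - 1) * (\<integral>y. S * norm (h y) powr p \<partial>lborel)"
  proof (intro mult_left_mono integral_mono)
    show "(\<Sum>k\<in>A. norm (h y) powr p * \<bar>D k y\<bar>) \<le> S * norm (h y) powr p" for y
      using D(3)[of y] by (simp add: mult.commute[of S] mult_left_mono flip: sum_distrib_left)
  qed (use i2 h in auto)
  also have "\<dots> = R powr (p - 1) * S * (\<integral>y. norm (h y) powr p \<partial>lborel)" by simp
  finally show ?thesis .
qed

text \<open>2 vp_mass bounds the mass of one coefficient density, see \<open>vp_coeff_mass\<close>;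
  adding 1 makes the constant positive. The kernel itself, of mass vp_mass per coordinate, is
  covered as well.\<close>

definition schur_mass :: "nat \<Rightarrow> real" where
  "schur_mass d = (2 * vp_mass + 1) ^ d"

lemma schur_mass_pos: "schur_mass d > 0"
  using vp_mass_nonneg by (simp add: schur_mass_def)

text \<open>Both parts apply Schur's test to the reproducing integral: with tensor products of
  \<open>vp_coeff\<close>, whose sums are at most 100 a i per coordinate, for the coefficients, and
  with the kernel itself for point values, which is Nikolskii's inequality. A common constant lets
  both be expressed by the same weights later.\<close>

lemma band_limited_coeff_bound:
  fixes F h :: "real ^ 'd \<Rightarrow> complex"
  assumes F: "integrable lborel F" and a: "\<And>i. a i > 0"
    and supp: "\<And>\<xi>. F \<xi> \<noteq> 0 \<Longrightarrow> \<forall>i. \<bar>\<xi> $ i\<bar> \<le> 2 * a i"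
    and h: "\<And>x. h x = (\<integral>\<xi>. F \<xi> * exp (\<i> * of_real (x \<bullet> \<xi>)) \<partial>lborel)"
    and p: "p \<ge> 1" and hp: "integrable lborel (\<lambda>y. norm (h y) powr p)"
  shows "(\<And>i. m $ i \<ge> -1) \<Longrightarrow> (\<Sum>k\<in>pos_set_d m. norm (faber_coeff m k h) powr p) \<le>
      schur_mass CARD('d) powr (p - 1) * (\<Prod>i\<in>UNIV. 100 * a i) * (\<integral>y. norm (h y) powr p \<partial>lborel)"
    and "norm (h x) powr p \<le>
      schur_mass CARD('d) powr (p - 1) * (\<Prod>i\<in>UNIV. 100 * a i) * (\<integral>y. norm (h y) powr p \<partial>lborel)"
proof -
  have hc: "continuous_on UNIV h" using continuous_on_band_limited[OF F, of UNIV] unfolding h[abs_def, symmetric]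
    by (simp add: h cong: continuous_on_cong)
  then have hm: "h \<in> borel_measurable borel" by (rule borel_measurable_continuous_onI)
  have hB: "norm (h y) \<le> (\<integral>\<xi>. norm (F \<xi>) \<partial>lborel)" for y
  proof -
    have "norm (h y) \<le> (\<integral>\<xi>. norm (F \<xi> * exp (\<i> * of_real (y \<bullet> \<xi>))) \<partial>lborel)" unfolding h by (rule integral_norm_bound)
    then show ?thesis by (simp add: norm_mult)
  qed
  note rep = band_limited_reproduce[OF F a supp h]
  have hint: "integrable lborel (\<lambda>y. h y * of_real (vp_kernel a (x - y)))" for x
  proof -
    have "integrable lborel (\<lambda>y. of_real (vp_kernel a (x - y)) * h y)"
      by (rule integrable_mult_bounded[OF _ hm hB]) (intro integrable_of_real vp_kernel_shift_integrable a)
    then show ?thesis by (simp add: mult.commute)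
  qed
  show "norm (h x) powr p \<le> schur_mass CARD('d) powr (p - 1) * (\<Prod>i\<in>UNIV. 100 * a i) * (\<integral>y. norm (h y) powr p \<partial>lborel)" for x
  proof -
    \<comment> \<open>A single value is treated as a family indexed by one element.\<close>
    have "(\<Sum>k\<in>{()}. norm (h x) powr p) \<le> schur_mass CARD('d) powr (p - 1) * (\<Prod>i\<in>UNIV. 100 * a i) * (\<integral>y. norm (h y) powr p \<partial>lborel)"
    proof (rule schur_bound[OF p schur_mass_pos hm hB hp, where D = "\<lambda>_ y. vp_kernel a (x - y)"])
      show "(\<integral>y. \<bar>vp_kernel a (x - y)\<bar> \<partial>lborel) \<le> schur_mass CARD('d)"
      proof -
        have "(\<integral>y. \<bar>vp_kernel a (x - y)\<bar> \<partial>lborel) = (\<integral>y. (\<Prod>i\<in>UNIV. \<bar>vp_scaled (a i) (x $ i - y $ i)\<bar>) \<partial>lborel)"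
          by (simp add: vp_kernel_def abs_prod)
        also have "\<dots> = (\<Prod>i\<in>UNIV. \<integral>t. \<bar>vp_scaled (a i) (x $ i - t)\<bar> \<partial>lborel)"
          by (rule integral_prod_vec[where u = "\<lambda>i t. \<bar>vp_scaled (a i) (x $ i - t)\<bar>"]) (intro integrable_abs vp_scaled_mass(2) a)
        also have "\<dots> = vp_mass ^ CARD('d)" using vp_scaled_mass(1)[OF a] by simp
        also have "\<dots> \<le> schur_mass CARD('d)" unfolding schur_mass_def using vp_mass_nonneg by (intro power_mono) auto
        finally show ?thesis .
      qed
      show "(\<Sum>k\<in>{()}. \<bar>vp_kernel a (x - y)\<bar>) \<le> (\<Prod>i\<in>UNIV. 100 * a i)" for y
      proof -
        have "\<bar>vp_kernel a (x - y)\<bar> \<le> (\<Prod>i\<in>UNIV. 100 * a i)" unfolding vp_kernel_def abs_prod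
        proof (intro prod_mono conjI)
          fix i
          have "\<bar>vp_scaled (a i) ((x - y) $ i)\<bar> \<le> a i * 10"
            using a[of i] vp_bound unfolding vp_scaled_def abs_mult by (intro mult_mono) auto
          then show "\<bar>vp_scaled (a i) ((x - y) $ i)\<bar> \<le> 100 * a i" using a[of i] by linarith
        qed simp
        then show ?thesis by simp
      qed
    qed (rule vp_kernel_shift_integrable[OF a], rule rep)
    then show ?thesis by simp
  qed
  assume m: "\<And>i. m $ i \<ge> -1"
  show "(\<Sum>k\<in>pos_set_d m. norm (faber_coeff m k h) powr p) \<le>
      schur_mass CARD('d) powr (p - 1) * (\<Prod>i\<in>UNIV. 100 * a i) * (\<integral>y. norm (h y) powr p \<partial>lborel)"
  proof (rule schur_bound[OF p schur_mass_pos hm hB hp, where D = "\<lambda>k y. \<Prod>i\<in>UNIV. vp_coeff (a i) (m $ i) (k $ i) (y $ i)"])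
    fix k :: "int ^ 'd"
    show "integrable lborel (\<lambda>y. \<Prod>i\<in>UNIV. vp_coeff (a i) (m $ i) (k $ i) (y $ i))"
      by (intro integral_prod_vec vp_coeff_mass a)
    have "(\<integral>y. \<bar>\<Prod>i\<in>UNIV. vp_coeff (a i) (m $ i) (k $ i) (y $ i)\<bar> \<partial>lborel) = (\<integral>y. (\<Prod>i\<in>UNIV. \<bar>vp_coeff (a i) (m $ i) (k $ i) (y $ i)\<bar>) \<partial>lborel)"
      by (simp add: abs_prod)
    also have "\<dots> = (\<Prod>i\<in>UNIV. \<integral>t. \<bar>vp_coeff (a i) (m $ i) (k $ i) t\<bar> \<partial>lborel)"
      by (rule integral_prod_vec) (intro integrable_abs vp_coeff_mass a)
    also have "\<dots> \<le> (\<Prod>i\<in>(UNIV::'d set). 2 * vp_mass + 1)"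
    proof (intro prod_mono conjI)
      fix i
      show "(\<integral>t. \<bar>vp_coeff (a i) (m $ i) (k $ i) t\<bar> \<partial>lborel) \<le> 2 * vp_mass + 1"
        using vp_coeff_mass(2)[OF a[of i], of "m $ i" "k $ i"] by linarith
    qed simp
    finally show "(\<integral>y. \<bar>\<Prod>i\<in>UNIV. vp_coeff (a i) (m $ i) (k $ i) (y $ i)\<bar> \<partial>lborel) \<le> schur_mass CARD('d)"
      by (simp add: schur_mass_def)
    \<comment> \<open>Each point value is replaced by its reproducing integral; the finite
      combination moves under the integral and factors over the coordinates into
      \<open>vp_coeff\<close>.\<close>
    have "faber_coeff m k h = (\<Sum>s\<in>PiE UNIV (\<lambda>_. {..<3}). of_real (\<Prod>i\<in>UNIV. wgt (m $ i) (s i)) *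
        (\<integral>y. h y * of_real (vp_kernel a ((\<chi> i. node (m $ i) (k $ i) (s i)) - y)) \<partial>lborel))"
      unfolding faber_coeff_expansion[OF m] by (intro sum.cong refl arg_cong2[where f = "(*)"] rep)
    also have "\<dots> = (\<integral>y. (\<Sum>s\<in>PiE UNIV (\<lambda>_. {..<3}). of_real (\<Prod>i\<in>UNIV. wgt (m $ i) (s i)) *
        (h y * of_real (vp_kernel a ((\<chi> i. node (m $ i) (k $ i) (s i)) - y)))) \<partial>lborel)"
      using hint by (subst Bochner_Integration.integral_sum) auto
    also have "\<dots> = (\<integral>y. h y * of_real (\<Prod>i\<in>UNIV. vp_coeff (a i) (m $ i) (k $ i) (y $ i)) \<partial>lborel)"
    proof (intro Bochner_Integration.integral_cong refl)
      fix y
      have "(\<Prod>i\<in>UNIV. vp_coeff (a i) (m $ i) (k $ i) (y $ i)) =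
        (\<Sum>s\<in>PiE UNIV (\<lambda>_. {..<3}). \<Prod>i\<in>UNIV. wgt (m $ i) (s i) * vp_scaled (a i) (node (m $ i) (k $ i) (s i) - y $ i))"
        unfolding vp_coeff_def by (rule prod_sum_PiE) auto
      also have "\<dots> = (\<Sum>s\<in>PiE UNIV (\<lambda>_. {..<3}). (\<Prod>i\<in>UNIV. wgt (m $ i) (s i)) * vp_kernel a ((\<chi> i. node (m $ i) (k $ i) (s i)) - y))"
        by (simp add: vp_kernel_def prod.distrib)
      finally have e: "(\<Prod>i\<in>UNIV. vp_coeff (a i) (m $ i) (k $ i) (y $ i)) = \<dots>" .
      show "(\<Sum>s\<in>PiE UNIV (\<lambda>_. {..<3}). of_real (\<Prod>i\<in>UNIV. wgt (m $ i) (s i)) *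
        (h y * of_real (vp_kernel a ((\<chi> i. node (m $ i) (k $ i) (s i)) - y)))) = h y * of_real (\<Prod>i\<in>UNIV. vp_coeff (a i) (m $ i) (k $ i) (y $ i))"
        unfolding e of_real_sum of_real_mult sum_distrib_left by (intro sum.cong refl) (simp only: mult_ac)
    qed
    finally show "faber_coeff m k h = (\<integral>y. h y * of_real (\<Prod>i\<in>UNIV. vp_coeff (a i) (m $ i) (k $ i) (y $ i)) \<partial>lborel)" .
  next
    fix y :: "real ^ 'd"
    have "(\<Sum>k\<in>pos_set_d m. \<bar>\<Prod>i\<in>UNIV. vp_coeff (a i) (m $ i) (k $ i) (y $ i)\<bar>) =
      (\<Sum>k\<in>PiE UNIV (\<lambda>i. pos_set (m $ i)). \<Prod>i\<in>UNIV. \<bar>vp_coeff (a i) (m $ i) (k i) (y $ i)\<bar>)"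
      unfolding pos_set_d_def sum_vec_reindex by (simp add: abs_prod)
    also have "\<dots> = (\<Prod>i\<in>UNIV. \<Sum>k\<in>pos_set (m $ i). \<bar>vp_coeff (a i) (m $ i) k (y $ i)\<bar>)"
      by (rule prod_sum_PiE[symmetric]) auto
    also have "\<dots> \<le> (\<Prod>i\<in>UNIV. 100 * a i)"
      using vp_coeff_sum[OF a m] by (intro prod_mono) (auto intro: sum_nonneg)
    finally show "(\<Sum>k\<in>pos_set_d m. \<bar>\<Prod>i\<in>UNIV. vp_coeff (a i) (m $ i) (k $ i) (y $ i)\<bar>) \<le> (\<Prod>i\<in>UNIV. 100 * a i)" .
  qed
qed

section \<open>Identification of the frequency decomposition\<close>

lemma resolution_continuous:
  assumes "resolution_of_unity \<phi>"
  shows "continuous_on A (\<phi> n)"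
proof -
  have "\<phi> n differentiable at x" for x
  proof -
    have "\<forall>l x. iter_deriv l (\<phi> n) differentiable at x"
      using assms by (simp add: resolution_of_unity_def smooth_def)
    from this[rule_format, of 0 x] show ?thesis by (simp add: iter_deriv_def)
  qed
  then show ?thesis by (meson continuous_at_imp_continuous_on differentiable_imp_continuous_within)
qed

lemma resolution_measurable:
  assumes "resolution_of_unity \<phi>"
  shows "\<phi> n \<in> borel_measurable borel"
  by (intro borel_measurable_continuous_onI resolution_continuous assms)

lemma resolution_bounded:
  assumes "resolution_of_unity \<phi>"
  obtains B where "B \<ge> 0" "\<And>n x. norm (\<phi> n x) \<le> B"
proof -
  have "\<forall>l. \<exists>B. \<forall>n x. 2 ^ (n * l) * norm (iter_deriv l (\<phi> n) x) \<le> B"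
    using assms by (simp add: resolution_of_unity_def)
  from this[rule_format, of 0] obtain B where B: "\<And>n x. norm (\<phi> n x) \<le> B"
    by (auto simp: iter_deriv_def)
  then show ?thesis using that[of B] norm_ge_zero order_trans by blast
qed

lemma resolution_support:
  assumes "resolution_of_unity \<phi>" "\<phi> n x \<noteq> 0"
  shows "\<bar>x\<bar> \<le> 2 * 2 ^ n" and "n \<ge> 1 \<Longrightarrow> 2 ^ (n - 1) \<le> \<bar>x\<bar>"
proof -
  have x: "x \<in> supp (\<phi> n)" using assms closure_subset[of "{x. \<phi> n x \<noteq> 0}"] by (auto simp: supp_def)
  show "n \<ge> 1 \<Longrightarrow> 2 ^ (n - 1) \<le> \<bar>x\<bar>" using x assms(1) by (auto simp: resolution_of_unity_def)
  show "\<bar>x\<bar> \<le> 2 * 2 ^ n"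
  proof (cases "n = 0")
    case True then show ?thesis using x assms(1) by (auto simp: resolution_of_unity_def)
  next
    case False
    have "\<forall>n\<ge>1. supp (\<phi> n) \<subseteq> {x. 2 ^ (n - 1) \<le> \<bar>x\<bar> \<and> \<bar>x\<bar> \<le> 2 ^ (n + 1)}"
      using assms(1) unfolding resolution_of_unity_def by (elim conjE)
    from this[rule_format, of n] show ?thesis using x False by auto
  qed
qed

text \<open>Positive indices n and m that do not vanish at the same x satisfy n <= m + 2, so there
  are at most three of them, and n = 0 may be a fourth. Independence of N is what dominated
  convergence needs.\<close>

lemma resolution_partial_sums:
  assumes res: "resolution_of_unity \<phi>" and B: "B \<ge> 0" "\<And>n x. norm (\<phi> n x) \<le> B"
  shows "norm (\<Sum>n\<le>N. \<phi> n x) \<le> 4 * B"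
proof -
  define J where "J = {n. n \<ge> 1 \<and> \<phi> n x \<noteq> 0}"
  have close: "n \<le> m + 2" if "n \<in> J" "m \<in> J" for n m
  proof -
    have "(2::real) ^ (n - 1) \<le> 2 * 2 ^ m"
      using resolution_support[OF res, of n x] resolution_support[OF res, of m x] that by (force simp: J_def)
    then have "(2::real) ^ (n - 1) \<le> 2 ^ Suc m" by simp
    then have "n - 1 \<le> Suc m" by (subst (asm) power_increasing_iff) auto
    then show ?thesis by simp
  qed
  have "finite J \<and> card J \<le> 3"
  proof (cases "J = {}")
    case False
    define m where "m = (LEAST n. n \<in> J)"
    have "m \<in> J" "\<And>n. n \<in> J \<Longrightarrow> m \<le> n" using False by (auto simp: m_def intro: LeastI Least_le)
    then have "J \<subseteq> {m..m + 2}" using close by force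
    then show ?thesis using card_mono[of "{m..m + 2}" J] by (auto intro: finite_subset)
  qed simp
  then have J: "finite (insert 0 J)" "card (insert 0 J) \<le> 4" using card_insert_le_m1[of 4 J 0] by auto
  have "norm (\<Sum>n\<le>N. \<phi> n x) = norm (\<Sum>n\<in>{..N} \<inter> insert 0 J. \<phi> n x)"
    by (intro arg_cong[where f = norm] sum.mono_neutral_right) (auto simp: J_def)
  also have "\<dots> \<le> real (card ({..N} \<inter> insert 0 J)) * B" using B by (intro sum_norm_bound) auto
  also have "card ({..N} \<inter> insert 0 J) \<le> card (insert 0 J)" by (intro card_mono J) auto
  then have "card ({..N} \<inter> insert 0 J) \<le> 4" using J(2) by linarith
  then have "real (card ({..N} \<inter> insert 0 J)) * B \<le> 4 * B" using B by (intro mult_right_mono) auto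
  finally show ?thesis .
qed

lemma resolution_integrable:
  assumes "resolution_of_unity \<phi>"
  shows "integrable lborel (\<phi> n)"
proof -
  define K :: "real set" where "K = {- (2 * 2 ^ n)..2 * 2 ^ n}"
  have "integrable lborel (\<lambda>x. indicator K x *\<^sub>R \<phi> n x)"
    by (intro borel_integrable_compact resolution_continuous assms) (simp add: K_def)
  moreover have "(\<lambda>x. indicator K x *\<^sub>R \<phi> n x) = \<phi> n"
  proof
    fix x
    show "indicator K x *\<^sub>R \<phi> n x = \<phi> n x"
      using resolution_support(1)[OF assms, of n x] by (cases "\<phi> n x = 0") (auto simp: K_def indicator_def abs_le_iff)
  qed
  ultimately show ?thesis by simp
qed

text \<open>The common prefactor of both transforms. Its square is the inverse of (2 pi) ^ d, the
  factor that appears in \<open>bump_transform\<close>.\<close>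

definition unitary_const :: "nat \<Rightarrow> real" where
  "unitary_const d = (2 * pi) powr (- real d / 2)"

lemma unitary_const_inverse: "unitary_const d > 0" "unitary_const d * ((2 * pi) ^ d * unitary_const d) = 1"
proof -
  show "unitary_const d > 0" by (simp add: unitary_const_def)
  have e: "unitary_const d * unitary_const d = (2 * pi) powr (- real d)"
    by (simp add: unitary_const_def flip: powr_add)
  have "(2 * pi) powr (- real d) = inverse ((2 * pi) ^ d)"
    by (subst powr_minus, subst powr_realpow) simp_all
  then show "unitary_const d * ((2 * pi) ^ d * unitary_const d) = 1"
    by (subst mult.left_commute) (simp only: e, rule right_inverse, simp)
qed

text \<open>The Fourier transform of a Lebesgue integrable function only depends on a Borel
  measurable representative, for which Fubini's theorem is available.\<close>

lemma fourier_borel_representative: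
  fixes g :: "real ^ 'd \<Rightarrow> complex"
  assumes "integrable lebesgue g"
  obtains g' where "integrable lborel g'" "AE x in lebesgue. g x = g' x"
    "\<And>\<xi>. fourier g \<xi> = of_real (unitary_const CARD('d)) * (\<integral>x. g' x * exp (- \<i> * of_real (\<xi> \<bullet> x)) \<partial>lborel)"
proof -
  have gm: "g \<in> borel_measurable lebesgue" using assms by auto
  obtain g' where g': "g' \<in> borel_measurable lborel" "AE x in lborel. g x = g' x"
  proof -
    obtain u where u: "u \<in> borel_measurable lborel" "AE x in lborel. Re (g x) = u x"
      using completion_ex_borel_measurable_real[of "\<lambda>x. Re (g x)" lborel] gm by auto
    obtain v where v: "v \<in> borel_measurable lborel" "AE x in lborel. Im (g x) = v x"
      using completion_ex_borel_measurable_real[of "\<lambda>x. Im (g x)" lborel] gm by auto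
    show ?thesis
    proof (rule that)
      show "(\<lambda>x. of_real (u x) + \<i> * of_real (v x)) \<in> borel_measurable lborel" using u v by measurable
      show "AE x in lborel. g x = of_real (u x) + \<i> * of_real (v x)"
        using u(2) v(2) by eventually_elim (simp add: complex_eq_iff)
    qed
  qed
  have ae: "AE x in lebesgue. g x = g' x" using g'(2) by (rule AE_completion)
  have m: "g' \<in> borel_measurable lebesgue" using g'(1) by (rule measurable_completion)
  have "integrable lebesgue g'" using assms ae m gm integrable_cong_AE by blast
  then have int: "integrable lborel g'" using g'(1) by (simp add: integrable_completion)
  have "fourier g \<xi> = of_real (unitary_const CARD('d)) * (\<integral>x. g' x * exp (- \<i> * of_real (\<xi> \<bullet> x)) \<partial>lborel)" for \<xi>
  proof -
    have em: "(\<lambda>x. exp (- \<i> * complex_of_real (\<xi> \<bullet> x))) \<in> borel_measurable borel"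
      by (intro borel_measurable_continuous_onI continuous_intros)
    then have em': "(\<lambda>x. exp (- \<i> * complex_of_real (\<xi> \<bullet> x))) \<in> borel_measurable lebesgue"
      by (intro measurable_completion) simp
    have "(\<integral>x. g x * exp (- \<i> * of_real (\<xi> \<bullet> x)) \<partial>lebesgue) = (\<integral>x. g' x * exp (- \<i> * of_real (\<xi> \<bullet> x)) \<partial>lebesgue)"
    proof (rule integral_cong_AE)
      show "AE x in lebesgue. g x * exp (- \<i> * of_real (\<xi> \<bullet> x)) = g' x * exp (- \<i> * of_real (\<xi> \<bullet> x))"
        using ae by eventually_elim simp
    qed (intro borel_measurable_times gm m em')+
    also have "\<dots> = (\<integral>x. g' x * exp (- \<i> * of_real (\<xi> \<bullet> x)) \<partial>lborel)"
      using g'(1) em by (intro integral_completion borel_measurable_times) auto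
    finally show ?thesis by (simp add: fourier_def unitary_const_def)
  qed
  then show ?thesis using that int ae by blast
qed

text \<open>\<open>F\<close> absorbs both prefactors, so a block is a plain exponential integral of
  an integrable function. The support bound is the one required by
  \<open>band_limited_coeff_bound\<close> with a i = 2 ^ (l $ i).\<close>

lemma freq_block_band_limited:
  fixes g :: "real ^ 'd \<Rightarrow> complex"
  assumes res: "resolution_of_unity \<phi>"
    and G: "\<And>\<xi>. fourier g \<xi> = of_real (unitary_const CARD('d)) * (\<integral>x. g' x * exp (- \<i> * of_real (\<xi> \<bullet> x)) \<partial>lborel)"
    and g': "integrable lborel g'"
  defines "F \<equiv> \<lambda>(l :: nat ^ 'd) \<xi>. of_real (unitary_const CARD('d)) * ((\<Prod>i\<in>UNIV. \<phi> (l $ i) (\<xi> $ i)) * fourier g \<xi>)"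
  shows "integrable lborel (F l)"
    and "F l \<xi> \<noteq> 0 \<Longrightarrow> \<forall>i. \<bar>\<xi> $ i\<bar> \<le> 2 * 2 ^ (l $ i)"
    and "freq_block \<phi> l g x = (\<integral>\<xi>. F l \<xi> * exp (\<i> * of_real (x \<bullet> \<xi>)) \<partial>lborel)"
    and "fourier g \<in> borel_measurable borel"
    and "norm (fourier g \<xi>) \<le> unitary_const CARD('d) * (\<integral>x. norm (g' x) \<partial>lborel)"
proof -
  have "continuous_on UNIV (\<lambda>\<xi>. \<integral>x. g' x * exp (\<i> * of_real (- \<xi> \<bullet> x)) \<partial>lborel)"
    by (rule continuous_on_compose2[OF continuous_on_band_limited[OF g', of UNIV]]) (auto intro!: continuous_intros)
  then have "continuous_on UNIV (\<lambda>\<xi>. \<integral>x. g' x * exp (- \<i> * of_real (\<xi> \<bullet> x)) \<partial>lborel)" by simp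
  then have "continuous_on UNIV (fourier g)" unfolding G by (intro continuous_intros)
  then show fm: "fourier g \<in> borel_measurable borel" by (rule borel_measurable_continuous_onI)
  show fb: "norm (fourier g \<xi>) \<le> unitary_const CARD('d) * (\<integral>x. norm (g' x) \<partial>lborel)" for \<xi>
  proof -
    have "norm (\<integral>x. g' x * exp (- \<i> * of_real (\<xi> \<bullet> x)) \<partial>lborel) \<le> (\<integral>x. norm (g' x * exp (- \<i> * of_real (\<xi> \<bullet> x))) \<partial>lborel)"
      by (rule integral_norm_bound)
    then show ?thesis unfolding G using unitary_const_inverse(1)[of "CARD('d)"] by (simp add: norm_mult)
  qed
  have prm: "integrable lborel (\<lambda>\<xi> :: real ^ 'd. \<Prod>i\<in>UNIV. \<phi> (l $ i) (\<xi> $ i))" for l :: "nat ^ 'd"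
    by (intro integral_prod_vec resolution_integrable res)
  show int: "integrable lborel (F l)" for l
    unfolding F_def by (intro integrable_mult_right integrable_mult_bounded[OF prm fm fb])
  show "\<forall>i. \<bar>\<xi> $ i\<bar> \<le> 2 * 2 ^ (l $ i)" if "F l \<xi> \<noteq> 0"
  proof
    fix i
    have "\<phi> (l $ i) (\<xi> $ i) \<noteq> 0" using that by (auto simp: F_def)
    then show "\<bar>\<xi> $ i\<bar> \<le> 2 * 2 ^ (l $ i)" by (rule resolution_support(1)[OF res])
  qed
  show "freq_block \<phi> l g x = (\<integral>\<xi>. F l \<xi> * exp (\<i> * of_real (x \<bullet> \<xi>)) \<partial>lborel)"
  proof -
    have em: "(\<lambda>\<xi>. exp (\<i> * complex_of_real (x \<bullet> \<xi>))) \<in> borel_measurable borel"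
      by (intro borel_measurable_continuous_onI continuous_intros)
    have pm: "(\<lambda>\<xi> :: real ^ 'd. \<Prod>i\<in>UNIV. \<phi> (l $ i) (\<xi> $ i)) \<in> borel_measurable borel"
      using borel_measurable_integrable[OF prm] by simp
    have "freq_block \<phi> l g x = of_real (unitary_const CARD('d)) *
        (\<integral>\<xi>. (\<Prod>i\<in>UNIV. \<phi> (l $ i) (\<xi> $ i)) * fourier g \<xi> * exp (\<i> * of_real (x \<bullet> \<xi>)) \<partial>lborel)"
      unfolding freq_block_def inv_fourier_def unitary_const_def
      by (subst integral_completion) (auto intro!: borel_measurable_times em pm fm)
    then show ?thesis unfolding F_def by (simp add: mult.assoc)
  qed
qed

section \<open>Triangle bumps and their transforms\<close>

definition bump :: "real ^ 'd \<Rightarrow> real \<Rightarrow> real ^ 'd \<Rightarrow> real" where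
  "bump c \<delta> y = (\<Prod>i\<in>UNIV. tri ((y $ i - c $ i) / \<delta>))"

text \<open>The frequency profile of the bump: its integral against exp (- i s y) returns
  \<open>bump\<close>, while the bump itself transforms to (2 pi) ^ d times this function.\<close>

definition bump_hat :: "real ^ 'd \<Rightarrow> real \<Rightarrow> real ^ 'd \<Rightarrow> complex" where
  "bump_hat c \<delta> s = of_real (\<Prod>i\<in>UNIV. \<delta> * fejer (\<delta> * s $ i)) * exp (\<i> * of_real (s \<bullet> c))"

lemma bump_nonneg: "bump c \<delta> y \<ge> 0"
  unfolding bump_def by (intro prod_nonneg) (simp add: tri_def)

lemma tri_shift:
  fixes x :: real
  assumes \<delta>: "\<delta> > 0"
  shows "integrable lborel (\<lambda>y. tri ((y - c) / \<delta>))" "(\<integral>y. tri ((y - c) / \<delta>) \<partial>lborel) = \<delta>"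
    "(\<integral>y. of_real (tri ((y - c) / \<delta>)) * exp (\<i> * of_real (y * x)) \<partial>lborel) = of_real (2 * pi * (\<delta> * fejer (\<delta> * x))) * exp (\<i> * of_real (x * c))"
proof -
  show "integrable lborel (\<lambda>y. tri ((y - c) / \<delta>))"
    using lborel_integrable_real_affine[OF tri_integrable, of "1 / \<delta>" "- c / \<delta>"] \<delta> by (simp add: diff_divide_distrib)
  have tr: "(\<integral>y. of_real (tri ((y - c) / \<delta>)) * exp (\<i> * of_real (y * x)) \<partial>lborel) = of_real (2 * pi * (\<delta> * fejer (\<delta> * x))) * exp (\<i> * of_real (x * c))" for x
  proof -
    have "(\<integral>y. of_real (tri ((y - c) / \<delta>)) * exp (\<i> * of_real (y * x)) \<partial>lborel) =
       \<bar>\<delta>\<bar> *\<^sub>R (\<integral>y. of_real (tri ((c + \<delta> * y - c) / \<delta>)) * exp (\<i> * of_real ((c + \<delta> * y) * x)) \<partial>lborel)"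
      using \<delta> by (intro lborel_integral_real_affine) auto
    also have "(\<lambda>y. of_real (tri ((c + \<delta> * y - c) / \<delta>)) * exp (\<i> * of_real ((c + \<delta> * y) * x))) =
       (\<lambda>y. (of_real (tri y) * exp (\<i> * of_real (y * (\<delta> * x)))) * exp (\<i> * of_real (x * c)))"
      using \<delta> by (auto simp: fun_eq_iff algebra_simps exp_add)
    also have "(\<integral>y. (of_real (tri y) * exp (\<i> * of_real (y * (\<delta> * x)))) * exp (\<i> * of_real (x * c)) \<partial>lborel) =
       of_real (2 * pi * fejer (\<delta> * x)) * exp (\<i> * of_real (x * c))"
      by (subst integral_mult_left_zero) (simp only: tri_transform)
    finally show ?thesis using \<delta> by (simp add: scaleR_conv_of_real mult_ac)
  qed
  then show "(\<integral>y. of_real (tri ((y - c) / \<delta>)) * exp (\<i> * of_real (y * x)) \<partial>lborel) = of_real (2 * pi * (\<delta> * fejer (\<delta> * x))) * exp (\<i> * of_real (x * c))" .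
  \<comment> \<open>The integral is the transform at x = 0, where \<open>fejer\<close> equals 1 / (2
    pi).\<close>
  have "complex_of_real (\<integral>y. tri ((y - c) / \<delta>) \<partial>lborel) = of_real \<delta>"
    using tr[of 0] by (simp add: fejer_0)
  then show "(\<integral>y. tri ((y - c) / \<delta>) \<partial>lborel) = \<delta>" by (simp only: of_real_eq_iff)
qed

lemma bump_integrable: "\<delta> > 0 \<Longrightarrow> integrable lborel (bump c \<delta>)"
  unfolding bump_def[abs_def] by (intro integral_prod_vec(1)[where u = "\<lambda>i y. tri ((y - c $ i) / \<delta>)"] tri_shift)

lemma bump_integral: "\<delta> > 0 \<Longrightarrow> integral\<^sup>L lborel (bump (c :: real ^ 'd) \<delta>) = \<delta> ^ CARD('d)"
  unfolding bump_def[abs_def] by (subst integral_prod_vec(2)[where u = "\<lambda>i y. tri ((y - c $ i) / \<delta>)"]) (simp_all add: tri_shift)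

lemma bump_hat_integrable:
  assumes \<delta>: "\<delta> > 0" shows "integrable lborel (bump_hat c \<delta>)"
proof -
  have "integrable lborel (\<lambda>s. \<delta> * fejer (\<delta> * s))"
    using \<delta> fejer_integrable by (intro integrable_mult_right) (simp add: lborel_integral_dilate)
  then have "integrable lborel (\<lambda>s. \<Prod>i\<in>UNIV. \<delta> * fejer (\<delta> * s $ i))"
    by (intro integral_prod_vec(1)[where u = "\<lambda>i t. \<delta> * fejer (\<delta> * t)"])
  then show ?thesis unfolding bump_hat_def[abs_def]
    by (intro integrable_mult_bounded[where B = 1] integrable_of_real) (auto intro!: borel_measurable_continuous_onI continuous_intros)
qed

lemma bump_transform:
  assumes \<delta>: "\<delta> > 0"
  shows "(\<integral>y. of_real (bump c \<delta> y) * exp (\<i> * of_real (y \<bullet> \<xi>)) \<partial>lborel) = of_real ((2 * pi) ^ CARD('d)) * bump_hat c \<delta> (\<xi> :: real ^ 'd)"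
proof -
  have i: "integrable lborel (\<lambda>t. of_real (tri ((t - c $ i) / \<delta>)) * exp (\<i> * of_real (t * \<xi> $ i)))" for i
    by (intro integrable_mult_bounded[where B = 1] integrable_of_real tri_shift \<delta>) (auto intro!: borel_measurable_continuous_onI continuous_intros)
  have "(\<integral>y. of_real (bump c \<delta> y) * exp (\<i> * of_real (y \<bullet> \<xi>)) \<partial>lborel) =
     (\<integral>y. (\<Prod>i\<in>UNIV. of_real (tri ((y $ i - c $ i) / \<delta>)) * exp (\<i> * of_real (y $ i * \<xi> $ i))) \<partial>lborel)"
    unfolding bump_def exp_inner_vec by (simp add: prod.distrib)
  also have "\<dots> = (\<Prod>i\<in>UNIV. \<integral>t. of_real (tri ((t - c $ i) / \<delta>)) * exp (\<i> * of_real (t * \<xi> $ i)) \<partial>lborel)"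
    by (rule integral_prod_vec(2)[OF i])
  also have "\<dots> = (\<Prod>i\<in>UNIV. of_real (2 * pi) * (of_real (\<delta> * fejer (\<delta> * \<xi> $ i)) * exp (\<i> * of_real (\<xi> $ i * c $ i))))"
    unfolding tri_shift(3)[OF \<delta>] by (simp only: of_real_mult mult_ac)
  also have "\<dots> = of_real ((2 * pi) ^ CARD('d)) * bump_hat c \<delta> \<xi>"
    unfolding bump_hat_def exp_inner_vec by (simp add: prod.distrib)
  finally show ?thesis .
qed

text \<open>Both directions are computed from the explicit one-variable pair:
  \<open>bump_transform\<close> serves the pairing with blocks, this one the pairing with the
  function itself.\<close>

lemma bump_inverse_transform:
  assumes \<delta>: "\<delta> > 0"
  shows "(\<integral>s. bump_hat c \<delta> s * exp (- \<i> * of_real (s \<bullet> y)) \<partial>lborel) = of_real (bump c \<delta> (y :: real ^ 'd))"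
proof -
  have i: "integrable lborel (\<lambda>t. of_real (\<delta> * fejer (\<delta> * t)) * exp (- \<i> * of_real (t * (y $ i - c $ i))))" for i
    using \<delta> fejer_integrable
    by (intro integrable_mult_bounded[where B = 1] integrable_of_real integrable_mult_right)
      (auto simp: lborel_integral_dilate intro!: borel_measurable_continuous_onI continuous_intros)
  have "bump_hat c \<delta> s * exp (- \<i> * of_real (s \<bullet> y)) =
     (\<Prod>i\<in>UNIV. of_real (\<delta> * fejer (\<delta> * s $ i)) * exp (- \<i> * of_real (s $ i * (y $ i - c $ i))))" for s
  proof -
    have "bump_hat c \<delta> s * exp (- \<i> * of_real (s \<bullet> y)) = of_real (\<Prod>i\<in>UNIV. \<delta> * fejer (\<delta> * s $ i)) * exp (- \<i> * of_real (s \<bullet> (y - c)))"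
      by (simp add: bump_hat_def inner_diff_right right_diff_distrib exp_diff exp_minus divide_inverse)
    also have "\<dots> = (\<Prod>i\<in>UNIV. of_real (\<delta> * fejer (\<delta> * s $ i)) * exp (- \<i> * of_real (s $ i * (y $ i - c $ i))))"
      unfolding exp_inner_vec vector_minus_component of_real_prod unfolding prod.distrib ..
    finally show ?thesis .
  qed
  then have "(\<integral>s. bump_hat c \<delta> s * exp (- \<i> * of_real (s \<bullet> y)) \<partial>lborel) =
      (\<integral>s. (\<Prod>i\<in>UNIV. of_real (\<delta> * fejer (\<delta> * s $ i)) * exp (- \<i> * of_real (s $ i * (y $ i - c $ i)))) \<partial>lborel)"
    by (simp only:)
  also have "\<dots> = (\<Prod>i\<in>UNIV. \<integral>t. of_real (\<delta> * fejer (\<delta> * t)) * exp (- \<i> * of_real (t * (y $ i - c $ i))) \<partial>lborel)"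
    by (rule integral_prod_vec(2)[OF i])
  also have "\<dots> = of_real (bump c \<delta> y)" by (simp only: fejer_dilate_transform[OF \<delta>] bump_def of_real_prod)
  finally show ?thesis .
qed

section \<open>Testing the block series against bumps\<close>

lemma borel_exp_inner:
  "(\<lambda>(x, y). exp (c * complex_of_real (x \<bullet> y))) \<in> borel_measurable ((borel :: (real ^ 'd) measure) \<Otimes>\<^sub>M (borel :: (real ^ 'd) measure))"
  "(\<lambda>(x, y). exp (c * complex_of_real (y \<bullet> x))) \<in> borel_measurable ((borel :: (real ^ 'd) measure) \<Otimes>\<^sub>M (borel :: (real ^ 'd) measure))"
proof -
  have "(\<lambda>(x, y). exp (c * complex_of_real (x \<bullet> y))) \<in> borel_measurable (borel :: ((real ^ 'd) \<times> (real ^ 'd)) measure)"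
    "(\<lambda>(x, y). exp (c * complex_of_real (y \<bullet> x))) \<in> borel_measurable (borel :: ((real ^ 'd) \<times> (real ^ 'd)) measure)"
    by (auto intro!: borel_measurable_continuous_onI continuous_intros simp: case_prod_beta)
  then show "(\<lambda>(x, y). exp (c * complex_of_real (x \<bullet> y))) \<in> borel_measurable ((borel :: (real ^ 'd) measure) \<Otimes>\<^sub>M (borel :: (real ^ 'd) measure))"
    "(\<lambda>(x, y). exp (c * complex_of_real (y \<bullet> x))) \<in> borel_measurable ((borel :: (real ^ 'd) measure) \<Otimes>\<^sub>M (borel :: (real ^ 'd) measure))"
    by (simp_all add: borel_prod)
qed

definition level_box :: "nat \<Rightarrow> (nat ^ 'd) set" where
  "level_box N = {l. \<forall>i. l $ i \<in> {..N}}"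

lemma finite_level_box: "finite (level_box N :: (nat ^ 'd) set)"
proof (rule finite_imageD)
  show "finite (vec_nth ` (level_box N :: (nat ^ 'd) set))"
    by (rule finite_subset[of _ "PiE UNIV (\<lambda>_. {..N})"]) (auto simp: finite_PiE level_box_def)
  show "inj_on vec_nth (level_box N :: (nat ^ 'd) set)" by (auto simp: inj_on_def vec_eq_iff)
qed

text \<open>Unordered sums over multi-indices may be evaluated along cubes, the exhaustion for which
  the resolution of unity factors over the coordinates.\<close>

lemma filterlim_level_box: "filterlim (level_box :: nat \<Rightarrow> (nat ^ 'd) set) (finite_subsets_at_top UNIV) sequentially"
  unfolding filterlim_finite_subsets_at_top
proof (intro allI impI)
  fix X :: "(nat ^ 'd) set" assume "finite X \<and> X \<subseteq> UNIV"
  then have X: "finite X" by simp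
  define M where "M = Max (insert 0 ((\<lambda>(l, i). l $ i) ` (X \<times> UNIV)))"
  have "l $ i \<le> M" if "l \<in> X" for l i
    unfolding M_def using X that by (intro Max_ge) (auto intro!: rev_image_eqI[of "(l, i)"])
  then have "X \<subseteq> level_box N" if "N \<ge> M" for N
    using that unfolding level_box_def by (auto intro: order_trans)
  then show "\<forall>\<^sub>F N in sequentially. finite (level_box N :: (nat ^ 'd) set) \<and> X \<subseteq> level_box N \<and> level_box N \<subseteq> UNIV"
    by (auto simp: eventually_sequentially finite_level_box)
qed

text \<open>Pairing a block with a bump integrates the multiplier of the block against one
  integrable function W. Over a cube the multipliers add up to a product of partial sums of the
  resolution, which is bounded and tends to 1; dominated convergence leaves the integral of W, and
  one more exchange identifies it with the pairing of g'.\<close>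

lemma freq_block_bump:
  fixes g :: "real ^ 'd \<Rightarrow> complex"
  assumes res: "resolution_of_unity \<phi>"
    and G: "\<And>\<xi>. fourier g \<xi> = of_real (unitary_const CARD('d)) * (\<integral>x. g' x * exp (- \<i> * of_real (\<xi> \<bullet> x)) \<partial>lborel)"
    and g': "integrable lborel g'" and \<delta>: "\<delta> > 0"
  shows "(\<lambda>N. \<Sum>l\<in>level_box N. \<integral>y. of_real (bump c \<delta> y) * freq_block \<phi> l g y \<partial>lborel) \<longlonglongrightarrow> (\<integral>y. g' y * of_real (bump c \<delta> y) \<partial>lborel)"
proof -
  define u where "u = unitary_const CARD('d)"
  have u: "u > 0" "u * ((2 * pi) ^ CARD('d) * u) = 1" using unitary_const_inverse by (auto simp: u_def)
  define F where "F l \<xi> = of_real u * ((\<Prod>i\<in>UNIV. \<phi> (l $ i) (\<xi> $ i)) * fourier g \<xi>)" for l :: "nat ^ 'd" and \<xi>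
  note FB = freq_block_band_limited[OF res G g', folded u_def, folded F_def]
  \<comment> \<open>The factor 1 / u equals u (2 pi) ^ d, the prefactor in F times the constant of
    \<open>bump_transform\<close>.\<close>
  define W where "W \<xi> = of_real (1 / u) * (fourier g \<xi> * bump_hat c \<delta> \<xi>)" for \<xi>
  obtain B where B: "B \<ge> 0" "\<And>n x. norm (\<phi> n x) \<le> B" using resolution_bounded[OF res] by blast
  have bh: "integrable lborel (bump_hat c \<delta>)" by (rule bump_hat_integrable[OF \<delta>])
  have "integrable lborel (\<lambda>\<xi>. bump_hat c \<delta> \<xi> * fourier g \<xi>)"
    by (rule integrable_mult_bounded[OF bh FB(4) FB(5)])
  then have Wi: "integrable lborel W" unfolding W_def by (intro integrable_mult_right) (simp add: mult.commute)
  have bc: "integrable lborel (\<lambda>y. complex_of_real (bump c \<delta> y))" by (intro integrable_of_real bump_integrable \<delta>)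
  have blk: "(\<integral>y. of_real (bump c \<delta> y) * freq_block \<phi> l g y \<partial>lborel) = (\<integral>\<xi>. (\<Prod>i\<in>UNIV. \<phi> (l $ i) (\<xi> $ i)) * W \<xi> \<partial>lborel)" for l
  proof -
    have "(\<integral>y. of_real (bump c \<delta> y) * freq_block \<phi> l g y \<partial>lborel) =
        (\<integral>\<xi>. F l \<xi> * (\<integral>y. of_real (bump c \<delta> y) * exp (\<i> * of_real (y \<bullet> \<xi>)) \<partial>lborel) \<partial>lborel)"
      unfolding FB(3) by (rule integral_swap[OF FB(1) bc borel_exp_inner(2)]) simp
    also have "\<dots> = (\<integral>\<xi>. (\<Prod>i\<in>UNIV. \<phi> (l $ i) (\<xi> $ i)) * W \<xi> \<partial>lborel)"
    proof (intro Bochner_Integration.integral_cong refl)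
      fix \<xi>
      have "u * (2 * pi) ^ CARD('d) = 1 / u" using u by (simp add: field_simps)
      then have e: "complex_of_real u * of_real ((2 * pi) ^ CARD('d)) = of_real (1 / u)" by (metis of_real_mult)
      have rearr: "v * (b * z) * (d * w) = (v * d) * (b * z * w)" for v b z d w :: complex by (simp only: mult_ac)
      show "F l \<xi> * (\<integral>y. of_real (bump c \<delta> y) * exp (\<i> * of_real (y \<bullet> \<xi>)) \<partial>lborel) = (\<Prod>i\<in>UNIV. \<phi> (l $ i) (\<xi> $ i)) * W \<xi>"
        unfolding bump_transform[OF \<delta>] F_def W_def rearr e by (simp only: mult_ac)
    qed
    finally show ?thesis .
  qed
  have pi: "integrable lborel (\<lambda>\<xi>. (\<Prod>i\<in>UNIV. \<phi> (l $ i) (\<xi> $ i)) * W \<xi>)" for l :: "nat ^ 'd"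
  proof -
    have "norm (\<Prod>i\<in>UNIV. \<phi> (l $ i) (\<xi> $ i)) \<le> B ^ CARD('d)" for \<xi> :: "real ^ 'd"
      unfolding prod_norm[symmetric] using prod_mono[of UNIV "\<lambda>i. norm (\<phi> (l $ i) (\<xi> $ i))" "\<lambda>_. B"] B by simp
    moreover have "(\<lambda>\<xi> :: real ^ 'd. \<Prod>i\<in>UNIV. \<phi> (l $ i) (\<xi> $ i)) \<in> borel_measurable borel"
      by (intro borel_measurable_prod measurable_compose[OF _ resolution_measurable[OF res]]) simp
    ultimately have "integrable lborel (\<lambda>\<xi>. W \<xi> * (\<Prod>i\<in>UNIV. \<phi> (l $ i) (\<xi> $ i)))"
      by (intro integrable_mult_bounded[OF Wi])
    then show ?thesis by (simp add: mult.commute)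
  qed
  define P where "P N \<xi> = (\<Prod>i\<in>UNIV. \<Sum>n\<le>N. \<phi> n (\<xi> $ i))" for N and \<xi> :: "real ^ 'd"
  have sm: "(\<Sum>l\<in>level_box N. \<integral>y. of_real (bump c \<delta> y) * freq_block \<phi> l g y \<partial>lborel) = (\<integral>\<xi>. P N \<xi> * W \<xi> \<partial>lborel)" for N
  proof -
    have "(\<Sum>l\<in>level_box N. \<integral>y. of_real (bump c \<delta> y) * freq_block \<phi> l g y \<partial>lborel) = (\<integral>\<xi>. (\<Sum>l\<in>level_box N. (\<Prod>i\<in>UNIV. \<phi> (l $ i) (\<xi> $ i)) * W \<xi>) \<partial>lborel)"
      unfolding blk using pi by (intro Bochner_Integration.integral_sum[symmetric])
    also have "(\<lambda>\<xi>. \<Sum>l\<in>level_box N. (\<Prod>i\<in>UNIV. \<phi> (l $ i) (\<xi> $ i)) * W \<xi>) = (\<lambda>\<xi>. P N \<xi> * W \<xi>)"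
    proof
      fix \<xi> :: "real ^ 'd"
      have "P N \<xi> = (\<Sum>l\<in>PiE UNIV (\<lambda>_. {..N}). \<Prod>i\<in>UNIV. \<phi> (l i) (\<xi> $ i))"
        unfolding P_def by (rule prod_sum_PiE) auto
      also have "\<dots> = (\<Sum>l\<in>level_box N. \<Prod>i\<in>UNIV. \<phi> (l $ i) (\<xi> $ i))"
        unfolding level_box_def sum_vec_reindex by simp
      finally show "(\<Sum>l\<in>level_box N. (\<Prod>i\<in>UNIV. \<phi> (l $ i) (\<xi> $ i)) * W \<xi>) = P N \<xi> * W \<xi>"
        by (simp add: sum_distrib_right)
    qed
    finally show ?thesis .
  qed
  have lim: "(\<lambda>N. \<integral>\<xi>. P N \<xi> * W \<xi> \<partial>lborel) \<longlonglongrightarrow> integral\<^sup>L lborel W"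
  proof (rule integral_dominated_convergence[where w = "\<lambda>\<xi>. (4 * B) ^ CARD('d) * norm (W \<xi>)"])
    show "W \<in> borel_measurable lborel" using Wi by (rule borel_measurable_integrable)
    have "P N \<in> borel_measurable borel" for N
      unfolding P_def by (intro borel_measurable_prod borel_measurable_sum measurable_compose[OF _ resolution_measurable[OF res]]) simp
    then show "(\<lambda>\<xi>. P N \<xi> * W \<xi>) \<in> borel_measurable lborel" for N
      using borel_measurable_integrable[OF Wi] by (intro borel_measurable_times) auto
    show "integrable lborel (\<lambda>\<xi>. (4 * B) ^ CARD('d) * norm (W \<xi>))" using Wi by simp
    show "AE \<xi> in lborel. (\<lambda>N. P N \<xi> * W \<xi>) \<longlonglongrightarrow> W \<xi>"
    proof (intro AE_I2)
      fix \<xi> :: "real ^ 'd"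
      have "(\<lambda>N. \<Sum>n\<le>N. \<phi> n (\<xi> $ i)) \<longlonglongrightarrow> 1" for i
        using res by (simp add: resolution_of_unity_def sums_def_le)
      then have "(\<lambda>N. P N \<xi>) \<longlonglongrightarrow> (\<Prod>i\<in>(UNIV :: 'd set). 1)" unfolding P_def by (intro tendsto_prod)
      then have "(\<lambda>N. P N \<xi> * W \<xi>) \<longlonglongrightarrow> 1 * W \<xi>" by (intro tendsto_mult tendsto_const) simp
      then show "(\<lambda>N. P N \<xi> * W \<xi>) \<longlonglongrightarrow> W \<xi>" by simp
    qed
    show "AE \<xi> in lborel. norm (P N \<xi> * W \<xi>) \<le> (4 * B) ^ CARD('d) * norm (W \<xi>)" for N
    proof (intro AE_I2)
      fix \<xi> :: "real ^ 'd"
      have "norm (P N \<xi>) \<le> (\<Prod>i\<in>(UNIV :: 'd set). 4 * B)"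
        unfolding P_def prod_norm[symmetric] using resolution_partial_sums[OF res B] by (intro prod_mono) auto
      then show "norm (P N \<xi> * W \<xi>) \<le> (4 * B) ^ CARD('d) * norm (W \<xi>)" by (simp add: norm_mult mult_right_mono)
    qed
  qed
  have "(\<integral>y. g' y * of_real (bump c \<delta> y) \<partial>lborel) = (\<integral>y. g' y * (\<integral>s. bump_hat c \<delta> s * exp (- \<i> * of_real (s \<bullet> y)) \<partial>lborel) \<partial>lborel)"
    by (simp only: bump_inverse_transform[OF \<delta>])
  also have "\<dots> = (\<integral>s. bump_hat c \<delta> s * (\<integral>y. g' y * exp (- \<i> * of_real (s \<bullet> y)) \<partial>lborel) \<partial>lborel)"
    by (rule integral_swap[OF bh g' borel_exp_inner(1)]) simp
  also have "\<dots> = integral\<^sup>L lborel W"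
    using u(1) unfolding W_def G u_def[symmetric] by (intro Bochner_Integration.integral_cong refl) (simp add: field_simps)
  finally show ?thesis using lim by (simp add: sm)
qed

text \<open>The majorant b makes the convergence uniform, so the sum is continuous and bounded and
  may be paired with bumps term by term. The sum and g' are compared only through these
  pairings.\<close>

lemma freq_block_series_bump:
  fixes g :: "real ^ 'd \<Rightarrow> complex" and b :: "nat ^ 'd \<Rightarrow> real"
  assumes res: "resolution_of_unity \<phi>"
    and G: "\<And>\<xi>. fourier g \<xi> = of_real (unitary_const CARD('d)) * (\<integral>x. g' x * exp (- \<i> * of_real (\<xi> \<bullet> x)) \<partial>lborel)"
    and g': "integrable lborel g'"
    and b: "b summable_on UNIV" "\<And>l x. norm (freq_block \<phi> l g x) \<le> b l"
  shows "continuous_on UNIV (\<lambda>x. \<Sum>\<^sub>\<infinity>l. freq_block \<phi> l g x)"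
    and "norm (\<Sum>\<^sub>\<infinity>l. freq_block \<phi> l g x) \<le> (\<Sum>\<^sub>\<infinity>l. b l)"
    and "\<delta> > 0 \<Longrightarrow> (\<integral>y. g' y * of_real (bump c \<delta> y) \<partial>lborel) = (\<integral>y. (\<Sum>\<^sub>\<infinity>l. freq_block \<phi> l g y) * of_real (bump c \<delta> y) \<partial>lborel)"
proof -
  define h where "h l = freq_block \<phi> l g" for l
  define H where "H x = (\<Sum>\<^sub>\<infinity>l. h l x)" for x
  note FB = freq_block_band_limited[OF res G g']
  have hc: "continuous_on A (h l)" for l A
    unfolding h_def FB(3)[abs_def] by (rule continuous_on_band_limited[OF FB(1)])
  have ul: "uniform_limit UNIV (\<lambda>X y. \<Sum>l\<in>X. h l y) H (finite_subsets_at_top UNIV)"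
    unfolding H_def by (rule Weierstrass_m_test_general) (use b in \<open>auto simp: h_def\<close>)
  show Hc: "continuous_on UNIV (\<lambda>x. \<Sum>\<^sub>\<infinity>l. freq_block \<phi> l g x)"
    unfolding h_def[symmetric] H_def[symmetric]
    by (rule uniform_limit_theorem[OF _ ul]) (auto intro!: always_eventually continuous_on_sum hc)
  show Hb: "norm (\<Sum>\<^sub>\<infinity>l. freq_block \<phi> l g x) \<le> (\<Sum>\<^sub>\<infinity>l. b l)" for x
  proof (rule norm_infsum_le[OF has_sum_infsum has_sum_infsum[OF b(1)] b(2)])
    show "(\<lambda>l. freq_block \<phi> l g x) summable_on UNIV"
      using b by (intro abs_summable_summable[OF summable_on_comparison_test[OF b(1)]]) auto
  qed
  have hm: "h l \<in> borel_measurable borel" for l by (intro borel_measurable_continuous_onI hc)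
  have Hm: "H \<in> borel_measurable borel" using Hc unfolding H_def[abs_def] h_def by (intro borel_measurable_continuous_onI)
  have b0: "b l \<ge> 0" for l using b(2)[of l undefined] by (rule order_trans[OF norm_ge_zero])
  assume \<delta>: "\<delta> > 0"
  have bc: "integrable lborel (\<lambda>y. complex_of_real (bump c \<delta> y))" by (intro integrable_of_real bump_integrable \<delta>)
  have bm: "bump c \<delta> \<in> borel_measurable borel" using borel_measurable_integrable[OF bump_integrable[OF \<delta>]] by simp
  have l1: "(\<lambda>N. \<Sum>l\<in>level_box N. \<integral>y. of_real (bump c \<delta> y) * h l y \<partial>lborel) \<longlonglongrightarrow> (\<integral>y. g' y * of_real (bump c \<delta> y) \<partial>lborel)"
    unfolding h_def by (rule freq_block_bump[OF res G g' \<delta>])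
  have hi: "integrable lborel (\<lambda>y. of_real (bump c \<delta> y) * h l y)" for l
    by (rule integrable_mult_bounded[OF bc hm, of _ "b l"]) (use b in \<open>auto simp: h_def\<close>)
  have "(\<Sum>l\<in>level_box N. \<integral>y. of_real (bump c \<delta> y) * h l y \<partial>lborel) = (\<integral>y. of_real (bump c \<delta> y) * (\<Sum>l\<in>level_box N. h l y) \<partial>lborel)" for N
    using hi by (subst Bochner_Integration.integral_sum[symmetric]) (auto simp: sum_distrib_left)
  moreover have "(\<lambda>N. \<integral>y. of_real (bump c \<delta> y) * (\<Sum>l\<in>level_box N. h l y) \<partial>lborel) \<longlonglongrightarrow> (\<integral>y. of_real (bump c \<delta> y) * H y \<partial>lborel)"
  proof (rule integral_dominated_convergence[where w = "\<lambda>y. (\<Sum>\<^sub>\<infinity>l. b l) * bump c \<delta> y"])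
    show "(\<lambda>y. of_real (bump c \<delta> y) * H y) \<in> borel_measurable lborel"
      using Hm bm by (intro borel_measurable_times) auto
    show "(\<lambda>y. of_real (bump c \<delta> y) * (\<Sum>l\<in>level_box N. h l y)) \<in> borel_measurable lborel" for N
      using hm bm by (intro borel_measurable_times borel_measurable_sum) auto
    show "integrable lborel (\<lambda>y. (\<Sum>\<^sub>\<infinity>l. b l) * bump c \<delta> y)" by (intro integrable_mult_right bump_integrable \<delta>)
    show "AE y in lborel. (\<lambda>N. of_real (bump c \<delta> y) * (\<Sum>l\<in>level_box N. h l y)) \<longlonglongrightarrow> of_real (bump c \<delta> y) * H y"
    proof (intro AE_I2 tendsto_mult tendsto_const)
      fix y
      show "(\<lambda>N. \<Sum>l\<in>level_box N. h l y) \<longlonglongrightarrow> H y"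
        using filterlim_compose[OF tendsto_uniform_limitI[OF ul] filterlim_level_box] by simp
    qed
    show "AE y in lborel. norm (of_real (bump c \<delta> y) * (\<Sum>l\<in>level_box N. h l y)) \<le> (\<Sum>\<^sub>\<infinity>l. b l) * bump c \<delta> y" for N
    proof (intro AE_I2)
      fix y
      have "norm (\<Sum>l\<in>level_box N. h l y) \<le> (\<Sum>l\<in>level_box N. b l)" using b by (intro sum_norm_le) (auto simp: h_def)
      also have "\<dots> \<le> (\<Sum>\<^sub>\<infinity>l. b l)"
        by (rule finite_sum_le_infsum[OF b(1) finite_level_box]) (use b0 in auto)
      finally have "norm (\<Sum>l\<in>level_box N. h l y) * bump c \<delta> y \<le> (\<Sum>\<^sub>\<infinity>l. b l) * bump c \<delta> y"
        by (intro mult_right_mono bump_nonneg)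
      moreover have "norm (of_real (bump c \<delta> y) * (\<Sum>l\<in>level_box N. h l y)) = norm (\<Sum>l\<in>level_box N. h l y) * bump c \<delta> y"
        unfolding norm_mult using bump_nonneg[of c \<delta> y] by simp
      ultimately show "norm (of_real (bump c \<delta> y) * (\<Sum>l\<in>level_box N. h l y)) \<le> (\<Sum>\<^sub>\<infinity>l. b l) * bump c \<delta> y"
        by (simp only:)
    qed
  qed
  ultimately show "(\<integral>y. g' y * of_real (bump c \<delta> y) \<partial>lborel) = (\<integral>y. (\<Sum>\<^sub>\<infinity>l. freq_block \<phi> l g y) * of_real (bump c \<delta> y) \<partial>lborel)"
    using LIMSEQ_unique[OF l1] by (simp add: H_def h_def mult.commute)
qed

lemma bump_support:
  assumes \<delta>: "\<delta> > 0" and "bump c \<delta> y \<noteq> 0"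
  shows "\<bar>y $ i - c $ i\<bar> \<le> \<delta>"
proof (rule ccontr)
  assume "\<not> ?thesis"
  then have "tri ((y $ i - c $ i) / \<delta>) = 0" using \<delta> by (simp add: tri_def abs_divide max_def)
  then have "bump c \<delta> y = 0" unfolding bump_def by (intro prod_zero) auto
  then show False using assms by simp
qed

text \<open>If u c were nonzero, a narrow bump at c would see v within norm (u c) / 2 of u c almost
  everywhere on its support; as the bump is nonnegative with positive integral, the pairing could
  not vanish.\<close>

lemma bump_test:
  fixes u :: "real ^ 'd \<Rightarrow> complex"
  assumes S: "open S" "c \<in> S" and u: "continuous_on S u"
    and v: "AE y in lborel. y \<in> S \<longrightarrow> v y = u y"
    and vi: "\<And>\<delta>. \<delta> > 0 \<Longrightarrow> integrable lborel (\<lambda>y. v y * of_real (bump c \<delta> y))"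
    and zero: "\<And>\<delta>. \<delta> > 0 \<Longrightarrow> (\<integral>y. v y * of_real (bump c \<delta> y) \<partial>lborel) = 0"
  shows "u c = 0"
proof (rule ccontr)
  assume nz: "u c \<noteq> 0"
  obtain e1 where e1: "e1 > 0" "ball c e1 \<subseteq> S" using S open_contains_ball by blast
  have "isCont u c" using u S by (simp add: continuous_on_eq_continuous_at)
  then obtain e2 where e2: "e2 > 0" "\<And>y. dist y c < e2 \<Longrightarrow> dist (u y) (u c) < norm (u c) / 2"
    using nz unfolding continuous_at_eps_delta by (meson half_gt_zero zero_less_norm_iff)
  \<comment> \<open>The support is a cube of half side \<delta>, so the factor 2 d keeps its l_1
    radius at half of both radii.\<close>
  define \<delta> where "\<delta> = min e1 e2 / (2 * real CARD('d))"
  have \<delta>: "\<delta> > 0" using e1 e2 by (simp add: \<delta>_def)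
  have near: "y \<in> S \<and> norm (u y - u c) \<le> norm (u c) / 2" if y: "bump c \<delta> y \<noteq> 0" for y
  proof -
    have "norm (y - c) \<le> (\<Sum>i\<in>UNIV. \<bar>(y - c) $ i\<bar>)" by (rule norm_le_l1_cart)
    also have "\<dots> \<le> (\<Sum>i\<in>(UNIV :: 'd set). \<delta>)" using bump_support[OF \<delta> y] by (intro sum_mono) simp
    also have "\<dots> = min e1 e2 / 2" by (simp add: \<delta>_def)
    also have "\<dots> < min e1 e2" using e1(1) e2(1) by (auto simp: min_def)
    finally have "dist y c < e1" "dist y c < e2" by (simp_all add: dist_norm)
    then show ?thesis using e1 e2(2)[of y] by (auto simp: dist_norm norm_minus_commute subset_iff mem_ball)
  qed
  have bi: "integrable lborel (bump c \<delta>)" by (rule bump_integrable[OF \<delta>])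
  have bi': "integrable lborel (\<lambda>y. u c * of_real (bump c \<delta> y))" by (intro integrable_mult_right integrable_of_real bi)
  have "(\<integral>y. v y * of_real (bump c \<delta> y) - u c * of_real (bump c \<delta> y) \<partial>lborel) = - (u c * of_real (\<delta> ^ CARD('d)))"
    using vi[OF \<delta>] bi' zero[OF \<delta>] bump_integral[OF \<delta>, of c] bi by (subst Bochner_Integration.integral_diff) simp_all
  then have "norm (u c) * \<delta> ^ CARD('d) = norm (\<integral>y. v y * of_real (bump c \<delta> y) - u c * of_real (bump c \<delta> y) \<partial>lborel)"
    using \<delta> by (simp add: norm_mult norm_power)
  also have "\<dots> \<le> (\<integral>y. norm (v y * of_real (bump c \<delta> y) - u c * of_real (bump c \<delta> y)) \<partial>lborel)"
    by (rule integral_norm_bound)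
  also have "\<dots> \<le> (\<integral>y. norm (u c) / 2 * bump c \<delta> y \<partial>lborel)"
  proof (rule integral_mono_AE)
    show "integrable lborel (\<lambda>y. norm (v y * of_real (bump c \<delta> y) - u c * of_real (bump c \<delta> y)))"
      using vi[OF \<delta>] bi' by (intro integrable_norm Bochner_Integration.integrable_diff)
    show "AE y in lborel. norm (v y * of_real (bump c \<delta> y) - u c * of_real (bump c \<delta> y)) \<le> norm (u c) / 2 * bump c \<delta> y"
      using v
    proof eventually_elim
      case (elim y)
      show ?case
      proof (cases "bump c \<delta> y = 0")
        case False
        have "norm (v y * of_real (bump c \<delta> y) - u c * of_real (bump c \<delta> y)) = norm (v y - u c) * bump c \<delta> y"
          using bump_nonneg[of c \<delta> y] by (simp add: norm_mult flip: left_diff_distrib)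
        also have "\<dots> \<le> norm (u c) / 2 * bump c \<delta> y"
          using near[OF False] elim bump_nonneg[of c \<delta> y] by (intro mult_right_mono) auto
        finally show ?thesis .
      qed simp
    qed
  qed (use bi in auto)
  also have "\<dots> = norm (u c) / 2 * \<delta> ^ CARD('d)" using bump_integral[OF \<delta>, of c] by simp
  finally show False using nz \<delta> by simp
qed

text \<open>g' and the sum H have equal pairings with all bumps on the whole space, and f equals g'
  almost everywhere on the open box, so \<open>bump_test\<close> gives f = H there. Boundary points
  of the cube, around which bumps leave it, follow by continuity and closure.\<close>

lemma freq_block_series:
  fixes g f :: "real ^ 'd \<Rightarrow> complex" and b :: "nat ^ 'd \<Rightarrow> real"
  assumes res: "resolution_of_unity \<phi>" and g: "integrable lebesgue g"
    and b: "b summable_on UNIV" "\<And>l x. norm (freq_block \<phi> l g x) \<le> b l"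
    and f: "continuous_on unit_cube f" "AE x in lebesgue_on unit_cube. f x = g x" and x: "x \<in> unit_cube"
  shows "((\<lambda>l. freq_block \<phi> l g x) has_sum f x) UNIV"
proof -
  obtain g' where g': "integrable lborel g'" "AE x in lebesgue. g x = g' x"
    "\<And>\<xi>. fourier g \<xi> = of_real (unitary_const CARD('d)) * (\<integral>x. g' x * exp (- \<i> * of_real (\<xi> \<bullet> x)) \<partial>lborel)"
    using fourier_borel_representative[OF g] by blast
  define H where "H x = (\<Sum>\<^sub>\<infinity>l. freq_block \<phi> l g x)" for x
  note FS = freq_block_series_bump[OF res g'(3) g'(1) b, folded H_def]
  have Hm: "H \<in> borel_measurable borel" using FS(1) by (intro borel_measurable_continuous_onI)
  have "f c - H c = 0" if c: "c \<in> box 0 1" for c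
  proof (rule bump_test[OF open_box c])
    have sub: "box 0 1 \<subseteq> (unit_cube :: (real ^ 'd) set)" by (rule box_subset_cbox)
    show "continuous_on (box 0 1) (\<lambda>x. f x - H x)"
      using f(1) FS(1) sub by (intro continuous_on_diff) (auto intro: continuous_on_subset)
    have "AE x in lebesgue. x \<in> unit_cube \<longrightarrow> f x = g x"
      using f(2) by (subst (asm) AE_restrict_space_iff) auto
    then have "AE y in lebesgue. y \<in> box 0 1 \<longrightarrow> g' y - H y = f y - H y"
      using g'(2) by eventually_elim (use sub in auto)
    then show "AE y in lborel. y \<in> box 0 1 \<longrightarrow> g' y - H y = f y - H y"
      by (simp add: AE_completion_iff)
    fix \<delta> :: real assume \<delta>: "\<delta> > 0"
    have bc: "integrable lborel (\<lambda>y. complex_of_real (bump c \<delta> y))" by (intro integrable_of_real bump_integrable \<delta>)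
    have bm: "(\<lambda>y. complex_of_real (bump c \<delta> y)) \<in> borel_measurable borel" using borel_measurable_integrable[OF bc] by simp
    have b1: "norm (complex_of_real (bump c \<delta> y)) \<le> 1" for y
    proof -
      have "bump c \<delta> y \<le> 1" unfolding bump_def by (intro prod_le_1) (simp add: tri_def)
      then show ?thesis using bump_nonneg[of c \<delta> y] by simp
    qed
    have i1: "integrable lborel (\<lambda>y. g' y * of_real (bump c \<delta> y))" by (rule integrable_mult_bounded[OF g'(1) bm b1])
    have "integrable lborel (\<lambda>y. of_real (bump c \<delta> y) * H y)" by (rule integrable_mult_bounded[OF bc Hm FS(2)])
    then have i2: "integrable lborel (\<lambda>y. H y * of_real (bump c \<delta> y))" by (simp add: mult.commute)
    show "integrable lborel (\<lambda>y. (g' y - H y) * of_real (bump c \<delta> y))"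
      unfolding left_diff_distrib using i1 i2 by (rule Bochner_Integration.integrable_diff)
    show "(\<integral>y. (g' y - H y) * of_real (bump c \<delta> y) \<partial>lborel) = 0"
      unfolding left_diff_distrib using i1 i2 FS(3)[OF \<delta>, of c] by (subst Bochner_Integration.integral_diff) auto
  qed
  moreover have "closure (box 0 1) = (unit_cube :: (real ^ 'd) set)"
    by (intro closure_box) (auto simp: interval_ne_empty_cart)
  moreover have "continuous_on unit_cube (\<lambda>x. f x - H x)"
    using f(1) FS(1) by (intro continuous_on_diff) (auto intro: continuous_on_subset)
  ultimately have "f x - H x = 0"
    using continuous_constant_on_closure[of "box 0 1" "\<lambda>x. f x - H x" 0 x] x by auto
  then have "f x = H x" by simp
  moreover have "(\<lambda>l. freq_block \<phi> l g x) summable_on UNIV"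
    using b by (intro abs_summable_summable[OF summable_on_comparison_test[OF b(1)]]) auto
  ultimately show ?thesis by (simp add: H_def)
qed

section \<open>The sampling error in the Besov space\<close>

lemma ennpowr_le:
  assumes "t \<le> ennreal r" "r \<ge> 0" "a > 0"
  shows "ennpowr t a \<le> ennreal (r powr a)"
proof -
  have "t \<noteq> \<infinity>" using assms by (metis ennreal_less_top infinity_ennreal_def not_le)
  moreover have "enn2real t \<le> r" using assms by (metis enn2real_leI)
  ultimately show ?thesis using assms by (auto simp: ennpowr_def intro!: ennreal_leI powr_mono2)
qed

lemma ennpowr_1: "ennpowr t 1 = t"
  by (cases t) (auto simp: ennpowr_def)

text \<open>For the third index 1 the outer powers are the identity and the norm is a plain sum of
  weighted L_p norms. The weights are positive, so finiteness makes every block p-integrable and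
  lets the norm be handled through real partial sums.\<close>

lemma SB_norm_finite:
  fixes g :: "real ^ 'd \<Rightarrow> complex"
  assumes res: "resolution_of_unity \<phi>" and g: "integrable lebesgue g" and p: "p \<ge> 1"
    and fin: "SB_norm \<phi> (1 / p) p 1 g < \<infinity>"
  defines "I \<equiv> \<lambda>l. \<integral>y. norm (freq_block \<phi> l g y) powr p \<partial>lborel"
  defines "s \<equiv> \<lambda>l :: nat ^ 'd. 2 powr (real (\<Sum>i\<in>UNIV. l $ i) / p) * I l powr (1 / p)"
  shows "integrable lborel (\<lambda>y. norm (freq_block \<phi> l g y) powr p)"
    and "finite A \<Longrightarrow> (\<Sum>l\<in>A. s l) \<le> enn2real (SB_norm \<phi> (1 / p) p 1 g)"
proof -
  obtain g' where g': "integrable lborel g'"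
    "\<And>\<xi>. fourier g \<xi> = of_real (unitary_const CARD('d)) * (\<integral>x. g' x * exp (- \<i> * of_real (\<xi> \<bullet> x)) \<partial>lborel)"
    using fourier_borel_representative[OF g] by blast
  note FB = freq_block_band_limited[OF res g'(2,1)]
  have hc: "continuous_on UNIV (freq_block \<phi> l g)" for l :: "nat ^ 'd"
    unfolding FB(3)[abs_def] by (rule continuous_on_band_limited[OF FB(1)])
  have hm: "(\<lambda>y. norm (freq_block \<phi> l g y) powr p) \<in> borel_measurable borel" for l :: "nat ^ 'd"
    using borel_measurable_continuous_onI[OF hc] by measurable
  define w where "w l = ennreal (2 powr (real (\<Sum>i\<in>UNIV. l $ i) * (1 / p) * 1))" for l :: "nat ^ 'd"
  define N where "N l = Lp_norm lebesgue p (freq_block \<phi> l g)" for l :: "nat ^ 'd"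
  have SN: "SB_norm \<phi> (1 / p) p 1 g = (\<Sum>\<^sub>\<infinity>l. w l * N l)"
    unfolding SB_norm_def w_def N_def by (simp only: ennpowr_1 div_by_1)
  have partial: "(\<Sum>l\<in>A. w l * N l) \<le> SB_norm \<phi> (1 / p) p 1 g" if "finite A" for A
    unfolding SN using that by (subst nonneg_infsum_complete) (auto intro!: SUP_upper)
  have Nfin: "N l < \<infinity>" for l
  proof (rule ccontr)
    assume "\<not> N l < \<infinity>"
    then have "N l = \<infinity>" by (simp add: less_top[symmetric])
    moreover have "w l \<noteq> 0" by (simp add: w_def)
    ultimately have "w l * N l = \<infinity>" by (simp add: ennreal_mult_top)
    then show False using partial[of "{l}"] fin by (simp add: top_unique)
  qed
  have nn: "(\<integral>\<^sup>+y. ennreal (norm (freq_block \<phi> l g y) powr p) \<partial>lebesgue) = (\<integral>\<^sup>+y. ennreal (norm (freq_block \<phi> l g y) powr p) \<partial>lborel)" for l :: "nat ^ 'd"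
    by (rule nn_integral_completion) 
  have nnfin: "(\<integral>\<^sup>+y. ennreal (norm (freq_block \<phi> l g y) powr p) \<partial>lborel) < \<infinity>" for l :: "nat ^ 'd"
    using Nfin[of l] unfolding N_def Lp_norm_def nn ennpowr_def by (auto simp: less_top split: if_splits)
  show int: "integrable lborel (\<lambda>y. norm (freq_block \<phi> l g y) powr p)" for l :: "nat ^ 'd"
    using hm nnfin[of l] by (intro integrableI_bounded) auto
  have Neq: "N l = ennreal (I l powr (1 / p))" for l
  proof -
    have "(\<integral>\<^sup>+y. ennreal (norm (freq_block \<phi> l g y) powr p) \<partial>lborel) = ennreal (I l)"
      unfolding I_def by (rule nn_integral_eq_integral[OF int]) auto
    moreover have "I l \<ge> 0" by (simp add: I_def)
    ultimately show ?thesis unfolding N_def Lp_norm_def nn ennpowr_def by simp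
  qed
  have "w l * N l = ennreal (s l)" for l
    unfolding w_def Neq s_def by (simp add: ennreal_mult)
  moreover assume A: "finite A"
  moreover have "s l \<ge> 0" for l by (simp add: s_def)
  ultimately have "ennreal (\<Sum>l\<in>A. s l) \<le> SB_norm \<phi> (1 / p) p 1 g"
    using partial[OF A] by (simp add: sum_ennreal)
  then show "(\<Sum>l\<in>A. s l) \<le> enn2real (SB_norm \<phi> (1 / p) p 1 g)"
    using fin \<open>\<And>l. s l \<ge> 0\<close> by (metis enn2real_ennreal enn2real_mono infinity_ennreal_def sum_nonneg)
qed

lemma node_in_unit:
  assumes "m \<ge> -1" "k \<in> pos_set m" "s < 3"
  shows "0 \<le> node m k s" "node m k s \<le> 1"
proof -
  have "0 \<le> node m k s \<and> node m k s \<le> 1"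
  proof (cases "m = -1")
    case True
    then show ?thesis using assms by (auto simp: node_def pos_set_def)
  next
    case False
    then have k: "0 \<le> k" "k + 1 \<le> 2 ^ nat m" using assms by (auto simp: pos_set_def)
    then have "real_of_int (k + 1) \<le> 2 ^ nat m" by (metis of_int_le_numeral_power_cancel_iff)
    moreover have "real s / 2 \<le> 1" using assms by simp
    ultimately have "of_int k + real s / 2 \<le> (2::real) ^ nat m" by simp
    then show ?thesis using False k by (simp add: node_def)
  qed
  then show "0 \<le> node m k s" "node m k s \<le> 1" by auto
qed

lemma has_sum_sum:
  fixes f :: "'a \<Rightarrow> 'b \<Rightarrow> 'c::topological_comm_monoid_add"
  assumes "\<And>i. i \<in> I \<Longrightarrow> (f i has_sum S i) A"
  shows "((\<lambda>x. \<Sum>i\<in>I. f i x) has_sum (\<Sum>i\<in>I. S i)) A"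
  using assms by (induction I rule: infinite_finite_induct) (auto intro: has_sum_add)

text \<open>The coefficient is a finite combination of values at points of the cube, so it passes
  through a series converging pointwise there.\<close>

lemma faber_coeff_has_sum:
  fixes f :: "real ^ 'd \<Rightarrow> complex"
  assumes m: "\<And>i. m $ i \<ge> -1" and k: "k \<in> pos_set_d m"
    and hs: "\<And>x. x \<in> unit_cube \<Longrightarrow> ((\<lambda>l. h l x) has_sum f x) UNIV"
  shows "((\<lambda>l. faber_coeff m k (h l)) has_sum faber_coeff m k f) UNIV"
  unfolding faber_coeff_expansion[OF m]
proof (intro has_sum_sum has_sum_cmult_right hs)
  fix s :: "'d \<Rightarrow> nat" assume "s \<in> PiE UNIV (\<lambda>_. {..<3})"
  then have "s i < 3" for i by (auto simp: PiE_def Pi_def)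
  then show "(\<chi> i. node (m $ i) (k $ i) (s i)) \<in> unit_cube"
    using node_in_unit[OF m] k by (auto simp: mem_box_cart pos_set_d_def)
qed

text \<open>The p-th root of the constant in \<open>band_limited_coeff_bound\<close>, with the
  powers of 2 from the band width left to the Besov weight.\<close>

definition coeff_const :: "real \<Rightarrow> nat \<Rightarrow> real" where
  "coeff_const p d = (schur_mass d powr (p - 1) * 100 ^ d) powr (1 / p)"

lemma coeff_const_pos: "coeff_const p d > 0"
  using schur_mass_pos[of d] by (simp add: coeff_const_def)

text \<open>The bound does not depend on m, since the variation of a kernel does not see the grid.
  Each block contributes K times its weighted norm s l; Minkowski adds finitely many blocks, and a
  limit over finite index sets adds them all.\<close>

lemma faber_coeff_SB:
  fixes f g :: "real ^ 'd \<Rightarrow> complex"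
  assumes res: "resolution_of_unity \<phi>" and p: "p \<ge> 1"
    and f: "continuous_on unit_cube f" and g: "g \<in> SB_extensions \<phi> (1 / p) p 1 f"
    and m: "\<And>i. m $ i \<ge> -1"
  shows "(\<Sum>k\<in>pos_set_d m. norm (faber_coeff m k f) powr p) \<le>
    (coeff_const p CARD('d) * enn2real (SB_norm \<phi> (1 / p) p 1 g)) powr p"
proof -
  define B where "B = enn2real (SB_norm \<phi> (1 / p) p 1 g)"
  define K where "K = coeff_const p CARD('d)"
  have K: "K > 0" by (simp add: K_def coeff_const_pos)
  have gi: "integrable lebesgue g" and gn: "SB_norm \<phi> (1 / p) p 1 g < \<infinity>" and fg: "AE x in lebesgue_on unit_cube. f x = g x"
    using g by (auto simp: SB_extensions_def SB_def)
  define h where "h l = freq_block \<phi> l g" for l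
  define I where "I l = (\<integral>y. norm (h l y) powr p \<partial>lborel)" for l
  define s where "s l = 2 powr (real (\<Sum>i\<in>UNIV. l $ i) / p) * I l powr (1 / p)" for l :: "nat ^ 'd"
  have s0: "s l \<ge> 0" for l by (simp add: s_def)
  have I0: "I l \<ge> 0" for l by (simp add: I_def)
  note SN = SB_norm_finite[OF res gi p gn, folded h_def, folded I_def, folded s_def, folded B_def]
  obtain g' where g': "integrable lborel g'"
    "\<And>\<xi>. fourier g \<xi> = of_real (unitary_const CARD('d)) * (\<integral>x. g' x * exp (- \<i> * of_real (\<xi> \<bullet> x)) \<partial>lborel)"
    using fourier_borel_representative[OF gi] by blast
  note FB = freq_block_band_limited[OF res g'(2,1), folded h_def]
  \<comment> \<open>The band width contributes 2 ^ |l|, whose p-th root is precisely the Besov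
    weight of smoothness 1/p.\<close>
  have const: "(schur_mass CARD('d) powr (p - 1) * (\<Prod>i\<in>UNIV. 100 * 2 ^ (l $ i)) * I l) = (K * s l) powr p" for l :: "nat ^ 'd"
  proof -
    have "(\<Prod>i\<in>UNIV. 100 * 2 ^ (l $ i)) = 100 ^ CARD('d) * (2::real) ^ (\<Sum>i\<in>UNIV. l $ i)"
      by (simp add: prod.distrib power_sum)
    moreover have "s l powr p = 2 ^ (\<Sum>i\<in>UNIV. l $ i) * I l"
      unfolding s_def using p I0 by (simp add: powr_mult powr_powr powr_realpow del: of_nat_sum)
    moreover have "K powr p = schur_mass CARD('d) powr (p - 1) * 100 ^ CARD('d)"
      using p schur_mass_pos[of "CARD('d)"] by (simp add: K_def coeff_const_def powr_powr)
    ultimately show ?thesis using K s0 by (simp add: powr_mult mult_ac)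
  qed
  have BL1: "(\<Sum>k\<in>pos_set_d m. norm (faber_coeff m k (h l)) powr p) \<le> (K * s l) powr p" for l
    unfolding const[symmetric] I_def
    by (rule band_limited_coeff_bound(1)[where a = "\<lambda>i. 2 ^ (l $ i)", OF FB(1) _ FB(2) FB(3) p SN(1) m]) simp_all
  have BL2: "norm (h l x) powr p \<le> (K * s l) powr p" for l x
    unfolding const[symmetric] I_def
    by (rule band_limited_coeff_bound(2)[where a = "\<lambda>i. 2 ^ (l $ i)", OF FB(1) _ FB(2) FB(3) p SN(1)]) simp_all
  \<comment> \<open>The supremum bound with the same weights gives the summable majorant needed to
    identify f with the series of its blocks.\<close>
  have hb: "norm (h l x) \<le> K * s l" for l x
  proof -
    have "(norm (h l x) powr p) powr (1 / p) \<le> ((K * s l) powr p) powr (1 / p)"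
      by (rule powr_mono2[OF _ _ BL2]) (use p in auto)
    then show ?thesis using p K s0 by (simp add: powr_powr)
  qed
  have cb: "(\<Sum>k\<in>pos_set_d m. norm (faber_coeff m k (h l)) powr p) powr (1 / p) \<le> K * s l" for l
  proof -
    have "(\<Sum>k\<in>pos_set_d m. norm (faber_coeff m k (h l)) powr p) powr (1 / p) \<le> ((K * s l) powr p) powr (1 / p)"
      using p m by (intro powr_mono2 BL1) (auto intro: sum_nonneg)
    then show ?thesis using p K s0 by (simp add: powr_powr)
  qed
  have "s summable_on UNIV"
    by (rule nonneg_bdd_above_summable_on) (auto intro!: s0 bdd_aboveI2[where M = B] SN(2))
  then have sm: "(\<lambda>l. K * s l) summable_on UNIV" by (rule summable_on_cmult_right)
  have hs: "((\<lambda>l. h l x) has_sum f x) UNIV" if "x \<in> unit_cube" for x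
    unfolding h_def by (rule freq_block_series[OF res gi sm _ f fg that]) (use hb in \<open>simp add: h_def\<close>)
  have cs: "((\<lambda>l. faber_coeff m k (h l)) has_sum faber_coeff m k f) UNIV" if "k \<in> pos_set_d m" for k
    by (rule faber_coeff_has_sum[OF m that hs])
  have fin: "(\<Sum>k\<in>pos_set_d m. norm (\<Sum>l\<in>A. faber_coeff m k (h l)) powr p) \<le> (K * B) powr p" if A: "finite A" for A
  proof -
    have "(\<Sum>k\<in>pos_set_d m. norm (\<Sum>l\<in>A. faber_coeff m k (h l)) powr p) \<le> (\<Sum>k\<in>pos_set_d m. 1 * (\<Sum>l\<in>A. norm (faber_coeff m k (h l))) powr p)"
      using p by (simp, intro sum_mono powr_mono2) (auto intro: norm_sum)
    also have "\<dots> = ((\<Sum>k\<in>pos_set_d m. 1 * (\<Sum>l\<in>A. norm (faber_coeff m k (h l))) powr p) powr (1 / p)) powr p"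
      using p by (simp add: powr_powr sum_nonneg)
    also have "\<dots> \<le> (\<Sum>l\<in>A. (\<Sum>k\<in>pos_set_d m. 1 * norm (faber_coeff m k (h l)) powr p) powr (1 / p)) powr p"
      using p by (intro powr_mono2 minkowski_sum) auto
    also have "\<dots> \<le> (\<Sum>l\<in>A. K * s l) powr p"
      using p cb by (intro powr_mono2 sum_mono) (auto intro: sum_nonneg)
    also have "\<dots> \<le> (K * B) powr p"
      using p K s0 SN(2)[OF A] by (intro powr_mono2) (auto simp: sum_distrib_left[symmetric] intro!: sum_nonneg mult_nonneg_nonneg)
    finally show ?thesis .
  qed
  \<comment> \<open>There are finitely many positions k, so the p-sum is continuous in the
    coefficients and the bound survives the limit.\<close>
  have "((\<lambda>A. \<Sum>k\<in>pos_set_d m. norm (\<Sum>l\<in>A. faber_coeff m k (h l)) powr p) \<longlongrightarrow> (\<Sum>k\<in>pos_set_d m. norm (faber_coeff m k f) powr p)) (finite_subsets_at_top UNIV)"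
    using cs p by (intro tendsto_sum tendsto_powr2 tendsto_norm tendsto_const) (auto simp: has_sum_def)
  then have "(\<Sum>k\<in>pos_set_d m. norm (faber_coeff m k f) powr p) \<le> (K * B) powr p"
    by (rule tendsto_upperbound) (auto intro!: eventually_finite_subsets_at_top_weakI fin)
  then show ?thesis by (simp add: K_def B_def)
qed

theorem theorem6p2:
  fixes \<phi> :: "nat \<Rightarrow> real \<Rightarrow> complex" and p q :: real
  assumes "resolution_of_unity \<phi>"
    and "1 \<le> p" and "p < q"
  shows "\<exists>C::real. C > 0 \<and>
    (\<forall>n::nat. n \<ge> 1 \<longrightarrow>
      (\<forall>f::real ^ 'd \<Rightarrow> complex.
         f \<in> SB_cube \<phi> (1 / p) p 1 \<and> continuous_on unit_cube f \<longrightarrow>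
         Lp_norm (lebesgue_on unit_cube) q (\<lambda>x. f x - faber_trunc n f x)
           \<le> ennreal (C * 2 powr (- real n / q) * real n powr ((real CARD('d) - 1) / q))
              * SB_cube_norm \<phi> (1 / p) p 1 f))"
proof -
  note res = assms(1) and p = assms(2) and pq = assms(3)
  define E where "E = (32 * (2 powr q * emb_const ((p + q) / 2) q)) ^ CARD('d)"
  have E: "E > 0" using emb_const_pos[of "(p + q) / 2" q] p pq by (simp add: E_def)
  define K where "K = coeff_const p CARD('d)"
  have K: "K > 0" by (simp add: K_def coeff_const_pos)
  define C where "C = E powr (1 / q) * K"
  have C: "C > 0" using E K by (simp add: C_def)
  show ?thesis
  proof (intro exI[of _ C] conjI allI impI C)
    fix n :: nat and f :: "real ^ 'd \<Rightarrow> complex"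
    assume n: "n \<ge> 1" and f: "f \<in> SB_cube \<phi> (1 / p) p 1 \<and> continuous_on unit_cube f"
    define r where "r = 2 powr (- real n / q) * real n powr ((real CARD('d) - 1) / q)"
    have r: "r > 0" using n by (simp add: r_def)
    \<comment> \<open>The claimed rate is the q-th root of the hyperbolic tail.\<close>
    have rq: "r = (real n ^ (CARD('d) - 1) * (1/2) ^ n) powr (1 / q)"
    proof -
      have "real n ^ (CARD('d) - 1) = real n powr (real CARD('d) - 1)"
        using n by (simp add: of_nat_diff flip: powr_realpow)
      moreover have "(1/2) ^ n = 2 powr (- real n)"
        by (subst powr_minus_divide, subst powr_realpow) (simp_all add: power_divide)
      ultimately show ?thesis by (simp add: r_def powr_mult powr_powr mult.commute)
    qed
    define L where "L = Lp_norm (lebesgue_on unit_cube) q (\<lambda>x. f x - faber_trunc n f x)"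
    have key: "L \<le> ennreal (C * r) * SB_norm \<phi> (1 / p) p 1 g" if g: "g \<in> SB_extensions \<phi> (1 / p) p 1 f" for g
    proof -
      define B where "B = enn2real (SB_norm \<phi> (1 / p) p 1 g)"
      have B: "B \<ge> 0" "ennreal B = SB_norm \<phi> (1 / p) p 1 g"
        using g by (auto simp: B_def SB_extensions_def SB_def)
      have "(\<integral>\<^sup>+x. ennreal (norm (f x - faber_trunc n f x) powr q) \<partial>lebesgue_on unit_cube) \<le>
          ennreal (E * (real n ^ (CARD('d) - 1) * (1/2) ^ n) * (K * B) powr q)"
        unfolding E_def K_def B_def using f g coeff_const_pos[of p "CARD('d)"]
        by (intro faber_error[OF p pq n] faber_coeff_SB[OF res p]) auto
      then have "L \<le> ennreal ((E * (real n ^ (CARD('d) - 1) * (1/2) ^ n) * (K * B) powr q) powr (1 / q))"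
        unfolding L_def Lp_norm_def using E p pq by (intro ennpowr_le) auto
      also have "(E * (real n ^ (CARD('d) - 1) * (1/2) ^ n) * (K * B) powr q) powr (1 / q) = C * r * B"
        unfolding rq C_def using E K B p pq by (simp add: powr_mult powr_powr mult_ac)
      also have "ennreal (C * r * B) = ennreal (C * r) * SB_norm \<phi> (1 / p) p 1 g"
        using B C r by (simp add: ennreal_mult flip: B(2))
      finally show ?thesis .
    qed
    \<comment> \<open>Multiplying by the reciprocal constant makes the left side a lower bound for
      the norms of all extensions, hence for their infimum; afterwards the constant is moved
      back.\<close>
    have cr: "ennreal (1 / (C * r)) * ennreal (C * r) = 1" "ennreal (C * r) * ennreal (1 / (C * r)) = 1"
      using C r by (auto simp flip: ennreal_mult)
    have "ennreal (1 / (C * r)) * L \<le> SB_cube_norm \<phi> (1 / p) p 1 f"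
      unfolding SB_cube_norm_def
    proof (rule INF_greatest)
      fix g assume "g \<in> SB_extensions \<phi> (1 / p) p 1 f"
      then have "ennreal (1 / (C * r)) * L \<le> ennreal (1 / (C * r)) * (ennreal (C * r) * SB_norm \<phi> (1 / p) p 1 g)"
        by (intro mult_left_mono key) auto
      then show "ennreal (1 / (C * r)) * L \<le> SB_norm \<phi> (1 / p) p 1 g" by (simp add: cr flip: mult.assoc)
    qed
    then have "ennreal (C * r) * (ennreal (1 / (C * r)) * L) \<le> ennreal (C * r) * SB_cube_norm \<phi> (1 / p) p 1 f"
      by (intro mult_left_mono) auto
    then have "L \<le> ennreal (C * r) * SB_cube_norm \<phi> (1 / p) p 1 f" by (simp add: cr flip: mult.assoc)
    then show "Lp_norm (lebesgue_on unit_cube) q (\<lambda>x. f x - faber_trunc n f x)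
           \<le> ennreal (C * 2 powr (- real n / q) * real n powr ((real CARD('d) - 1) / q)) * SB_cube_norm \<phi> (1 / p) p 1 f"
      by (simp add: L_def r_def mult.assoc)
  qed
qed

end
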